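(* Let $p,q,n$ be positive integers and $a,b\in\{1,-1\}$, with $p\neq 1$ when $a^nb=1$, and $q\neq 1$ when $a=1$. Then $$\begin{aligned}\int_0^\infty\frac{\ln^{q-1}(x)\operatorname{Li}_{p}(bx^{n})}{x(1-ax)}\,\mathrm{d}x={}&-a^{n-1}b\,(1+(-1)^{q})\,(q-1)!\,\Phi(a^nb,p,1)\,\Phi(a,q,1)\\ &+2a^n n^{-q}(q-1)!\sum_{j=0}^{\lfloor q/2\rfloor}\binom{p+q-2j-1}{p-1}\Phi(b,2j,1)\,\Phi(a^nb,p+q-2j,1)\\ &+a^{n-1}b\,n^{-q}(q-1)!\sum_{j=2}^{n}\sum_{k=1}^{q}\binom{p+q-k-1}{p-1}a^{j}(-1)^{k}\,\Theta(b,k,j-1,n)\,\Phi\!\left(a^nb,p+q-k,\tfrac{n-j+1}{n}\right),\end{aligned}$$ where the integral is understood as a Cauchy principal value when $b=1$ (that is, $\operatorname{Li}_p$ at arguments $>1$ is given by its principal-value integral).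
   Context: Polylogarithm: for real $x\le 1$, $\operatorname{Li}_p(x)=\frac{(-1)^{p-1}}{(p-1)!}\int_0^1\frac{x\ln^{p-1}(y)}{1-xy}\,\mathrm{d}y$; for $x>1$, $\operatorname{Li}_p(x)$ denotes the Cauchy principal value of the same integral (equivalently, the real part of the analytically continued polylogarithm). Lerch function: for $c=\pm1$, integer $q\ge1$ (with $q\neq1$ if $c=1$) and $\alpha>0$, $\Phi(c,q,\alpha)=\sum_{m=0}^\infty \frac{c^m}{(m+\alpha)^q}$. At $q=0$, $\alpha=1$ the values by analytic continuation are used: $\Phi(1,0,1)=\zeta(0)=-\tfrac12$ and $\Phi(-1,0,1)=\eta(0)=\tfrac12$. For $c=\pm1$, integer $k\ge 1$ and $0<s<r$: $\Theta(c,k,s,r)=\Phi(c,k,\tfrac{s}{r})+c(-1)^{k}\Phi(c,k,\tfrac{r-s}{r})$ if $(c,k)\ne(1,1)$, and $\Theta(1,1,s,r)=\pi\cot(\pi s/r)$. Empty sums are $0$. *)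

theory Defs
  imports "HOL-Analysis.Analysis"
begin

text \<open>Cauchy principal value of the integral of \<open>f\<close> over \<open>[a, b]\<close> with a
  singularity at the interior point \<open>c\<close>.\<close>

definition pv_integral :: "real \<Rightarrow> real \<Rightarrow> real \<Rightarrow> (real \<Rightarrow> real) \<Rightarrow> real" where
  "pv_integral a c b f =
     Lim (at_right 0) (\<lambda>\<epsilon>. integral {a..c - \<epsilon>} f + integral {c + \<epsilon>..b} f)"

text \<open>Real polylogarithm for \<open>p \<ge> 1\<close>. For \<open>x > 1\<close> the integrand has a simple pole at
  \<open>y = 1/x\<close>. Isabelle's conventions \<open>ln 0 = 0\<close> and \<open>t / 0 = 0\<close> only affect the integrand
  at single points. The integral diverges for \<open>p = x = 1\<close>, where the value
  of \<open>polylog\<close> is meaningless.\<close>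

definition polylog :: "nat \<Rightarrow> real \<Rightarrow> real" where
  "polylog p x = (-1) ^ (p - 1) / fact (p - 1) *
     (let f = (\<lambda>y. x * ln y ^ (p - 1) / (1 - x * y))
      in if x \<le> 1 then integral {0..1} f else pv_integral 0 (1 / x) 1 f)"

text \<open>Lerch function for \<open>c = 1\<close> or \<open>c = -1\<close> and \<open>\<alpha> > 0\<close>. The series diverges for \<open>q = 0\<close>; at \<open>\<alpha> = 1\<close>
  the values \<open>\<zeta>(0) = -1/2\<close> and \<open>\<eta>(0) = 1/2\<close> of the analytic continuations are used. For \<open>c = -1\<close>,
  \<open>q = 1\<close> the convergence is conditional, which \<open>suminf\<close> covers. The value is
  meaningless for \<open>c = q = 1\<close>, and for \<open>q = 0\<close> with \<open>\<alpha> \<noteq> 1\<close>.\<close>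

definition lerch :: "real \<Rightarrow> nat \<Rightarrow> real \<Rightarrow> real" where
  "lerch c q \<alpha> =
     (if q = 0 \<and> \<alpha> = 1 then (if c = 1 then - 1 / 2 else 1 / 2)
      else (\<Sum>m. c ^ m / (real m + \<alpha>) ^ q))"

definition Theta :: "real \<Rightarrow> nat \<Rightarrow> real \<Rightarrow> real \<Rightarrow> real" where
  "Theta c k s r =
     (if c = 1 \<and> k = 1 then pi * cot (pi * s / r)
      else lerch c k (s / r) + c * (-1) ^ k * lerch c k ((r - s) / r))"

end

theory Submission
  imports Defs "HOL-Real_Asymp.Real_Asymp"
begin

text \<open>
  Inserting the integral for \<open>Li\<^sub>p\<close> and interchanging the integrations reduces the claim to partial
  fractions of \<open>1 / ((1 - a x) (1 - b x\<^sup>n y))\<close> in \<open>x\<^sup>n\<close>: the substitution \<open>v = x\<^sup>n y\<close> and the binomial theorem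
  leave products of integrals \<open>\<integral> ln\<^sup>k v v\<^sup>s / (1 - b v) dv / v\<close> over \<open>(0, \<infinity>)\<close>, which inversion turns into
  \<open>\<Theta>\<close>, with integrals over \<open>y \<in> (0, 1)\<close>, which are Lerch values. For \<open>b = 1\<close> the inner integrals are
  principal values, so \<open>b\<close> is first replaced by \<open>z = b e\<^sup>i\<^sup>t\<close> with \<open>t > 0\<close>: then everything converges
  absolutely and Fubini applies. As \<open>t \<rightarrow> 0\<close> the real parts converge; one integration by parts replaces
  the pole of the integrand of \<open>Li\<^sub>p\<close> by the singularity \<open>ln \<bar>1 - x y\<bar>\<close>, dominated uniformly in \<open>t\<close>.
  The imaginary parts of the inner integrals need not vanish in the limit, but they stay bounded and are
  multiplied by imaginary parts that tend to zero.
\<close>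

subsection \<open>Integration on the half-line\<close>

text \<open>The approximating \<open>z\<close> stay on the unit circle for two reasons. There
  \<open>1 / z = cnj z\<close>, so inversion turns an integral over \<open>(1, \<infinity>)\<close>
  into the conjugate of one over \<open>(0, 1)\<close>. And \<open>norm (1 - z x)\<close> lies
  between \<open>\<bar>1 - x\<bar>\<close> and \<open>1 + x\<close>, which gives majorants that do
  not depend on \<open>z\<close>. The indicator of \<open>x < 1\<close> that regularizes the term of
  index 0 leaves two traces. The same indicator is taken from \<open>1 / (1 - a x)\<close>, which
  produces the first term of the formula. After \<open>v = y x ^ n\<close> it reads
  \<open>v < y\<close> instead of \<open>v < 1\<close>, which leaves a pure power of
  \<open>ln y\<close>; this becomes the summand \<open>j = 0\<close>, the values -1/2 and 1/2 of the
  Lerch function at \<open>q = 0\<close> being half of \<open>- b\<close>. Among the integrals over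
  \<open>v\<close> the obstacle is \<open>b = 1\<close> with no logarithm, where the Lerch integrals
  diverge as \<open>z\<close> tends to 1. In the real part the divergence cancels, leaving a
  cotangent (or 0 in the term of index 0); the imaginary part is bounded through the argument of
  \<open>1 - z\<close>. The conditions on \<open>p\<close> and \<open>q\<close> exclude this
  divergence in the other Lerch values.\<close>

lemma absolutely_integrable_on_bound:
  fixes f :: "real \<Rightarrow> 'b::euclidean_space"
  assumes "f \<in> borel_measurable borel" "S \<in> sets borel" "g integrable_on S"
    and "\<And>x. x \<in> S \<Longrightarrow> norm (f x) \<le> g x"
  shows "f absolutely_integrable_on S"
proof (rule measurable_bounded_by_integrable_imp_absolutely_integrable[OF _ _ assms(3,4)])
  have "f \<in> borel_measurable lebesgue"
    using assms(1) by (intro measurable_completion) simp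
  then show "f \<in> borel_measurable (lebesgue_on S)"
    by (rule measurable_restrict_space1)
qed (use assms(2) in auto)

text \<open>The measure \<open>dv / v\<close> is invariant under \<open>v = c * x powr r\<close> up
  to the factor \<open>\<bar>r\<bar>\<close>. The cases needed are \<open>r = -1\<close>
  (inversion), \<open>r = 1\<close> (scaling) and \<open>r = n\<close>.\<close>

lemma mellin_substitution:
  fixes F :: "real \<Rightarrow> 'a::{euclidean_space,real_normed_field}"
  assumes "S \<in> sets lebesgue" "S \<subseteq> {0<..}" "c > 0" "r \<noteq> 0"
  shows "(\<lambda>x. F (c * x powr r) / of_real x) absolutely_integrable_on S \<and>
         integral S (\<lambda>x. F (c * x powr r) / of_real x) = b / of_real \<bar>r\<bar>
     \<longleftrightarrow> (\<lambda>v. F v / of_real v) absolutely_integrable_on (\<lambda>x. c * x powr r) ` S \<and>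
         integral ((\<lambda>x. c * x powr r) ` S) (\<lambda>v. F v / of_real v) = b"
proof -
  let ?g = "\<lambda>x. c * x powr r"
  have der: "(?g has_field_derivative c * r * x powr (r - 1)) (at x within S)" if "x \<in> S" for x
    using that assms(2) by (auto intro!: derivative_eq_intros)
  have "x = y" if "x \<in> S" "y \<in> S" "c * x powr r = c * y powr r" for x y
  proof -
    have "x > 0" "y > 0" using that assms by auto
    with that assms show ?thesis
      by (metis mult_cancel_left order_less_irrefl powr_powr powr_one right_inverse less_imp_le)
  qed
  then have inj: "inj_on ?g S" by (rule inj_onI)
  have eq: "\<bar>c * r * x powr (r - 1)\<bar> *\<^sub>R (F (?g x) / of_real (?g x))
          = of_real \<bar>r\<bar> * (F (?g x) / of_real x)" if "x \<in> S" for x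
  proof -
    have "x > 0" using that assms(2) by auto
    then have "c * x powr r * inverse (c * x powr r) = 1"
      using assms by (intro right_inverse) auto
    moreover have "(of_real (x powr (r - 1)) :: 'a) = of_real (x powr r) / of_real x"
      using \<open>x > 0\<close> by (simp add: powr_diff)
    ultimately show ?thesis
      using assms(3) \<open>x > 0\<close> by (simp add: scaleR_conv_of_real abs_mult field_simps)
  qed
  have ai: "(\<lambda>x. \<bar>c * r * x powr (r - 1)\<bar> *\<^sub>R (F (?g x) / of_real (?g x))) absolutely_integrable_on S
      \<longleftrightarrow> (\<lambda>x. F (?g x) / of_real x) absolutely_integrable_on S"
  proof -
    have "(\<lambda>x. \<bar>c * r * x powr (r - 1)\<bar> *\<^sub>R (F (?g x) / of_real (?g x))) absolutely_integrable_on S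
      \<longleftrightarrow> (\<lambda>x. of_real \<bar>r\<bar> * (F (?g x) / of_real x)) absolutely_integrable_on S"
      using eq by (intro set_integrable_cong) auto
    also have "\<dots> \<longleftrightarrow> (\<lambda>x. F (?g x) / of_real x) absolutely_integrable_on S"
      using assms(4) by (intro set_integrable_mult_right_iff) auto
    finally show ?thesis .
  qed
  have int: "integral S (\<lambda>x. \<bar>c * r * x powr (r - 1)\<bar> *\<^sub>R (F (?g x) / of_real (?g x)))
     = of_real \<bar>r\<bar> * integral S (\<lambda>x. F (?g x) / of_real x)"
    by (subst integral_mult_right[symmetric]) (intro integral_cong eq)
  show ?thesis
    using has_absolute_integral_change_of_variables_real[OF assms(1) der inj, of "\<lambda>v. F v / of_real v" b]
    unfolding ai int using assms(4) by (auto simp: field_simps)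
qed

text \<open>Comes from \<open>t \<le> exp t\<close> at \<open>t = - ln v * c / k\<close>, raised to
  the power \<open>k\<close>; hence the constant \<open>(k / c) ^ k\<close>. Below, logarithms are
  paid for with a small power in this way.\<close>

lemma power_neg_ln_le:
  fixes v :: real
  assumes "0 < v" "v \<le> 1" "c > 0"
  shows "(- ln v) ^ k \<le> (real k / c) ^ k * v powr (- c)"
proof (cases "k = 0")
  case True
  have "1 \<le> v powr (-c)" using assms powr_mono'[of "-c" 0 v] by simp
  with True show ?thesis by simp
next
  case False
  have "- ln v * (c / real k) \<le> exp (- ln v * (c / real k))"
    using exp_ge_add_one_self[of "- ln v * (c / real k)"] by linarith
  also have "\<dots> = v powr (- (c / k))"
    using assms by (simp add: powr_def mult.commute)
  finally have "- ln v \<le> real k / c * v powr (- (c / k))"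
    using False assms by (simp add: field_simps)
  then have "(- ln v) ^ k \<le> (real k / c * v powr (- (c / k))) ^ k"
    using assms by (intro power_mono) auto
  also have "\<dots> = (real k / c) ^ k * (v powr (- (c / k))) ^ k"
    by (rule power_mult_distrib)
  also have "(v powr (- (c / k))) ^ k = v powr (- c)"
    using False assms by (simp add: powr_powr flip: powr_realpow)
  finally show ?thesis .
qed

text \<open>Half of the exponent \<open>s\<close> absorbs the logarithms, the other half still tends
  to 0.\<close>

lemma tendsto_powr_times_power_ln:
  assumes "s > 0"
  shows "((\<lambda>v. v powr s * (- ln v) ^ k) \<longlongrightarrow> 0) (at_right (0::real))"
proof (rule Lim_null_comparison)
  show "\<forall>\<^sub>F v in at_right 0. norm (v powr s * (- ln v) ^ k) \<le> (real k / (s/2)) ^ k * v powr (s/2)"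
    unfolding eventually_at_right_field
  proof (intro exI[of _ 1] conjI allI impI)
    fix v :: real assume v: "0 < v" "v < 1"
    have "0 \<le> v powr s * (- ln v) ^ k"
      using v by (intro mult_nonneg_nonneg zero_le_power) auto
    then have "norm (v powr s * (- ln v) ^ k) = v powr s * (- ln v) ^ k"
      by (simp only: real_norm_def abs_of_nonneg)
    also have "\<dots> \<le> v powr s * ((real k / (s/2)) ^ k * v powr (- (s/2)))"
      using v assms by (intro mult_left_mono power_neg_ln_le) auto
    also have "\<dots> = (real k / (s/2)) ^ k * (v powr s * v powr (- (s/2)))" by simp
    also have "v powr s * v powr (- (s/2)) = v powr (s/2)" by (simp flip: powr_add)
    finally show "norm (v powr s * (- ln v) ^ k) \<le> (real k / (s/2)) ^ k * v powr (s/2)" .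
  qed simp
  have "((\<lambda>v. v powr (s/2)) \<longlongrightarrow> 0) (at_right (0::real))"
    using assms by real_asymp
  then show "((\<lambda>v. (real k / (s/2)) ^ k * v powr (s/2)) \<longlongrightarrow> 0) (at_right (0::real))"
    using tendsto_mult_right_zero by blast
qed

text \<open>The Gamma integral in the variable \<open>- ln v\<close>. The induction step is an
  integration by parts whose boundary terms vanish at both ends, at 1 because of
  \<open>ln 1 = 0\<close> and at 0 because of \<open>s > 0\<close>.\<close>

lemma has_integral_powr_power_ln:
  fixes s :: real
  assumes "s > 0"
  shows "((\<lambda>v. (- ln v) ^ k * v powr (s - 1)) has_integral fact k / s ^ Suc k) {0<..<1}"
proof (induction k)
  case 0
  show ?case
    using has_integral_powr_from_0[of "s - 1" 1] assms by (simp add: has_integral_Icc_iff_Ioo)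
next
  case (Suc k)
  let ?F = "\<lambda>v::real. v powr s * (- ln v) ^ Suc k / s"
  let ?F' = "\<lambda>v. (- ln v) ^ Suc k * v powr (s - 1) - real (Suc k) / s * ((- ln v) ^ k * v powr (s - 1))"
  have der: "(?F has_real_derivative ?F' x) (at x)" if "x > 0" for x
  proof -
    have "((\<lambda>v. (- ln v) ^ Suc k) has_real_derivative real (Suc k) * (- ln x) ^ k * (- (1 / x))) (at x)"
      by (rule DERIV_cong[OF DERIV_power[OF DERIV_minus[OF DERIV_ln_divide[OF that]]]])
        (simp del: of_nat_Suc)
    from DERIV_cdivide[OF DERIV_mult[OF has_real_derivative_powr[OF that, of s] this], of s]
    show ?thesis
      by (rule DERIV_cong) (use that assms in \<open>simp add: powr_diff field_simps\<close>)
  qed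
  have cont: "continuous_on {0..1} ?F"
    unfolding continuous_on_eq_continuous_within
  proof
    fix x :: real assume x: "x \<in> {0..1}"
    show "continuous (at x within {0..1}) ?F"
    proof (cases "x = 0")
      case True
      have "((\<lambda>v. v powr s * (- ln v) ^ Suc k / s) \<longlongrightarrow> 0 / s) (at_right 0)"
        using assms by (intro tendsto_divide tendsto_powr_times_power_ln) auto
      with True show ?thesis
        by (simp add: continuous_within at_within_Icc_at_right)
    next
      case False
      with x der[of x] show ?thesis
        by (auto intro: continuous_at_imp_continuous_at_within DERIV_isCont)
    qed
  qed
  have "(?F' has_integral ?F 1 - ?F 0) {0..1}"
    by (rule fundamental_theorem_of_calculus_interior[OF _ cont])
      (use der in \<open>auto simp: has_real_derivative_iff_has_vector_derivative\<close>)
  then have "((\<lambda>v. (- ln v) ^ Suc k * v powr (s - 1) - real (Suc k) / s * ((- ln v) ^ k * v powr (s - 1)))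
      has_integral 0) {0<..<1}"
    by (simp add: has_integral_Icc_iff_Ioo)
  from has_integral_add[OF this has_integral_mult_right[OF Suc, of "real (Suc k) / s"]]
  show ?case by (simp add: field_simps)
qed

lemma integrable_neg_ln_powr:
  fixes s :: real
  assumes "s > 0"
  shows "(\<lambda>v. (- ln v) ^ k * v powr (s - 1)) absolutely_integrable_on {0<..<1}"
  using has_integral_powr_power_ln[OF assms, of k]
  by (intro nonnegative_absolutely_integrable_1) (auto simp: integrable_on_def)

section \<open>Splitting the half-line at 1, and Fubini for product majorants\<close>

lemma absolutely_integrable_Ioi_split:
  fixes f :: "real \<Rightarrow> 'a::euclidean_space"
  assumes "f absolutely_integrable_on {0<..<1}" "f absolutely_integrable_on {1<..}"
  shows "f absolutely_integrable_on {0<..}"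
    and "integral {0<..} f = integral {0<..<1} f + integral {1<..} f"
proof -
  have 1: "f absolutely_integrable_on {1..}"
    by (rule absolutely_integrable_spike_set[OF assms(2)]) (rule negligible_subset[of "{1}"], auto)+
  have eq: "{0<..} = {0<..<1} \<union> {1::real..}" by auto
  show "f absolutely_integrable_on {0<..}"
    unfolding eq by (rule set_integrable_Un[OF assms(1) 1]) auto
  have "integral {0<..} f = integral {0<..<1} f + integral {1..} f"
    unfolding eq
  proof (rule Henstock_Kurzweil_Integration.integral_Un)
    have "{0<..<1} \<inter> {1::real..} = {}" by auto
    then show "negligible ({0<..<1} \<inter> {1::real..})" by simp
  qed (use assms(1) 1 in \<open>auto intro: set_lebesgue_integral_eq_integral\<close>)
  also have "integral {1..} f = integral {1<..} f"
    by (rule integral_spike_set) (rule negligible_subset[of "{1}"], auto)+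
  finally show "integral {0<..} f = integral {0<..<1} f + integral {1<..} f" .
qed

text \<open>Inversion preserves \<open>dv / v\<close> and exchanges \<open>{0<..<1}\<close> with
  \<open>{1<..}\<close>, so an integral over the half-line becomes two over the unit interval, the
  form in which Lerch values appear.\<close>

lemma integral_Ioi_by_inversion:
  fixes F :: "real \<Rightarrow> 'a::{euclidean_space,real_normed_field}"
  assumes "(\<lambda>v. F v / of_real v) absolutely_integrable_on {0<..<1}"
    and "(\<lambda>v. F (1 / v) / of_real v) absolutely_integrable_on {0<..<1}"
  shows "(\<lambda>v. F v / of_real v) absolutely_integrable_on {0<..}"
    and "integral {0<..} (\<lambda>v. F v / of_real v) =
         integral {0<..<1} (\<lambda>v. F v / of_real v) + integral {0<..<1} (\<lambda>v. F (1 / v) / of_real v)"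
proof -
  have img: "(\<lambda>x. 1 * x powr (-1)) ` {0<..<1} = {1::real<..}"
  proof (intro equalityI subsetI)
    fix y :: real assume "y \<in> {1<..}"
    then show "y \<in> (\<lambda>x. 1 * x powr (-1)) ` {0<..<1}"
      by (intro image_eqI[of _ _ "1 / y"]) (auto simp: powr_minus powr_divide)
  qed (auto simp: powr_minus field_simps)
  have eq: "F (1 * v powr (-1)) / of_real v = F (1 / v) / of_real v" if "v \<in> {0<..<1}" for v
    using that by (simp add: powr_minus field_simps)
  let ?I = "integral {0<..<1} (\<lambda>v. F (1 / v) / of_real v)"
  have 1: "(\<lambda>v. F (1 * v powr (-1)) / of_real v) absolutely_integrable_on {0<..<1}"
    by (rule iffD2[OF set_integrable_cong[OF refl refl eq] assms(2)])
  have 2: "integral {0<..<1} (\<lambda>v. F (1 * v powr (-1)) / of_real v) = ?I / of_real \<bar>-1\<bar>"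
    by (simp only: abs_minus abs_one of_real_1 div_by_1) (intro integral_cong eq)
  have "(\<lambda>v. F v / of_real v) absolutely_integrable_on {1<..} \<and> integral {1<..} (\<lambda>v. F v / of_real v) = ?I"
    by (rule mellin_substitution[of "{0<..<1}" 1 "-1" F ?I, unfolded img, THEN iffD1, OF _ _ _ _ conjI[OF 1 2]])
      auto
  then have *: "(\<lambda>v. F v / of_real v) absolutely_integrable_on {1<..}"
      "integral {1<..} (\<lambda>v. F v / of_real v) = ?I"
    by blast+
  show "(\<lambda>v. F v / of_real v) absolutely_integrable_on {0<..}"
    and "integral {0<..} (\<lambda>v. F v / of_real v) =
         integral {0<..<1} (\<lambda>v. F v / of_real v) + integral {0<..<1} (\<lambda>v. F (1 / v) / of_real v)"
    using absolutely_integrable_Ioi_split[OF assms(1) *(1)] *(2) by auto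
qed

text \<open>The product majorant makes \<open>f\<close> integrable on the product of the two sets,
  so Fubini applies. Borel measurability is assumed because the product measure is formed from
  \<open>lborel\<close>; the results then pass to the completed measure of absolute
  integrability.\<close>

lemma fubini_product_bound:
  fixes f :: "real \<Rightarrow> real \<Rightarrow> 'a::euclidean_space"
  assumes f [measurable]: "case_prod f \<in> borel_measurable (borel \<Otimes>\<^sub>M borel)"
    and h [measurable]: "h1 \<in> borel_measurable borel" "h2 \<in> borel_measurable borel"
    and S [measurable]: "S \<in> sets borel" "T \<in> sets borel"
    and int: "h1 absolutely_integrable_on S" "h2 absolutely_integrable_on T"
    and bound: "\<And>x y. x \<in> S \<Longrightarrow> y \<in> T \<Longrightarrow> norm (f x y) \<le> h1 x * (h2 y :: real)"
  shows "(\<lambda>x. integral T (f x)) absolutely_integrable_on S"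
    and "(\<lambda>y. integral S (\<lambda>x. f x y)) absolutely_integrable_on T"
    and "integral S (\<lambda>x. integral T (f x)) = integral T (\<lambda>y. integral S (\<lambda>x. f x y))"
proof -
  have borel: "set_integrable lborel A g \<longleftrightarrow> g absolutely_integrable_on A"
    if "g \<in> borel_measurable borel" "A \<in> sets borel" for g :: "real \<Rightarrow> 'b::euclidean_space" and A
    using that unfolding set_integrable_def by (intro integrable_completion[symmetric]) auto
  define H1 where "H1 = (\<lambda>x. indicator S x * h1 x)"
  define H2 where "H2 = (\<lambda>x. indicator T x * h2 x)"
  define G where "G = (\<lambda>(x,y). indicator S x *\<^sub>R indicator T y *\<^sub>R f x y)"
  have [measurable]: "H1 \<in> borel_measurable borel" "H2 \<in> borel_measurable borel"
    unfolding H1_def H2_def by measurable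
  have [measurable]: "G \<in> borel_measurable (borel \<Otimes>\<^sub>M borel)"
    unfolding G_def by measurable
  have H: "integrable lborel H1" "integrable lborel H2"
    using int borel[of h1 S] borel[of h2 T] by (simp_all add: H1_def H2_def set_integrable_def)
  have "integrable (lborel \<Otimes>\<^sub>M lborel) (\<lambda>(x,y). H1 x * H2 y)"
    by (rule lborel_pair.Fubini_integrable) (use H in \<open>auto simp: abs_mult\<close>)
  then have G: "integrable (lborel \<Otimes>\<^sub>M lborel) G"
  proof (rule Bochner_Integration.integrable_bound)
    show "AE x in lborel \<Otimes>\<^sub>M lborel. norm (G x) \<le> norm (case x of (x, y) \<Rightarrow> H1 x * H2 y)"
      using bound by (intro AE_I2) (auto simp: G_def H1_def H2_def indicator_def intro: order_trans[OF _ abs_ge_self])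
  qed simp
  have sec: "f x absolutely_integrable_on T" if "x \<in> S" for x
    using that int(2) by (intro absolutely_integrable_on_bound[where g = "\<lambda>y. h1 x * h2 y"] bound)
      (auto intro!: set_lebesgue_integral_eq_integral)
  have sec': "(\<lambda>x. f x y) absolutely_integrable_on S" if "y \<in> T" for y
    using that int(1) by (intro absolutely_integrable_on_bound[where g = "\<lambda>x. h1 x * h2 y"] bound)
      (auto intro!: set_lebesgue_integral_eq_integral)
  have 1: "(\<integral>y. G (x, y) \<partial>lborel) = indicator S x *\<^sub>R integral T (f x)" for x
    using set_borel_integral_eq_integral(2)[of T "f x"] sec[of x] borel[of "f x" T]
    by (auto simp: G_def set_lebesgue_integral_def indicator_def)
  have 2: "(\<integral>x. G (x, y) \<partial>lborel) = indicator T y *\<^sub>R integral S (\<lambda>x. f x y)" for y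
    using set_borel_integral_eq_integral(2)[of S "\<lambda>x. f x y"] sec'[of y] borel[of "\<lambda>x. f x y" S]
    by (auto simp: G_def set_lebesgue_integral_def indicator_def mult.commute)
  have i1: "set_integrable lborel S (\<lambda>x. integral T (f x))"
    using lborel_pair.integrable_fst'[OF G] unfolding 1 set_integrable_def .
  have i2: "set_integrable lborel T (\<lambda>y. integral S (\<lambda>x. f x y))"
    using lborel_pair.integrable_snd[of "\<lambda>x y. G (x, y)"] G 
    unfolding 2 set_integrable_def by simp
  show "(\<lambda>x. integral T (f x)) absolutely_integrable_on S"
      "(\<lambda>y. integral S (\<lambda>x. f x y)) absolutely_integrable_on T"
    using i1 i2 unfolding set_integrable_def
    by (auto intro: integrable_completion[THEN iffD2] borel_measurable_integrable)
  have "(\<integral>x. \<integral>y. G (x, y) \<partial>lborel \<partial>lborel) = (\<integral>y. \<integral>x. G (x, y) \<partial>lborel \<partial>lborel)"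
    using lborel_pair.Fubini_integral[of "\<lambda>x y. G (x, y)"] G by simp
  then show "integral S (\<lambda>x. integral T (f x)) = integral T (\<lambda>y. integral S (\<lambda>x. f x y))"
    using set_borel_integral_eq_integral(2)[OF i1] set_borel_integral_eq_integral(2)[OF i2]
    unfolding 1 2 set_lebesgue_integral_def by simp
qed

subsection \<open>Majorants\<close>

text \<open>Bounds the absolute logarithm of every number between \<open>\<bar>1 - x\<bar>\<close>
  and \<open>1 + x\<close>, hence that of \<open>norm (1 - z x)\<close> for all \<open>z\<close> on
  the unit circle. As \<open>ln 0 = 0\<close>, its value at \<open>x = 1\<close> is only
  \<open>ln 2\<close>, so that point has to be excluded from the bound.\<close>

definition log_majorant :: "real \<Rightarrow> real" where
  "log_majorant x = \<bar>ln \<bar>1 - x\<bar>\<bar> + ln (1 + x)"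

lemma log_majorant_nonneg: "x \<ge> 0 \<Longrightarrow> log_majorant x \<ge> 0"
  by (simp add: log_majorant_def)

lemma borel_measurable_log_majorant [measurable]: "log_majorant \<in> borel_measurable borel"
  unfolding log_majorant_def by measurable

lemma abs_ln_norm_le_log_majorant:
  assumes "norm z = 1" "x \<ge> 0" "x \<noteq> 1"
  shows "\<bar>ln (norm (1 - z * complex_of_real x))\<bar> \<le> log_majorant x"
proof -
  let ?m = "norm (1 - z * complex_of_real x)"
  have "\<bar>1 - x\<bar> \<le> ?m"
    using norm_triangle_ineq3[of 1 "z * complex_of_real x"] assms by (simp add: norm_mult)
  moreover have "?m \<le> 1 + x"
    using norm_triangle_ineq4[of 1 "z * complex_of_real x"] assms by (simp add: norm_mult)
  moreover have "\<bar>1 - x\<bar> > 0" using assms by simp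
  ultimately have "ln \<bar>1 - x\<bar> \<le> ln ?m \<and> ln ?m \<le> ln (1 + x)"
    by (metis ln_mono order_less_le_trans)
  moreover have "ln (1 + x) \<ge> 0" using assms by simp
  ultimately show ?thesis unfolding log_majorant_def by linarith
qed

lemma has_integral_inverse_sqrt:
  "((\<lambda>v. 1 / sqrt (1 - v)) has_integral 2) {0<..<1}"
proof -
  have "((\<lambda>v. 1 / sqrt (1 - v)) has_integral (- 2 * sqrt (1 - 1)) - (- 2 * sqrt (1 - 0))) {0..1::real}"
  proof (rule fundamental_theorem_of_calculus_interior)
    fix x :: real assume x: "x \<in> {0<..<1}"
    then have "((\<lambda>x. - 2 * sqrt (1 - x)) has_real_derivative 1 / sqrt (1 - x)) (at x)"
      by (auto intro!: derivative_eq_intros simp: field_simps)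
    then show "((\<lambda>x. - 2 * sqrt (1 - x)) has_vector_derivative 1 / sqrt (1 - x)) (at x)"
      by (simp add: has_real_derivative_iff_has_vector_derivative)
  qed (auto intro!: continuous_intros)
  then show ?thesis by (simp add: has_integral_Icc_iff_Ioo)
qed

text \<open>Uses \<open>w = sqrt (1 - v)\<close>, \<open>ln t \<le> t - 1\<close> at
  \<open>t = 1 / w\<close>, and \<open>w * w \<le> w\<close>. The factor \<open>v\<close>
  compensates the weight \<open>1 / v\<close> at 0, while the singularity at 1 stays
  integrable.\<close>

lemma log_majorant_le:
  assumes "0 < v" "v < 1"
  shows "log_majorant v \<le> 2 * v / sqrt (1 - v) + v"
proof -
  define w where "w = sqrt (1 - v)"
  have w: "0 < w" "w < 1" "v = 1 - w\<^sup>2" using assms by (auto simp: w_def)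
  have "- ln (1 - v) = 2 * ln (1 / w)"
    using w by (simp add: ln_div ln_realpow)
  also have "\<dots> \<le> 2 * (1 / w - 1)"
    using w ln_le_minus_one[of "1 / w"] by simp
  also have "\<dots> = 2 * (1 - w) / w" using w by (simp add: field_simps)
  also have "\<dots> \<le> 2 * v / w"
  proof -
    have "w * w \<le> w * 1" using w by (intro mult_left_mono) auto
    then show ?thesis using w by (intro divide_right_mono) (auto simp: power2_eq_square)
  qed
  finally have "- ln (1 - v) \<le> 2 * v / sqrt (1 - v)" unfolding w_def .
  moreover have "ln (1 + v) \<le> v" using assms by (intro ln_add_one_self_le_self) auto
  moreover have "ln (1 - v) \<le> 0" using assms by simp
  ultimately show ?thesis using assms by (simp add: log_majorant_def)
qed

lemma log_majorant_inverse_le: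
  assumes "0 < v" "v < 1"
  shows "log_majorant (1 / v) \<le> log_majorant v + 2 * (- ln v)"
proof -
  have "\<bar>1 - 1 / v\<bar> = (1 - v) / v" using assms by (simp add: field_simps)
  then have "ln \<bar>1 - 1 / v\<bar> = ln (1 - v) - ln v" using assms by (simp add: ln_div)
  moreover have "1 + 1 / v = (1 + v) / v" using assms by (simp add: field_simps)
  then have "ln (1 + 1 / v) = ln (1 + v) - ln v" using assms by (simp add: ln_div)
  moreover have "ln v < 0" "ln (1 - v) < 0" using assms by simp_all
  moreover have "\<bar>1 - v\<bar> = 1 - v" using assms by simp
  ultimately show ?thesis unfolding log_majorant_def by linarith
qed

text \<open>Separates the singularities at 0 and at 1: on either side of 1/2 the factor that is not
  singular there is at most 2.\<close>

lemma powr_over_sqrt_le: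
  assumes "0 < v" "v < 1" "0 < c" "c < 1"
  shows "v powr (- c) / sqrt (1 - v) \<le> 2 * v powr (- c) + 2 * (1 / sqrt (1 - v))"
proof (cases "v \<le> 1 / 2")
  case True
  have "1 / 2 \<le> sqrt (1 - v)"
    using True by (intro real_le_rsqrt) (simp add: power2_eq_square)
  then have "1 / sqrt (1 - v) \<le> 2" using assms by (simp add: field_simps)
  then have "v powr (- c) * (1 / sqrt (1 - v)) \<le> v powr (- c) * 2"
    by (intro mult_left_mono) auto
  moreover have "2 * (1 / sqrt (1 - v)) \<ge> 0" using assms by simp
  moreover have "v powr (- c) / sqrt (1 - v) = v powr (- c) * (1 / sqrt (1 - v))" by simp
  ultimately show ?thesis by linarith
next
  case False
  have "v powr (- c) \<le> (1 / 2) powr (- c)"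
    using False assms by (intro powr_mono2') auto
  also have "\<dots> = 2 powr c" by (simp add: powr_divide powr_minus)
  also have "\<dots> \<le> 2 powr 1" using assms by (intro powr_mono) auto
  finally have "v powr (- c) * (1 / sqrt (1 - v)) \<le> 2 * (1 / sqrt (1 - v))"
    using assms by (intro mult_right_mono) auto
  moreover have "v powr (- c) \<ge> 0" by simp
  moreover have "v powr (- c) / sqrt (1 - v) = v powr (- c) * (1 / sqrt (1 - v))" by simp
  ultimately show ?thesis by linarith
qed

text \<open>\<open>log_majorant\<close> is \<open>O(v)\<close> at 0 and \<open>O(ln v)\<close> at
  infinity; convergence there is due to \<open>c < 1\<close> and \<open>c > 0\<close>
  respectively.\<close>

lemma log_majorant_integrable:
  assumes "0 < c" "c < 1"
  shows "(\<lambda>v. log_majorant v * v powr (- c) / v) absolutely_integrable_on {0<..}"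
proof -
  \<comment> \<open>The constants 5 and 4 collect
    \<open>2 * (2 * v powr (- c) + 2 / sqrt (1 - v)) + v powr (- c)\<close>.\<close>
  define h where "h = (\<lambda>v. 5 * v powr (- c) + 4 * (1 / sqrt (1 - v)))"
  have "(\<lambda>v::real. v powr (- c)) integrable_on {0<..<1}"
    using has_integral_powr_power_ln[of "1 - c" 0] assms by (auto simp: integrable_on_def)
  then have h: "h integrable_on {0<..<1}"
    unfolding h_def using has_integral_inverse_sqrt
    by (intro integrable_add integrable_on_mult_right) (auto simp: integrable_on_def)
  have le: "log_majorant v * v powr (- c) / v \<le> h v" if "0 < v" "v < 1" for v
  proof -
    have "log_majorant v * v powr (- c) / v \<le> (2 * v / sqrt (1 - v) + v) * v powr (- c) / v"
      using that by (intro divide_right_mono mult_right_mono log_majorant_le) auto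
    also have "\<dots> = 2 * (v powr (- c) / sqrt (1 - v)) + v powr (- c)"
      using that by (simp add: field_simps)
    also have "\<dots> \<le> h v"
      using powr_over_sqrt_le[OF that assms] by (simp add: h_def)
    finally show ?thesis .
  qed
  have le': "log_majorant (1 / v) * (1 / v) powr (- c) / v \<le> h v + 2 * ((- ln v) ^ 1 * v powr (c - 1))"
    if "0 < v" "v < 1" for v
  proof -
    have pw: "(1 / v) powr (- c) = v powr c" "v powr (c - 1) = v powr c / v"
      using that by (auto simp: powr_divide powr_minus powr_diff field_simps)
    have "log_majorant (1 / v) * (1 / v) powr (- c) / v
        \<le> (log_majorant v + 2 * (- ln v)) * (1 / v) powr (- c) / v"
      using that by (intro divide_right_mono mult_right_mono log_majorant_inverse_le) auto
    also have "\<dots> = log_majorant v * v powr c / v + 2 * ((- ln v) ^ 1 * v powr (c - 1))"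
      unfolding pw using that by (simp add: field_simps)
    also have "log_majorant v * v powr c / v \<le> log_majorant v * v powr (- c) / v"
      using that assms by (intro divide_right_mono mult_left_mono log_majorant_nonneg powr_mono') auto
    also have "\<dots> \<le> h v" by (rule le[OF that])
    finally show ?thesis by simp
  qed
  have 1: "(\<lambda>v. log_majorant v * v powr (- c) / of_real v) absolutely_integrable_on {0<..<1}"
    using le h by (intro absolutely_integrable_on_bound[where g = h]) (auto simp: abs_mult log_majorant_nonneg)
  have 2: "(\<lambda>v. log_majorant (1 / v) * (1 / v) powr (- c) / of_real v) absolutely_integrable_on {0<..<1}"
  proof (rule absolutely_integrable_on_bound)
    show "(\<lambda>v. h v + 2 * ((- ln v) ^ 1 * v powr (c - 1))) integrable_on {0<..<1}"
      using has_integral_powr_power_ln[OF assms(1), of 1]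
      by (intro integrable_add[OF h] integrable_on_mult_right) (auto simp: integrable_on_def)
  qed (use le' in \<open>auto simp: abs_mult log_majorant_nonneg\<close>)
  show ?thesis
    using integral_Ioi_by_inversion(1)[of "\<lambda>v. log_majorant v * v powr (- c)"] 1 2 by simp
qed

section \<open>Size of the kernel that multiplies the polylogarithm\<close>

definition log_kernel :: "nat \<Rightarrow> real \<Rightarrow> real \<Rightarrow> real" where
  "log_kernel q a x = ln x ^ (q - 1) / (x * (1 - a * x))"

lemma borel_measurable_log_kernel [measurable]: "log_kernel q a \<in> borel_measurable borel"
  unfolding log_kernel_def by measurable

text \<open>If \<open>a = 1\<close>, one logarithm is spent on the zero of \<open>1 - u\<close>:
  \<open>- ln u / (1 - u) \<le> 1 - ln u\<close>, by \<open>ln t \<le> t - 1\<close> at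
  \<open>t = 1 / u\<close>. If \<open>a = -1\<close>, the denominator is at least 1.\<close>

lemma power_ln_over_le:
  fixes a :: real
  assumes "a \<in> {1, -1}" "a = 1 \<Longrightarrow> m \<noteq> 0" "c > 0"
  obtains C where "C \<ge> 1" "\<And>u. 0 < u \<Longrightarrow> u < 1 \<Longrightarrow> (- ln u) ^ m / \<bar>1 - a * u\<bar> \<le> C * u powr (- c)"
proof -
  define K where "K = (\<lambda>k. (real k / c) ^ k)"
  have K: "(- ln u) ^ k \<le> K k * u powr (- c)" if "0 < u" "u < 1" for u k
    unfolding K_def using that assms by (intro power_neg_ln_le) auto
  have K0: "K k \<ge> 0" for k using assms by (simp add: K_def)
  \<comment> \<open>The summand 1 gives \<open>C \<ge> 1\<close>, which later covers the kernel at
    \<open>x = 1\<close>, where it equals 1/2 if \<open>a = -1\<close> and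
    \<open>q = 1\<close>.\<close>
  define C where "C = 1 + K m + K (m - 1)"
  have "(- ln u) ^ m / \<bar>1 - a * u\<bar> \<le> (K m + K (m - 1)) * u powr (- c)" if u: "0 < u" "u < 1" for u
  proof (cases "a = 1")
    case True
    then obtain k where k: "m = Suc k" using assms not0_implies_Suc by blast
    have "ln (1 / u) \<le> 1 / u - 1" using u by (intro ln_le_minus_one) auto
    then have "- ln u * u \<le> (1 / u - 1) * u" using u by (intro mult_right_mono) (auto simp: ln_div)
    also have "(1 / u - 1) * u = 1 - u" using u by (simp add: field_simps)
    finally have "- ln u \<le> (1 - u) * (1 + (- ln u))" by (simp add: algebra_simps)
    then have "- ln u / (1 - u) \<le> 1 + (- ln u)" using u by (simp add: field_simps)
    then have "(- ln u / (1 - u)) * (- ln u) ^ k \<le> (1 + (- ln u)) * (- ln u) ^ k"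
      using u by (intro mult_right_mono) auto
    also have "\<dots> = (- ln u) ^ (m - 1) + (- ln u) ^ m" by (simp add: k algebra_simps)
    also have "\<dots> \<le> (K m + K (m - 1)) * u powr (- c)"
      using K[OF u, of m] K[OF u, of "m - 1"] by (simp add: algebra_simps)
    finally show ?thesis using True u by (simp add: k)
  next
    case False
    then have "\<bar>1 - a * u\<bar> \<ge> 1" using assms u by auto
    then have "(- ln u) ^ m / \<bar>1 - a * u\<bar> \<le> (- ln u) ^ m"
      using u by (simp add: divide_le_eq mult_le_cancel_left1) 
    also have "\<dots> \<le> K m * u powr (- c)" using K u by blast
    also have "\<dots> \<le> (K m + K (m - 1)) * u powr (- c)"
      using K0 by (intro mult_right_mono) auto
    finally show ?thesis .
  qed
  moreover have "(K m + K (m - 1)) * u powr (- c) \<le> C * u powr (- c)" for u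
    by (intro mult_right_mono) (auto simp: C_def)
  ultimately have "(- ln u) ^ m / \<bar>1 - a * u\<bar> \<le> C * u powr (- c)" if "0 < u" "u < 1" for u
    using that order_trans by blast
  moreover have "C \<ge> 1" using K0 by (simp add: C_def)
  ultimately show thesis using that by blast
qed

text \<open>Up to logarithms the kernel has size \<open>1 / x\<close> at 0 and
  \<open>1 / x ^ 2\<close> at infinity; the exponent -3/2 lies halfway, and integrability against
  \<open>x powr (1/2)\<close> remains. The pointwise bound serves \<open>p = 1\<close>, the
  integrability serves \<open>p \<ge> 2\<close> and Fubini.\<close>

lemma log_kernel_bound:
  fixes a :: real
  assumes "a \<in> {1, -1}" "q \<ge> 1" "a = 1 \<Longrightarrow> q \<noteq> 1"
  obtains C where "C \<ge> 0" "\<And>x. x > 0 \<Longrightarrow> \<bar>log_kernel q a x\<bar> \<le> C * x powr (- 3 / 2)"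
    and "(\<lambda>x. log_kernel q a x * x powr (1/2)) absolutely_integrable_on {0<..}"
proof -
  obtain C where C: "C \<ge> 1" 
      "\<And>u. 0 < u \<Longrightarrow> u < 1 \<Longrightarrow> (- ln u) ^ (q - 1) / \<bar>1 - a * u\<bar> \<le> C * u powr (- (1/4))"
    \<comment> \<open>Any exponent below 1/2 would do; 1/4 leads to the integrable
      \<open>u powr (- (3/4))\<close>.\<close>
    using power_ln_over_le[of a "q - 1" "1/4"] assms by auto
  define K where "K = (\<lambda>u. (- ln u) ^ (q - 1) / \<bar>1 - a * u\<bar>)"
  have CK: "K u \<le> C * u powr (- (1/4))" if "0 < u" "u < 1" for u
    using C(2)[OF that] by (simp add: K_def)
  define F where "F = (\<lambda>x. ln x ^ (q - 1) / (1 - a * x) * x powr (1/2))"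
  have small: "\<bar>log_kernel q a u\<bar> = K u / u" if "0 < u" "u < 1" for u
    using that by (simp add: log_kernel_def K_def abs_mult power_abs)
  have inv: "\<bar>ln (1 / u) ^ (q - 1) / (1 - a * (1 / u))\<bar> = K u * u" if "0 < u" "u < 1" for u
  proof -
    have "\<bar>1 - a * (1 / u)\<bar> = \<bar>1 - a * u\<bar> / u"
      using that assms by (auto simp: field_simps abs_if)
    then show ?thesis using that by (simp add: K_def abs_mult power_abs ln_div)
  qed
  have F: "\<bar>F u\<bar> / u \<le> C * u powr (- (3/4))" "\<bar>F (1 / u)\<bar> / u \<le> C * u powr (- (3/4))"
    if u: "0 < u" "u < 1" for u
  proof -
    have "\<bar>F u\<bar> / u = K u * (u powr (1/2) / u)"
      using u by (simp add: F_def K_def abs_mult power_abs)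
    also have "u powr (1/2) / u = u powr (- (1/2))"
      using u powr_diff[of u "1/2" 1] by simp
    also have "K u * u powr (- (1/2)) \<le> C * u powr (- (1/4)) * u powr (- (1/2))"
      using u by (intro mult_right_mono CK) auto
    also have "\<dots> = C * u powr (- (3/4))" by (simp flip: powr_add)
    finally show "\<bar>F u\<bar> / u \<le> C * u powr (- (3/4))" .
    have "\<bar>F (1 / u)\<bar> / u = K u * u * (1 / u) powr (1/2) / u"
      unfolding F_def abs_mult inv[OF u] by simp
    also have "\<dots> = K u * u powr (- (1/2))"
      using u by (simp add: powr_divide powr_minus field_simps)
    also have "K u * u powr (- (1/2)) \<le> C * u powr (- (1/4)) * u powr (- (1/2))"
      using u by (intro mult_right_mono CK) auto
    also have "\<dots> = C * u powr (- (3/4))" by (simp flip: powr_add)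
    finally show "\<bar>F (1 / u)\<bar> / u \<le> C * u powr (- (3/4))" .
  qed
  have h: "(\<lambda>u. C * u powr (- (3/4))) integrable_on {0<..<1}"
    using has_integral_powr_power_ln[of "1/4" 0]
    by (intro integrable_on_mult_right) (auto simp: integrable_on_def)
  have [measurable]: "F \<in> borel_measurable borel" unfolding F_def by measurable
  have "(\<lambda>v. F v / of_real v) absolutely_integrable_on {0<..<1}"
    "(\<lambda>v. F (1 / v) / of_real v) absolutely_integrable_on {0<..<1}"
    using F by (intro absolutely_integrable_on_bound[OF _ _ h]; auto)+
  from integral_Ioi_by_inversion(1)[OF this]
  have "(\<lambda>v. F v / v) absolutely_integrable_on {0<..}" by simp
  also have "(\<lambda>v. F v / v) = (\<lambda>x. log_kernel q a x * x powr (1/2))"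
    by (simp add: F_def log_kernel_def fun_eq_iff)
  finally have int: "(\<lambda>x. log_kernel q a x * x powr (1/2)) absolutely_integrable_on {0<..}" .
  have "\<bar>log_kernel q a x\<bar> \<le> C * x powr (- 3 / 2)" if "x > 0" for x
  proof -
    consider "x < 1" | "x = 1" | "x > 1" by linarith
    then show ?thesis
    proof cases
      case 1
      have "\<bar>log_kernel q a x\<bar> \<le> C * x powr (- (1/4)) / x"
        unfolding small[OF that 1] using CK[OF that 1] that by (intro divide_right_mono) auto
      also have "\<dots> = C * x powr (- (5/4))" 
        using that powr_diff[of x "-(1/4)" 1] by simp
      also have "\<dots> \<le> C * x powr (- 3 / 2)"
        using that 1 C by (intro mult_left_mono powr_mono') auto
      finally show ?thesis .
    next
      case 2
      then show ?thesis using assms C by (auto simp: log_kernel_def power_0_left)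
    next
      case 3
      define u where "u = 1 / x"
      have u: "0 < u" "u < 1" "x = 1 / u" using 3 by (auto simp: u_def)
      have "\<bar>log_kernel q a x\<bar> = \<bar>ln (1 / u) ^ (q - 1) / (1 - a * (1 / u))\<bar> * u"
        using u(1) by (simp add: log_kernel_def u(3) abs_mult)
      also have "\<dots> = K u * u\<^sup>2" unfolding inv[OF u(1,2)] by (simp add: power2_eq_square)
      also have "\<dots> \<le> C * u powr (- (1/4)) * u\<^sup>2"
        using u by (intro mult_right_mono CK) auto
      also have "\<dots> = C * u powr (7/4)" using u by (simp flip: powr_add powr_numeral)
      also have "\<dots> \<le> C * u powr (3/2)" using u C by (intro mult_left_mono powr_mono') auto
      also have "u powr (3/2) = x powr (- 3 / 2)" using u by (simp add: powr_divide powr_minus)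
      finally show ?thesis .
    qed
  qed
  then show thesis using that[of C] C int by auto
qed

subsection \<open>Lerch values as integrals\<close>

lemma lerch_kernel_integrable:
  fixes c :: real
  assumes "c \<in> {1, -1}" "s > 0" "c = 1 \<Longrightarrow> k \<noteq> 0"
  shows "(\<lambda>v. (- ln v) ^ k * v powr (s - 1) / \<bar>1 - c * v\<bar>) integrable_on {0<..<1}"
proof -
  \<comment> \<open>Half of \<open>s\<close> is spent on the logarithms and the pole, the other half
    keeps the power integrable.\<close>
  obtain C where C: "C \<ge> 1" "\<And>u. 0 < u \<Longrightarrow> u < 1 \<Longrightarrow> (- ln u) ^ k / \<bar>1 - c * u\<bar> \<le> C * u powr (- (s / 2))"
    using power_ln_over_le[of c k "s / 2"] assms by auto
  have "(\<lambda>v. (- ln v) ^ k * v powr (s - 1) / \<bar>1 - c * v\<bar>) absolutely_integrable_on {0<..<1}"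
  proof (rule absolutely_integrable_on_bound)
    show "(\<lambda>v. C * v powr (s / 2 - 1)) integrable_on {0<..<1}"
      using has_integral_powr_power_ln[of "s / 2" 0] assms
      by (intro integrable_on_mult_right) (auto simp: integrable_on_def)
    fix v :: real assume v: "v \<in> {0<..<1}"
    have "norm ((- ln v) ^ k * v powr (s - 1) / \<bar>1 - c * v\<bar>) = (- ln v) ^ k / \<bar>1 - c * v\<bar> * v powr (s - 1)"
      using v by (simp add: abs_mult power_abs)
    also have "\<dots> \<le> C * v powr (- (s / 2)) * v powr (s - 1)"
      using v by (intro mult_right_mono C) auto
    also have "\<dots> = C * v powr (s / 2 - 1)"
      by (simp flip: powr_add)
    finally show "norm ((- ln v) ^ k * v powr (s - 1) / \<bar>1 - c * v\<bar>) \<le> C * v powr (s / 2 - 1)" .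
  qed auto
  then show ?thesis by (rule set_lebesgue_integral_eq_integral)
qed

text \<open>The geometric series of \<open>1 / (1 - c * v)\<close>, integrated term by term. For
  \<open>c = -1\<close>, \<open>k = 0\<close> the resulting series converges only conditionally;
  dominated convergence still applies, since the partial sums are
  \<open>h v * (1 - (c * v) ^ N)\<close>, hence at most \<open>2 * \<bar>h v\<bar>\<close>.\<close>

lemma integral_eq_lerch:
  fixes c :: real
  assumes "c \<in> {1, -1}" "s > 0" "c = 1 \<Longrightarrow> k \<noteq> 0"
  shows "((\<lambda>v. (- ln v) ^ k * v powr (s - 1) / (1 - c * v)) has_integral fact k * lerch c (Suc k) s) {0<..<1}"
proof -
  define h where "h = (\<lambda>v. (- ln v) ^ k * v powr (s - 1) / (1 - c * v))"
  define f where "f = (\<lambda>N v. \<Sum>m<N. c ^ m * ((- ln v) ^ k * v powr (real m + s - 1)))"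
  define t where "t = (\<lambda>m. c ^ m * (fact k / (real m + s) ^ Suc k))"
  have cv: "\<bar>c * v\<bar> < 1" "1 - c * v > 0" if "v \<in> {0<..<1}" for v
    using that assms(1) by auto
  have f: "(f N has_integral (\<Sum>m<N. t m)) {0<..<1}" for N
    unfolding f_def t_def using assms(2)
    by (intro has_integral_sum has_integral_mult_right has_integral_powr_power_ln) auto
  have f_eq: "f N v = h v * (1 - (c * v) ^ N)" if v: "v \<in> {0<..<1}" for N v
  proof -
    have "f N v = (\<Sum>m<N. (- ln v) ^ k * v powr (s - 1) * (c * v) ^ m)"
      unfolding f_def
    proof (intro sum.cong refl)
      fix m
      have "v powr (real m + s - 1) = v powr (s - 1) * v ^ m"
        using v by (simp add: powr_add[symmetric] powr_realpow[symmetric] algebra_simps)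
      then show "c ^ m * ((- ln v) ^ k * v powr (real m + s - 1)) = (- ln v) ^ k * v powr (s - 1) * (c * v) ^ m"
        by (simp add: power_mult_distrib)
    qed
    also have "\<dots> = (- ln v) ^ k * v powr (s - 1) * ((1 - (c * v) ^ N) / (1 - c * v))"
      using cv[OF v] by (simp add: sum_gp_strict flip: sum_distrib_left)
    finally show ?thesis by (simp add: h_def)
  qed
  have int: "(\<lambda>v. 2 * ((- ln v) ^ k * v powr (s - 1) / \<bar>1 - c * v\<bar>)) integrable_on {0<..<1}"
    by (intro integrable_on_mult_right lerch_kernel_integrable assms)
  have bound: "norm (f N v) \<le> 2 * ((- ln v) ^ k * v powr (s - 1) / \<bar>1 - c * v\<bar>)" if v: "v \<in> {0<..<1}" for N v
  proof -
    have "norm (f N v) = \<bar>h v\<bar> * \<bar>1 - (c * v) ^ N\<bar>"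
      unfolding f_eq[OF v] by (simp add: abs_mult)
    also have "\<dots> \<le> \<bar>h v\<bar> * 2"
    proof (intro mult_left_mono)
      have "\<bar>(c * v) ^ N\<bar> \<le> 1"
        unfolding power_abs using cv[OF v] by (intro power_le_one) auto
      then show "\<bar>1 - (c * v) ^ N\<bar> \<le> 2" by linarith
    qed simp
    also have "\<bar>h v\<bar> = (- ln v) ^ k * v powr (s - 1) / \<bar>1 - c * v\<bar>"
      using v by (simp add: h_def abs_mult power_abs)
    finally show ?thesis by (simp only: mult.commute[of 2])
  qed
  have lim: "(\<lambda>N. f N v) \<longlonglongrightarrow> h v" if v: "v \<in> {0<..<1}" for v
  proof -
    have "(\<lambda>N. h v * (1 - (c * v) ^ N)) \<longlonglongrightarrow> h v * (1 - 0)"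
      using cv[OF v] by (intro tendsto_intros LIMSEQ_power_zero) auto
    then show ?thesis using f_eq[OF v] by simp
  qed
  have conv: "h integrable_on {0<..<1}" "(\<lambda>N. integral {0<..<1} (f N)) \<longlonglongrightarrow> integral {0<..<1} h"
    by (rule dominated_convergence[OF _ int bound lim]; use f in \<open>auto simp: integrable_on_def\<close>)+
  then have "t sums integral {0<..<1} h"
    by (simp add: sums_def integral_unique[OF f])
  then have "(\<lambda>m. t m / fact k) sums (integral {0<..<1} h / fact k)"
    by (rule sums_divide)
  then have "lerch c (Suc k) s = integral {0<..<1} h / fact k"
    by (simp add: lerch_def t_def sums_iff)
  then have "fact k * lerch c (Suc k) s = integral {0<..<1} h" by simp
  then show ?thesis using conv(1) unfolding h_def by (simp add: has_integral_integral)
qed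

section \<open>Lerch integrals on the unit circle and their limits\<close>

lemma norm_one_minus_ge:
  assumes "norm z = 1" "0 \<le> v" "v \<le> 1"
  shows "norm (1 - z * complex_of_real v) \<ge> norm (1 - z) / 2"
    and "norm (1 - z * complex_of_real v) \<ge> 1 - v"
proof -
  show 1: "norm (1 - z * complex_of_real v) \<ge> 1 - v"
    using norm_triangle_ineq2[of 1 "z * complex_of_real v"] assms by (simp add: norm_mult)
  \<comment> \<open>\<open>1 - z\<close> and \<open>1 - z * v\<close> differ by a number of norm
    \<open>1 - v\<close>, which is itself at most \<open>norm (1 - z * v)\<close>.\<close>
  have "1 - z = (1 - z * complex_of_real v) - z * complex_of_real (1 - v)"
    by (simp add: algebra_simps)
  then have "norm (1 - z) \<le> norm (1 - z * complex_of_real v) + norm (z * complex_of_real (1 - v))"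
    by (metis norm_triangle_ineq4)
  also have "norm (z * complex_of_real (1 - v)) = 1 - v"
    using assms by (simp only: norm_mult norm_of_real) simp
  finally show "norm (1 - z * complex_of_real v) \<ge> norm (1 - z) / 2"
    using 1 by linarith
qed

text \<open>The integral of \<open>integral_eq_lerch\<close> at a complex argument:
  \<open>fact k\<close> times the Lerch transcendent of order \<open>Suc k\<close> at
  \<open>z\<close>. If \<open>norm z = 1\<close> and \<open>z \<noteq> 1\<close>, the integrand has
  no pole and every \<open>k\<close> is allowed.\<close>

definition lerch_int :: "nat \<Rightarrow> real \<Rightarrow> complex \<Rightarrow> complex" where
  "lerch_int k s z =
     integral {0<..<1} (\<lambda>v. complex_of_real ((- ln v) ^ k * v powr (s - 1)) / (1 - z * complex_of_real v))"

lemma lerch_int_integrable: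
  assumes "norm z = 1" "z \<noteq> 1" "s > 0"
  shows "(\<lambda>v. complex_of_real ((- ln v) ^ k * v powr (s - 1)) / (1 - z * complex_of_real v))
           absolutely_integrable_on {0<..<1}"
proof (rule absolutely_integrable_on_bound)
  show "(\<lambda>v. ((- ln v) ^ k * v powr (s - 1)) * (2 / norm (1 - z))) integrable_on {0<..<1}"
    using has_integral_powr_power_ln[OF assms(3), of k]
    by (intro integrable_on_mult_left) (auto simp: integrable_on_def)
  fix v :: real assume v: "v \<in> {0<..<1}"
  have pos: "norm (1 - z) / 2 > 0" using assms by simp
  have "norm (complex_of_real ((- ln v) ^ k * v powr (s - 1)) / (1 - z * complex_of_real v))
      = ((- ln v) ^ k * v powr (s - 1)) / norm (1 - z * complex_of_real v)"
    using v unfolding norm_divide norm_of_real by (simp add: abs_mult power_abs)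
  also have "\<dots> \<le> ((- ln v) ^ k * v powr (s - 1)) / (norm (1 - z) / 2)"
    using v pos norm_one_minus_ge(1)[OF assms(1), of v]
    by (intro divide_left_mono mult_pos_pos mult_nonneg_nonneg zero_le_power) auto
  also have "\<dots> = ((- ln v) ^ k * v powr (s - 1)) * (2 / norm (1 - z))" by simp
  finally show "norm (complex_of_real ((- ln v) ^ k * v powr (s - 1)) / (1 - z * complex_of_real v))
    \<le> ((- ln v) ^ k * v powr (s - 1)) * (2 / norm (1 - z))" .
qed auto

lemma cnj_lerch_int: "cnj (lerch_int k s z) = lerch_int k s (cnj z)"
  unfolding lerch_int_def by (subst integral_cnj) simp

text \<open>The point \<open>c\<close> is approached along the circle by a sequence, the form that
  dominated convergence takes. The angle is at most 1, hence below \<open>pi / 2\<close>: its sine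
  is positive, which keeps the points off the real axis, and its cosine is nonnegative.\<close>

abbreviation unit_seq :: "real \<Rightarrow> nat \<Rightarrow> complex" where
  "unit_seq c N \<equiv> complex_of_real c * cis (1 / real (Suc N))"

lemma unit_seq_tendsto: "unit_seq c \<longlonglongrightarrow> complex_of_real c"
proof -
  have "(\<lambda>N. complex_of_real c * cis (1 / real (Suc N))) \<longlonglongrightarrow> complex_of_real c * cis 0"
    by (intro tendsto_mult tendsto_const tendsto_cis[OF LIMSEQ_Suc] lim_1_over_n)
  then show ?thesis by simp
qed

lemma unit_seq_angle:
  "0 < 1 / real (Suc N)" "1 / real (Suc N) < pi / 2" "1 / real (Suc N) < pi"
proof -
  have "1 / real (Suc N) \<le> 1" by simp
  then show "1 / real (Suc N) < pi / 2" "1 / real (Suc N) < pi" using pi_gt3 by linarith+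
qed simp

lemma norm_unit_seq: "c \<in> {1, -1} \<Longrightarrow> norm (unit_seq c N) = 1"
  by (auto simp: norm_mult)

lemma unit_seq_neq_1: "c \<in> {1, -1} \<Longrightarrow> unit_seq c N \<noteq> 1"
proof -
  assume c: "c \<in> {1, -1}"
  have "sin (1 / real (Suc N)) > 0"
    using unit_seq_angle[of N] by (intro sin_gt_zero) auto
  moreover have "Im (unit_seq c N) = c * sin (1 / real (Suc N))" by simp
  ultimately have "Im (unit_seq c N) \<noteq> 0" using c by (auto simp del: of_nat_Suc)
  then show "unit_seq c N \<noteq> 1" by (metis one_complex.sel(2))
qed

text \<open>Uniform in \<open>N\<close>, so that twice the limit integrand is a majorant. For
  \<open>c = -1\<close> the cosine of the angle is nonnegative, so the real part is at least 1,
  while \<open>1 + v \<le> 2\<close>.\<close>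

lemma norm_one_minus_unit_seq_ge:
  assumes "c \<in> {1, -1}" "0 \<le> v" "v \<le> 1"
  shows "norm (1 - unit_seq c N * complex_of_real v) \<ge> \<bar>1 - c * v\<bar> / 2"
proof (cases "c = 1")
  case True
  then show ?thesis
    using norm_one_minus_ge(2)[OF norm_unit_seq, OF assms, of N] assms by simp
next
  case False
  have "- (pi / 2) \<le> 1 / real (Suc N)"
    using unit_seq_angle(1)[of N] pi_gt_zero by linarith
  then have "0 \<le> cos (1 / real (Suc N)) * v"
    using unit_seq_angle[of N] assms by (intro mult_nonneg_nonneg cos_ge_zero) auto
  then have "1 \<le> Re (1 - unit_seq c N * complex_of_real v)"
    using False assms by auto
  also have "\<dots> \<le> norm (1 - unit_seq c N * complex_of_real v)" by (rule complex_Re_le_cmod)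
  finally show ?thesis using False assms by auto
qed

text \<open>Dominated convergence. In the excluded case \<open>c = 1\<close>, \<open>k = 0\<close>
  the limit integrand is not integrable; real and imaginary parts are then treated
  separately.\<close>

lemma lerch_int_tendsto:
  assumes "c \<in> {1, -1}" "s > 0" "c = 1 \<Longrightarrow> k \<noteq> 0"
  shows "(\<lambda>N. lerch_int k s (unit_seq c N)) \<longlonglongrightarrow> of_real (fact k * lerch c (Suc k) s)"
proof -
  let ?g = "\<lambda>v. (- ln v) ^ k * v powr (s - 1)"
  have ne: "\<bar>1 - c * v\<bar> > 0" if "v \<in> {0<..<1}" for v using that assms(1) by auto
  have "(\<lambda>N. lerch_int k s (unit_seq c N))
      \<longlonglongrightarrow> integral {0<..<1} (\<lambda>v. complex_of_real (?g v) / (1 - complex_of_real c * complex_of_real v))"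
    unfolding lerch_int_def
  proof (rule dominated_convergence(2))
    show "(\<lambda>v. complex_of_real (?g v) / (1 - unit_seq c N * complex_of_real v)) integrable_on {0<..<1}" for N
      using lerch_int_integrable[OF norm_unit_seq[OF assms(1)] unit_seq_neq_1[OF assms(1)] assms(2)]
      by (rule set_lebesgue_integral_eq_integral)
    show "(\<lambda>v. 2 * (?g v / \<bar>1 - c * v\<bar>)) integrable_on {0<..<1}"
      by (intro integrable_on_mult_right lerch_kernel_integrable assms)
  next
    fix N and v :: real assume v: "v \<in> {0<..<1}"
    have "norm (complex_of_real (?g v) / (1 - unit_seq c N * complex_of_real v))
        = ?g v / norm (1 - unit_seq c N * complex_of_real v)"
      using v unfolding norm_divide norm_of_real by (simp add: abs_mult power_abs)
    also have "\<dots> \<le> ?g v / (\<bar>1 - c * v\<bar> / 2)"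
    proof (rule divide_left_mono)
      show le: "\<bar>1 - c * v\<bar> / 2 \<le> norm (1 - unit_seq c N * complex_of_real v)"
        using norm_one_minus_unit_seq_ge[OF assms(1), of v N] v by simp
      have pos: "0 < \<bar>1 - c * v\<bar> / 2" using ne[OF v] by simp
      show "0 < norm (1 - unit_seq c N * complex_of_real v) * (\<bar>1 - c * v\<bar> / 2)"
        by (rule mult_pos_pos[OF less_le_trans[OF pos le] pos])
    qed (use v in auto)
    also have "\<dots> = 2 * (?g v / \<bar>1 - c * v\<bar>)" by simp
    finally show "norm (complex_of_real (?g v) / (1 - unit_seq c N * complex_of_real v))
        \<le> 2 * (?g v / \<bar>1 - c * v\<bar>)" .
  next
    fix v :: real assume v: "v \<in> {0<..<1}"
    have "complex_of_real (1 - c * v) \<noteq> 0" using ne[OF v] unfolding of_real_eq_0_iff by auto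
    then have "1 - complex_of_real c * complex_of_real v \<noteq> 0" by simp
    then show "(\<lambda>N. complex_of_real (?g v) / (1 - unit_seq c N * complex_of_real v))
       \<longlonglongrightarrow> complex_of_real (?g v) / (1 - complex_of_real c * complex_of_real v)"
      by (intro tendsto_intros unit_seq_tendsto)
  qed
  also have "(\<lambda>v. complex_of_real (?g v) / (1 - complex_of_real c * complex_of_real v))
      = (\<lambda>v. complex_of_real (?g v / (1 - c * v)))"
    by simp
  also have "integral {0<..<1} \<dots> = of_real (fact k * lerch c (Suc k) s)"
    using has_integral_linear[OF integral_eq_lerch[OF assms] bounded_linear_of_real]
    unfolding o_def by (rule integral_unique)
  finally show ?thesis .
qed

section \<open>The cotangent as an integral\<close>

lemma Digamma_reflection:
  assumes "0 < s" "s < (1::real)"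
  shows "Digamma (1 - s) - Digamma s = pi * cot (pi * s)"
proof -
  define z where "z = complex_of_real s"
  have z: "z \<notin> \<int>\<^sub>\<le>\<^sub>0" "1 - z \<notin> \<int>\<^sub>\<le>\<^sub>0"
    using assms nonpos_Ints_nonpos[of s] nonpos_Ints_nonpos[of "1 - s"]
      of_real_in_nonpos_Ints_iff[of s, where 'a = complex] of_real_in_nonpos_Ints_iff[of "1 - s", where 'a = complex]
    by (auto simp: z_def)
  \<comment> \<open>Both sides of the reflection formula
    \<open>rGamma z * rGamma (1 - z) = sin (pi * z) / pi\<close> are differentiated.\<close>
  have "((\<lambda>z. rGamma z * rGamma (1 - z)) has_field_derivative
      (- rGamma z * Digamma z) * rGamma (1 - z) + (- rGamma (1 - z) * Digamma (1 - z)) * (-1) * rGamma z) (at z)"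
    using z by (auto intro!: derivative_eq_intros)
  moreover have "((\<lambda>z. sin (of_real pi * z) / of_real pi) has_field_derivative cos (of_real pi * z)) (at z)"
    by (auto intro!: derivative_eq_intros)
  ultimately have "cos (of_real pi * z) =
      (- rGamma z * Digamma z) * rGamma (1 - z) + (- rGamma (1 - z) * Digamma (1 - z)) * (-1) * rGamma z"
    unfolding rGamma_reflection_complex by (metis DERIV_unique)
  also have "\<dots> = rGamma z * rGamma (1 - z) * (Digamma (1 - z) - Digamma z)"
    by (simp add: algebra_simps)
  also have "\<dots> = sin (of_real pi * z) / of_real pi * (Digamma (1 - z) - Digamma z)"
    by (simp add: rGamma_reflection_complex)
  finally have *: "cos (complex_of_real pi * z) =
    sin (complex_of_real pi * z) / of_real pi * (Digamma (1 - z) - Digamma z)" .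
  have "complex_of_real (cos (pi * s))
      = complex_of_real (sin (pi * s) / pi * (Digamma (1 - s) - Digamma s))"
  proof -
    have "complex_of_real pi * z = of_real (pi * s)" by (simp add: z_def)
    then have "cos (complex_of_real pi * z) = of_real (cos (pi * s))"
        "sin (complex_of_real pi * z) = of_real (sin (pi * s))"
      by (simp_all only: cos_of_real sin_of_real)
    moreover have "Digamma z = of_real (Digamma s)" "Digamma (1 - z) = of_real (Digamma (1 - s))"
      using Polygamma_of_real[of s 0, where 'a = complex] Polygamma_of_real[of "1 - s" 0, where 'a = complex] assms
      by (simp_all add: z_def)
    ultimately show ?thesis using * by simp
  qed
  then have "cos (pi * s) = sin (pi * s) / pi * (Digamma (1 - s) - Digamma s)"
    by (simp only: of_real_eq_iff)
  moreover have "sin (pi * s) > 0" using assms by (intro sin_gt_zero) auto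
  ultimately show ?thesis by (simp add: cot_def field_simps)
qed

text \<open>First-order bound \<open>1 - exp (- t) \<le> t\<close>; the claim is symmetric, so it
  suffices to treat \<open>x \<le> y\<close>.\<close>

lemma abs_powr_diff_le:
  fixes v :: real
  assumes "0 < v" "v < 1"
  shows "\<bar>v powr x - v powr y\<bar> \<le> \<bar>x - y\<bar> * (- ln v) * (v powr x + v powr y)"
proof -
  have *: "\<bar>v powr x - v powr y\<bar> \<le> \<bar>x - y\<bar> * (- ln v) * (v powr x + v powr y)" if "x \<le> y" for x y
  proof -
    have "v powr y = v powr x * exp ((y - x) * ln v)"
      using assms by (simp add: powr_def ring_distribs flip: exp_add)
    then have "v powr x - v powr y = v powr x * (1 - exp ((y - x) * ln v))" by (simp add: algebra_simps)
    also have "\<dots> \<le> v powr x * ((y - x) * (- ln v))"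
    proof (rule mult_left_mono)
      have "1 - exp ((y - x) * ln v) \<le> - ((y - x) * ln v)"
        using exp_ge_add_one_self[of "(y - x) * ln v"] by linarith
      then show "1 - exp ((y - x) * ln v) \<le> (y - x) * (- ln v)" by simp
    qed simp
    also have "\<dots> \<le> (v powr x + v powr y) * ((y - x) * (- ln v))"
      using assms that by (intro mult_right_mono mult_nonneg_nonneg) auto
    finally have "v powr x - v powr y \<le> (v powr x + v powr y) * ((y - x) * (- ln v))" .
    moreover have "v powr y \<le> v powr x" using assms that by (intro powr_mono') auto
    ultimately show ?thesis using that by (simp add: mult.commute mult.left_commute)
  qed
  show ?thesis
  proof (cases "x \<le> y")
    case False
    with *[of y x] show ?thesis by (simp add: abs_minus_commute add.commute)
  qed (rule *)
qed

text \<open>The numerator vanishes to first order at \<open>v = 1\<close>, which removes the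
  pole.\<close>

lemma integrable_powr_diff_over:
  assumes "0 < s" "s < (1::real)"
  shows "(\<lambda>v. (v powr (s - 1) - v powr (- s)) / (1 - v)) absolutely_integrable_on {0<..<1}"
proof -
  \<comment> \<open>Small enough that the exponents \<open>s - c\<close> and
    \<open>1 - s - c\<close> stay positive.\<close>
  define c where "c = min s (1 - s) / 2"
  have c: "c > 0" "s - c > 0" "1 - s - c > 0" using assms by (auto simp: c_def min_def)
  obtain C where C: "C \<ge> 1" "\<And>u. 0 < u \<Longrightarrow> u < 1 \<Longrightarrow> (- ln u) ^ 1 / \<bar>1 - 1 * u\<bar> \<le> C * u powr (- c)"
    using power_ln_over_le[of 1 1 c] c by auto
  show ?thesis
  proof (rule absolutely_integrable_on_bound)
    show "(\<lambda>v. \<bar>s - 1 - (- s)\<bar> * C * (v powr (s - c - 1) + v powr (1 - s - c - 1))) integrable_on {0<..<1}"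
      using has_integral_powr_power_ln[OF c(2), of 0] has_integral_powr_power_ln[OF c(3), of 0]
      by (intro integrable_on_mult_right integrable_add) (auto simp: integrable_on_def)
    fix v :: real assume v: "v \<in> {0<..<1}"
    have "norm ((v powr (s - 1) - v powr (- s)) / (1 - v)) = \<bar>v powr (s - 1) - v powr (- s)\<bar> / (1 - v)"
      using v by simp
    also have "\<dots> \<le> \<bar>s - 1 - (- s)\<bar> * (- ln v) * (v powr (s - 1) + v powr (- s)) / (1 - v)"
      using v by (intro divide_right_mono abs_powr_diff_le) auto
    also have "\<dots> = \<bar>s - 1 - (- s)\<bar> * ((- ln v) ^ 1 / \<bar>1 - 1 * v\<bar>) * (v powr (s - 1) + v powr (- s))"
      using v by simp
    also have "\<dots> \<le> \<bar>s - 1 - (- s)\<bar> * (C * v powr (- c)) * (v powr (s - 1) + v powr (- s))"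
      using v by (intro mult_right_mono mult_left_mono C) auto
    also have "\<dots> = \<bar>s - 1 - (- s)\<bar> * C * (v powr (- c) * v powr (s - 1) + v powr (- c) * v powr (- s))"
      by (simp only: algebra_simps)
    also have "v powr (- c) * v powr (s - 1) = v powr (s - c - 1)"
      by (simp add: powr_add[symmetric] algebra_simps)
    also have "v powr (- c) * v powr (- s) = v powr (1 - s - c - 1)"
      by (simp add: powr_add[symmetric] algebra_simps)
    finally show "norm ((v powr (s - 1) - v powr (- s)) / (1 - v))
       \<le> \<bar>s - 1 - (- s)\<bar> * C * (v powr (s - c - 1) + v powr (1 - s - c - 1))" .
  qed auto
qed

text \<open>Expanding \<open>1 / (1 - v)\<close> gives the series of
  \<open>1 / (m + s) - 1 / (m + 1 - s)\<close>, a difference of two Digamma values, which reflection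
  turns into a cotangent.\<close>

lemma integral_eq_cot:
  assumes "0 < s" "s < (1::real)"
  shows "integral {0<..<1} (\<lambda>v. (v powr (s - 1) - v powr (- s)) / (1 - v)) = pi * cot (pi * s)"
proof -
  define h where "h = (\<lambda>v. (v powr (s - 1) - v powr (- s)) / (1 - v))"
  define f where "f = (\<lambda>N v. \<Sum>m<N. v powr (real m + s - 1) - v powr (real m + (1 - s) - 1))"
  define t where "t = (\<lambda>m. inverse (s + real m) - inverse (1 - s + real m))"
  have h: "(\<lambda>v. \<bar>h v\<bar>) integrable_on {0<..<1}"
    using integrable_powr_diff_over[OF assms] by (simp add: h_def absolutely_integrable_on_def)
  have f: "(f N has_integral (\<Sum>m<N. t m)) {0<..<1}" for N
    unfolding f_def
  proof (intro has_integral_sum)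
    fix m
    have "((\<lambda>v. (- ln v) ^ 0 * v powr (real m + s - 1) - (- ln v) ^ 0 * v powr (real m + (1 - s) - 1))
        has_integral (fact 0 / (real m + s) ^ Suc 0 - fact 0 / (real m + (1 - s)) ^ Suc 0)) {0<..<1}"
      using assms by (intro has_integral_diff has_integral_powr_power_ln) auto
    then show "((\<lambda>v. v powr (real m + s - 1) - v powr (real m + (1 - s) - 1)) has_integral t m) {0<..<1}"
      by (simp add: t_def inverse_eq_divide add.commute)
  qed auto
  have f_eq: "f N v = h v * (1 - v ^ N)" if v: "v \<in> {0<..<1}" for N v
  proof -
    have "f N v = (\<Sum>m<N. (v powr (s - 1) - v powr (- s)) * v ^ m)"
      unfolding f_def
    proof (intro sum.cong refl)
      fix m
      have "v powr (real m + s - 1) = v powr (s - 1) * v ^ m"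
        using v by (simp add: powr_add[symmetric] powr_realpow[symmetric] algebra_simps)
      moreover have "v powr (real m + (1 - s) - 1) = v powr (- s) * v ^ m"
        using v by (simp add: powr_add[symmetric] powr_realpow[symmetric] algebra_simps)
      ultimately show "v powr (real m + s - 1) - v powr (real m + (1 - s) - 1) 
          = (v powr (s - 1) - v powr (- s)) * v ^ m"
        by (simp add: left_diff_distrib)
    qed
    also have "\<dots> = (v powr (s - 1) - v powr (- s)) * ((1 - v ^ N) / (1 - v))"
      using v by (simp add: sum_gp_strict flip: sum_distrib_left)
    finally show ?thesis by (simp add: h_def)
  qed
  have bound: "norm (f N v) \<le> \<bar>h v\<bar>" if v: "v \<in> {0<..<1}" for N v
  proof -
    have "0 \<le> v ^ N" "v ^ N \<le> 1" using v by (auto intro: power_le_one)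
    then have "\<bar>h v\<bar> * \<bar>1 - v ^ N\<bar> \<le> \<bar>h v\<bar> * 1" by (intro mult_left_mono) auto
    then show ?thesis unfolding f_eq[OF v] by (simp add: abs_mult)
  qed
  have lim: "(\<lambda>N. f N v) \<longlonglongrightarrow> h v" if v: "v \<in> {0<..<1}" for v
  proof -
    have "(\<lambda>N. h v * (1 - v ^ N)) \<longlonglongrightarrow> h v * (1 - 0)"
      using v by (intro tendsto_intros LIMSEQ_power_zero) auto
    then show ?thesis using f_eq[OF v] by simp
  qed
  have "(\<lambda>N. integral {0<..<1} (f N)) \<longlonglongrightarrow> integral {0<..<1} h"
    by (rule dominated_convergence(2)[OF _ h bound lim]) (use f in \<open>auto simp: integrable_on_def\<close>)
  then have "(\<lambda>N. \<Sum>m<N. t m) \<longlonglongrightarrow> integral {0<..<1} h"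
    by (simp add: integral_unique[OF f])
  \<comment> \<open>The terms \<open>ln N\<close> in the two Digamma limits cancel.\<close>
  moreover have "(\<lambda>N. (of_real (ln (real N)) - (\<Sum>m<N. inverse (1 - s + of_nat m)))
     - (of_real (ln (real N)) - (\<Sum>m<N. inverse (s + of_nat m)))) \<longlonglongrightarrow> Digamma (1 - s) - Digamma s"
    using assms by (intro tendsto_diff Digamma_LIMSEQ) auto
  then have "(\<lambda>N. \<Sum>m<N. t m) \<longlonglongrightarrow> Digamma (1 - s) - Digamma s"
    by (simp add: t_def sum_subtractf)
  ultimately show ?thesis
    using Digamma_reflection[OF assms] unfolding h_def by (metis LIMSEQ_unique)
qed

text \<open>A nonpositive real part would mean \<open>Re z * v \<ge> 1\<close>, which on the unit
  circle forces \<open>z = 1\<close>. This keeps the path of integration off the cut of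
  \<open>Ln\<close>.\<close>

lemma one_minus_slit:
  assumes "norm z = 1" "z \<noteq> 1" "0 \<le> v" "v \<le> 1"
  shows "1 - z * complex_of_real v \<notin> \<real>\<^sub>\<le>\<^sub>0"
proof
  assume "1 - z * complex_of_real v \<in> \<real>\<^sub>\<le>\<^sub>0"
  then have "Re (1 - z * complex_of_real v) \<le> 0" by (simp add: complex_nonpos_Reals_iff)
  then have 1: "1 \<le> Re z * v" by simp
  have "Re z \<le> 1" using complex_Re_le_cmod[of z] assms by simp
  moreover have "Re z * v \<le> Re z" if "Re z \<ge> 0" using that assms mult_left_le by blast
  moreover have "Re z * v \<le> 0" if "Re z \<le> 0" using that assms mult_nonpos_nonneg by blast
  ultimately have "Re z = 1" using 1 by linarith
  then have "z = 1" using assms(1) by (simp add: complex_eq_iff cmod_def)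
  with assms show False by simp
qed

lemma has_integral_inverse_one_minus:
  assumes "norm z = 1" "z \<noteq> 1"
  shows "((\<lambda>v. z / (1 - z * complex_of_real v)) has_integral - Ln (1 - z)) {0<..<1}"
proof -
  have nz: "1 - z * complex_of_real v \<notin> \<real>\<^sub>\<le>\<^sub>0" if "v \<in> {0..1}" for v
    using one_minus_slit[OF assms] that by auto
  have "((\<lambda>v. z / (1 - z * complex_of_real v)) has_integral 
      (- Ln (1 - z * complex_of_real 1)) - (- Ln (1 - z * complex_of_real 0))) {0..1}"
  proof (rule fundamental_theorem_of_calculus_interior)
    show "continuous_on {0..1} (\<lambda>v. - Ln (1 - z * complex_of_real v))"
      using nz by (intro continuous_intros) auto
    fix x :: real assume x: "x \<in> {0<..<1}"
    have "((\<lambda>w. - Ln (1 - z * w)) has_field_derivative z / (1 - z * complex_of_real x)) (at (complex_of_real x))"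
      using nz[of x] x by (auto intro!: derivative_eq_intros simp: divide_inverse mult.commute)
    then show "((\<lambda>v. - Ln (1 - z * complex_of_real v)) has_vector_derivative z / (1 - z * complex_of_real x)) (at x)"
      using has_vector_derivative_real_field by blast
  qed simp
  then show ?thesis by (simp add: has_integral_Icc_iff_Ioo)
qed

text \<open>The imaginary part of \<open>z / (1 - z * v)\<close> is the nonnegative Poisson-type
  kernel \<open>Im z / norm (1 - z * v) ^ 2\<close>. Near \<open>v = 1\<close> it is not bounded
  uniformly in \<open>z\<close>, but its total mass is minus the argument of \<open>1 - z\<close>,
  hence at most \<open>pi\<close>.\<close>

lemma Im_mult_lerch_int_0_bound:
  assumes "norm z = 1" "z \<noteq> 1" "Im z \<ge> 0" "s > 0"
  shows "\<bar>Im (z * lerch_int 0 s z)\<bar> \<le> 4 / s + 2 * pi"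
proof -
  define P where "P = (\<lambda>v. Im (z / (1 - z * complex_of_real v)))"
  have P_eq: "P v = Im z / (norm (1 - z * complex_of_real v))\<^sup>2" for v
    unfolding P_def Im_divide cmod_power2 by (simp add: algebra_simps)
  have P0: "P v \<ge> 0" for v unfolding P_eq using assms by simp
  have Pint: "(P has_integral Im (- Ln (1 - z))) {0<..<1}"
    using has_integral_Im[OF has_integral_inverse_one_minus[OF assms(1,2)]] by (simp add: P_def)
  have "Im z \<le> 1" using abs_Im_le_cmod[of z] assms by simp
  \<comment> \<open>Below 1/2 the kernel is at most 4, above 1/2 the weight is at most 2; these are
    the constants of the claim.\<close>
  have b: "v powr (s - 1) * P v \<le> 4 * v powr (s - 1) + 2 * P v" if v: "v \<in> {0<..<1}" for v
  proof (cases "v \<le> 1 / 2")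
    case True
    have "1 / 2 \<le> norm (1 - z * complex_of_real v)"
      using norm_one_minus_ge(2)[OF assms(1), of v] v True by simp
    then have "(1 / 2)\<^sup>2 \<le> (norm (1 - z * complex_of_real v))\<^sup>2" by (intro power_mono) auto
    then have "P v \<le> Im z / (1 / 2)\<^sup>2"
      unfolding P_eq using assms by (intro divide_left_mono mult_pos_pos) (auto simp: power2_eq_square)
    also have "\<dots> \<le> 4" using \<open>Im z \<le> 1\<close> by (simp add: power2_eq_square)
    finally have "v powr (s - 1) * P v \<le> v powr (s - 1) * 4" by (intro mult_left_mono) auto
    then show ?thesis using P0[of v] by linarith
  next
    case False
    have "v powr (s - 1) \<le> v powr (- 1)" using v assms by (intro powr_mono') auto
    also have "\<dots> \<le> 2" using False by (simp add: powr_minus field_simps)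
    finally have "v powr (s - 1) * P v \<le> 2 * P v" using P0 by (intro mult_right_mono) auto
    moreover have "0 \<le> 4 * v powr (s - 1)" by simp
    ultimately show ?thesis by linarith
  qed
  have int: "((\<lambda>v. z * (complex_of_real ((- ln v) ^ 0 * v powr (s - 1)) / (1 - z * complex_of_real v)))
      has_integral z * lerch_int 0 s z) {0<..<1}"
    unfolding lerch_int_def using lerch_int_integrable[OF assms(1,2,4), of 0]
    by (intro has_integral_mult_right integrable_integral) (rule set_lebesgue_integral_eq_integral)
  have "Im (z * (complex_of_real ((- ln v) ^ 0 * v powr (s - 1)) / (1 - z * complex_of_real v))) = v powr (s - 1) * P v" for v
  proof -
    have "z * (complex_of_real ((- ln v) ^ 0 * v powr (s - 1)) / (1 - z * complex_of_real v))
      = of_real (v powr (s - 1)) * (z / (1 - z * complex_of_real v))" by simp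
    then show ?thesis
      by (simp only: P_def times_complex.sel Re_complex_of_real Im_complex_of_real mult_zero_left add_0_right)
  qed
  then have J: "((\<lambda>v. v powr (s - 1) * P v) has_integral Im (z * lerch_int 0 s z)) {0<..<1}"
    using has_integral_Im[OF int] by simp
  have "Im (z * lerch_int 0 s z) \<ge> 0"
    by (rule has_integral_nonneg[OF J]) (auto simp: P0)
  moreover have "Im (z * lerch_int 0 s z) \<le> 4 * (fact 0 / s ^ Suc 0) + 2 * Im (- Ln (1 - z))"
  proof (rule has_integral_le[OF J])
    show "((\<lambda>v. 4 * ((- ln v) ^ 0 * v powr (s - 1)) + 2 * P v) has_integral
       4 * (fact 0 / s ^ Suc 0) + 2 * Im (- Ln (1 - z))) {0<..<1}"
      by (intro has_integral_add has_integral_mult_right has_integral_powr_power_ln assms Pint)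
  qed (use b in auto)
  moreover have "\<bar>Im (Ln (1 - z))\<bar> \<le> pi"
    using mpi_less_Im_Ln[of "1 - z"] Im_Ln_le_pi[of "1 - z"] assms by auto
  ultimately show ?thesis by auto
qed

subsection \<open>Mellin transforms of the resolvent kernel\<close>

text \<open>Closed form of the integral of \<open>ln v ^ k * v powr s / (1 - z * v)\<close> against
  \<open>dv / v\<close>, as \<open>integral_mellin_resolvent\<close> shows. The first term is the
  part over \<open>(0, 1)\<close>, the second the part over \<open>(1, \<infinity>)\<close> after
  inversion, with \<open>cnj z\<close> for \<open>1 / z\<close>.\<close>

definition mellin_resolvent :: "nat \<Rightarrow> real \<Rightarrow> complex \<Rightarrow> complex" where
  "mellin_resolvent k s z = (-1) ^ k * lerch_int k s z - cnj z * cnj (lerch_int k (1 - s) z)"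

text \<open>The exponent \<open>s = 0\<close>, where the integral diverges at 0 and is regularized
  by the indicator of \<open>v < 1\<close>. The sign is reversed: the resolvent is subtracted from
  the indicator.\<close>

definition mellin_resolvent_0 :: "nat \<Rightarrow> complex \<Rightarrow> complex" where
  "mellin_resolvent_0 k z = cnj z * cnj (lerch_int k 1 z) - (-1) ^ k * z * lerch_int k 1 z"

text \<open>Rests on \<open>z * cnj z = 1\<close>: inversion carries the resolvent at
  \<open>z\<close> to the one at \<open>cnj z\<close>.\<close>

lemma resolvent_inversion:
  assumes "norm z = 1" "z \<noteq> 1" "0 < v" "v < 1"
  shows "1 / (1 - z * complex_of_real (1 / v)) = - (cnj z * of_real v / (1 - cnj z * of_real v))"
proof -
  have z: "z * cnj z = 1" "z \<noteq> 0" using assms(1) by (auto simp: complex_norm_square[symmetric])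
  have "norm (1 - cnj z * complex_of_real v) \<ge> 1 - v"
    using norm_one_minus_ge(2)[of "cnj z" v] assms by simp
  then have nz: "1 - cnj z * complex_of_real v \<noteq> 0" using assms by auto
  have "(1 - z * complex_of_real (1 / v)) * (- (cnj z * of_real v)) = z * cnj z - cnj z * of_real v"
    using assms by (simp add: field_simps)
  also have "\<dots> = 1 - cnj z * of_real v" using z by simp
  finally have eq: "(1 - z * complex_of_real (1 / v)) * (- (cnj z * of_real v)) = 1 - cnj z * of_real v" .
  have "1 / D = - (M / N)" if "D * (- M) = N" "N \<noteq> 0" for D M N :: complex
    using that by (auto simp: field_simps)
  from this[OF eq nz] show ?thesis .
qed

lemma integral_mellin_resolvent:
  fixes k :: nat
  assumes z: "norm z = 1" "z \<noteq> 1" and s: "0 < s" "s < 1"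
  defines "f \<equiv> \<lambda>v. complex_of_real (ln v ^ k * v powr s) / (1 - z * complex_of_real v) / complex_of_real v"
  shows "f absolutely_integrable_on {0<..}" "integral {0<..} f = mellin_resolvent k s z"
proof -
  define F where "F = (\<lambda>v. complex_of_real (ln v ^ k * v powr s) / (1 - z * complex_of_real v))"
  let ?L = "\<lambda>s z v. complex_of_real ((- ln v) ^ k * v powr (s - 1)) / (1 - z * complex_of_real v)"
  have 1: "F v / of_real v = (-1) ^ k * ?L s z v" if "v \<in> {0<..<1}" for v
  proof -
    have "ln v ^ k * v powr s / v = (-1) ^ k * ((- ln v) ^ k * v powr (s - 1))"
      using that by (simp add: powr_diff power_minus[of "ln v"] flip: mult.assoc power_add)
    then have "complex_of_real (ln v ^ k * v powr s / v) = (-1) ^ k * complex_of_real ((- ln v) ^ k * v powr (s - 1))"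
      by simp
    then show ?thesis unfolding F_def by (simp add: divide_simps)
  qed
  have 2: "F (1 / v) / of_real v = - cnj z * ?L (1 - s) (cnj z) v" if v: "v \<in> {0<..<1}" for v
  proof -
    have "F (1 / v) / of_real v
      = complex_of_real (ln (1 / v) ^ k * (1 / v) powr s / v) * (1 / (1 - z * complex_of_real (1 / v)))"
      by (simp add: F_def)
    also have "1 / (1 - z * complex_of_real (1 / v)) = - (cnj z * of_real v / (1 - cnj z * of_real v))"
      using v by (intro resolvent_inversion z) auto
    also have "ln (1 / v) ^ k * (1 / v) powr s / v = (- ln v) ^ k * v powr (1 - s - 1) / v"
      using v by (simp add: ln_div powr_divide powr_minus field_simps)
    finally have "F (1 / v) / of_real v = complex_of_real ((- ln v) ^ k * v powr (1 - s - 1)) / of_real v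
        * (- (cnj z * of_real v / (1 - cnj z * of_real v)))" by (simp only: of_real_divide)
    moreover have "(A / w) * (- (c * w / d)) = - c * (A / d)" if "w \<noteq> 0" for A c w d :: complex
      using that by simp
    ultimately show ?thesis using v by simp
  qed
  have cz: "norm (cnj z) = 1" "cnj z \<noteq> 1" using z by (auto simp: complex_eq_iff)
  have i1: "(\<lambda>v. (-1) ^ k * ?L s z v) absolutely_integrable_on {0<..<1}"
    using lerch_int_integrable[OF z s(1), of k] by (intro set_integrable_mult_right) auto
  have i2: "(\<lambda>v. - cnj z * ?L (1 - s) (cnj z) v) absolutely_integrable_on {0<..<1}"
    using lerch_int_integrable[OF cz, of "1 - s" k] s by (intro set_integrable_mult_right) auto
  have I: "(\<lambda>v. F v / of_real v) absolutely_integrable_on {0<..<1}"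
      "(\<lambda>v. F (1 / v) / of_real v) absolutely_integrable_on {0<..<1}"
    by (rule iffD2[OF set_integrable_cong[OF refl refl 1] i1], assumption)
      (rule iffD2[OF set_integrable_cong[OF refl refl 2] i2], assumption)
  show "f absolutely_integrable_on {0<..}"
    using integral_Ioi_by_inversion(1)[OF I] by (simp add: f_def F_def)
  have "integral {0<..} f = integral {0<..<1} (\<lambda>v. F v / of_real v) + integral {0<..<1} (\<lambda>v. F (1 / v) / of_real v)"
    using integral_Ioi_by_inversion(2)[OF I] by (simp add: f_def F_def)
  also have "integral {0<..<1} (\<lambda>v. F v / of_real v) = (-1) ^ k * lerch_int k s z"
    unfolding lerch_int_def integral_mult_right[symmetric] by (intro integral_cong 1)
  also have "integral {0<..<1} (\<lambda>v. F (1 / v) / of_real v) = - cnj z * lerch_int k (1 - s) (cnj z)"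
    unfolding lerch_int_def integral_mult_right[symmetric] by (intro integral_cong 2)
  finally show "integral {0<..} f = mellin_resolvent k s z"
    by (simp add: mellin_resolvent_def cnj_lerch_int)
qed

lemma integral_mellin_resolvent_0:
  fixes k :: nat
  assumes z: "norm z = 1" "z \<noteq> 1"
  defines "f \<equiv> \<lambda>v. complex_of_real (ln v ^ k) * ((if v < 1 then 1 else 0) - 1 / (1 - z * complex_of_real v)) / complex_of_real v"
  shows "f absolutely_integrable_on {0<..}" "integral {0<..} f = mellin_resolvent_0 k z"
proof -
  define F where "F = (\<lambda>v. complex_of_real (ln v ^ k) * ((if v < 1 then 1 else 0) - 1 / (1 - z * complex_of_real v)))"
  let ?L = "\<lambda>z v. complex_of_real ((- ln v) ^ k * v powr (1 - 1)) / (1 - z * complex_of_real v)"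
  have 1: "F v / of_real v = - ((-1) ^ k * z) * ?L z v" if v: "v \<in> {0<..<1}" for v
  proof -
    have "norm (1 - z * complex_of_real v) \<ge> 1 - v"
      using norm_one_minus_ge(2)[of z v] z v by simp
    then have nz: "1 - z * complex_of_real v \<noteq> 0" using v by auto
    have A: "(if v < 1 then 1 else 0) - 1 / (1 - z * complex_of_real v) = - z * of_real v / (1 - z * complex_of_real v)"
      using nz v by (simp add: field_simps)
    have B: "complex_of_real (ln v ^ k) = (-1) ^ k * complex_of_real ((- ln v) ^ k * v powr (1 - 1))"
      using v by (simp add: power_minus[of "complex_of_real (ln v)"] flip: mult.assoc power_add)
    have "(s * C) * (- z * w / d) / w = - (s * z) * (C / d)" if "w \<noteq> 0" for s C w d :: complex
      using that by simp
    then show ?thesis using v unfolding F_def A B by simp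
  qed
  have 2: "F (1 / v) / of_real v = cnj z * ?L (cnj z) v" if v: "v \<in> {0<..<1}" for v
  proof -
    have "F (1 / v) / of_real v = - complex_of_real (ln (1 / v) ^ k / v) * (1 / (1 - z * complex_of_real (1 / v)))"
      using v by (simp add: F_def)
    also have "1 / (1 - z * complex_of_real (1 / v)) = - (cnj z * of_real v / (1 - cnj z * of_real v))"
      using v by (intro resolvent_inversion z) auto
    also have "ln (1 / v) ^ k / v = (- ln v) ^ k * v powr (1 - 1) / v"
      using v by (simp add: ln_div)
    finally have "F (1 / v) / of_real v = - (complex_of_real ((- ln v) ^ k * v powr (1 - 1)) / of_real v)
        * (- (cnj z * of_real v / (1 - cnj z * of_real v)))" by (simp only: of_real_divide)
    moreover have "- (A / w) * (- (c * w / d)) = c * (A / d)" if "w \<noteq> 0" for A c w d :: complex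
      using that by simp
    ultimately show ?thesis using v by simp
  qed
  have cz: "norm (cnj z) = 1" "cnj z \<noteq> 1" using z by (auto simp: complex_eq_iff)
  have i1: "(\<lambda>v. - ((-1) ^ k * z) * ?L z v) absolutely_integrable_on {0<..<1}"
    using lerch_int_integrable[OF z, of 1 k] by (intro set_integrable_mult_right) auto
  have i2: "(\<lambda>v. cnj z * ?L (cnj z) v) absolutely_integrable_on {0<..<1}"
    using lerch_int_integrable[OF cz, of 1 k] by (intro set_integrable_mult_right) auto
  have I: "(\<lambda>v. F v / of_real v) absolutely_integrable_on {0<..<1}"
      "(\<lambda>v. F (1 / v) / of_real v) absolutely_integrable_on {0<..<1}"
    by (rule iffD2[OF set_integrable_cong[OF refl refl 1] i1], assumption)
      (rule iffD2[OF set_integrable_cong[OF refl refl 2] i2], assumption)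
  show "f absolutely_integrable_on {0<..}"
    using integral_Ioi_by_inversion(1)[OF I] by (simp add: f_def F_def)
  have "integral {0<..} f = integral {0<..<1} (\<lambda>v. F v / of_real v) + integral {0<..<1} (\<lambda>v. F (1 / v) / of_real v)"
    using integral_Ioi_by_inversion(2)[OF I] by (simp add: f_def F_def)
  also have "integral {0<..<1} (\<lambda>v. F v / of_real v) = - ((-1) ^ k * z) * lerch_int k 1 z"
    unfolding lerch_int_def integral_mult_right[symmetric] by (intro integral_cong 1)
  also have "integral {0<..<1} (\<lambda>v. F (1 / v) / of_real v) = cnj z * lerch_int k 1 (cnj z)"
    unfolding lerch_int_def integral_mult_right[symmetric] by (intro integral_cong 2)
  finally show "integral {0<..} f = mellin_resolvent_0 k z"
    by (simp add: mellin_resolvent_0_def cnj_lerch_int)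
qed

section \<open>Boundary values of the Mellin transforms\<close>

lemma Im_unit_seq_1_nonneg: "Im (unit_seq 1 N) \<ge> 0"
  using sin_gt_zero[of "1 / real (Suc N)"] unit_seq_angle[of N] by (simp del: of_nat_Suc)

lemma lerch_int_0_bound:
  assumes "s > 0"
  shows "\<bar>Im (unit_seq 1 N * lerch_int 0 s (unit_seq 1 N))\<bar> \<le> 4 / s + 2 * pi"
  using assms by (intro Im_mult_lerch_int_0_bound norm_unit_seq unit_seq_neq_1 Im_unit_seq_1_nonneg) auto

text \<open>From \<open>1 / (1 - z * v) = 1 + z * v / (1 - z * v)\<close>. It supplies the factor
  \<open>z\<close> that \<open>lerch_int_0_bound\<close> asks for, at the price of a real summand,
  which does not affect imaginary parts.\<close>

lemma lerch_int_0_eq: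
  assumes z: "norm z = 1" "z \<noteq> 1" and "s > 0"
  shows "lerch_int 0 s z = of_real (1 / s) + z * lerch_int 0 (s + 1) z"
proof -
  let ?L = "\<lambda>s v. complex_of_real ((- ln v) ^ 0 * v powr (s - 1)) / (1 - z * complex_of_real v)"
  have L: "(?L t has_integral lerch_int 0 t z) {0<..<1}" if "t > 0" for t
    unfolding lerch_int_def using lerch_int_integrable[OF z that, of 0]
    by (intro integrable_integral) (rule set_lebesgue_integral_eq_integral)
  have hi: "((\<lambda>v. complex_of_real ((- ln v) ^ 0 * v powr (s - 1)) + z * ?L (s + 1) v) has_integral
      complex_of_real (fact 0 / s ^ Suc 0) + z * lerch_int 0 (s + 1) z) {0<..<1}"
    using has_integral_linear[OF has_integral_powr_power_ln[OF assms(3), of 0] bounded_linear_of_real[where 'a = complex]] assms(3)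
    unfolding o_def by (intro has_integral_add has_integral_mult_right L) auto
  have eq: "complex_of_real ((- ln v) ^ 0 * v powr (s - 1)) + z * ?L (s + 1) v = ?L s v"
    if v: "v \<in> {0<..<1}" for v
  proof -
    have "norm (1 - z * complex_of_real v) \<ge> 1 - v"
      using norm_one_minus_ge(2)[of z v] z v by simp
    then have nz: "1 - z * complex_of_real v \<noteq> 0" using v by auto
    have "v powr (s + 1 - 1) = v powr (s - 1) * v" using v by (simp add: powr_diff)
    then show ?thesis using nz by (simp add: field_simps)
  qed
  have "(?L s has_integral complex_of_real (fact 0 / s ^ Suc 0) + z * lerch_int 0 (s + 1) z) {0<..<1}"
    by (rule has_integral_eq[OF eq hi])
  from has_integral_unique[OF L[OF assms(3)] this] show ?thesis by simp
qed

text \<open>Each of the two Lerch integrals diverges as \<open>z\<close> tends to 1. Under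
  \<open>Re\<close> the conjugation may be dropped, and the combined integrand
  \<open>(v powr (s - 1) - z * v powr (- s)) / (1 - z * v)\<close> loses its pole in the
  limit.\<close>

lemma Re_mellin_resolvent_tendsto_cot:
  assumes s: "0 < s" "s < 1"
  shows "(\<lambda>N. Re (mellin_resolvent 0 s (unit_seq 1 N))) \<longlonglongrightarrow> pi * cot (pi * s)"
proof -
  let ?z = "unit_seq 1"
  let ?h = "\<lambda>v. (v powr (s - 1) - v powr (- s)) / (1 - v)"
  let ?L = "\<lambda>s z v. complex_of_real ((- ln v) ^ 0 * v powr (s - 1)) / (1 - z * complex_of_real v)"
  let ?f = "\<lambda>N v. ?L s (?z N) v - ?z N * ?L (1 - s) (?z N) v"
  have z: "norm (?z N) = 1" "?z N \<noteq> 1" for N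
    using norm_unit_seq[of 1 N] unit_seq_neq_1[of 1 N] by auto
  have L: "(?L t (?z N) has_integral lerch_int 0 t (?z N)) {0<..<1}" if "t > 0" for t N
    unfolding lerch_int_def using lerch_int_integrable[OF z that, of 0]
    by (intro integrable_integral) (rule set_lebesgue_integral_eq_integral)
  have f: "(?f N has_integral lerch_int 0 s (?z N) - ?z N * lerch_int 0 (1 - s) (?z N)) {0<..<1}" for N
    using L[of s N] L[of "1 - s" N] s by (intro has_integral_diff has_integral_mult_right) simp_all
  have "(\<lambda>N. integral {0<..<1} (?f N)) \<longlonglongrightarrow> integral {0<..<1} (\<lambda>v. complex_of_real (?h v))"
  proof (rule dominated_convergence(2))
    show "?f N integrable_on {0<..<1}" for N using f by (auto simp: integrable_on_def)
    show "(\<lambda>v. \<bar>?h v\<bar> + 2 * ((- ln v) ^ 0 * v powr (1 - s - 1))) integrable_on {0<..<1}"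
      using integrable_powr_diff_over[OF s] has_integral_powr_power_ln[of "1 - s" 0] s
      by (intro integrable_add integrable_on_mult_right)
        (auto simp: absolutely_integrable_on_def integrable_on_def)
  next
    fix N and v :: real assume v: "v \<in> {0<..<1}"
    let ?d = "1 - ?z N * complex_of_real v"
    have d: "norm ?d \<ge> 1 - v" "norm ?d \<ge> norm (1 - ?z N) / 2"
      using norm_one_minus_ge[OF z(1), of v N] v by auto
    \<comment> \<open>The remainder with \<open>1 - z\<close> tends to 0 pointwise and is at most
      \<open>2 * v powr (- s)\<close>, because the denominator is at least
      \<open>norm (1 - z) / 2\<close>.\<close>
    have "?f N v = complex_of_real (v powr (s - 1) - v powr (- s)) / ?d
        + complex_of_real (v powr (- s)) * ((1 - ?z N) / ?d)"
    proof -
      have "A / d - w * (B / d) = (A - B) / d + B * ((1 - w) / d)" for A B d w :: complex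
        by (simp add: diff_divide_distrib right_diff_distrib mult.commute)
      then show ?thesis by simp
    qed
    also have "norm \<dots> \<le> norm (complex_of_real (v powr (s - 1) - v powr (- s)) / ?d)
        + norm (complex_of_real (v powr (- s)) * ((1 - ?z N) / ?d))"
      by (rule norm_triangle_ineq)
    also have "norm (complex_of_real (v powr (s - 1) - v powr (- s)) / ?d) \<le> \<bar>?h v\<bar>"
    proof -
      have "\<bar>v powr (s - 1) - v powr (- s)\<bar> / norm ?d \<le> \<bar>v powr (s - 1) - v powr (- s)\<bar> / (1 - v)"
        using d(1) v by (intro divide_left_mono mult_pos_pos) auto
      then show ?thesis using v unfolding norm_divide norm_of_real by simp
    qed
    also have "norm (complex_of_real (v powr (- s)) * ((1 - ?z N) / ?d)) \<le> v powr (- s) * 2"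
    proof -
      have "1 - v > 0" using v by simp
      then have "norm ?d > 0" using d(1) by linarith
      then have "norm (1 - ?z N) / norm ?d \<le> 2" using d(2) by (simp add: divide_le_eq)
      then show ?thesis unfolding norm_mult norm_divide norm_of_real by (intro mult_mono) auto
    qed
    finally show "norm (?f N v) \<le> \<bar>?h v\<bar> + 2 * ((- ln v) ^ 0 * v powr (1 - s - 1))" by simp
  next
    fix v :: real assume v: "v \<in> {0<..<1}"
    then have nz: "1 - complex_of_real 1 * complex_of_real v \<noteq> 0" by (auto simp: complex_eq_iff)
    have "(\<lambda>N. ?f N v) \<longlonglongrightarrow> ?L s (complex_of_real 1) v - complex_of_real 1 * ?L (1 - s) (complex_of_real 1) v"
      using nz by (intro tendsto_intros unit_seq_tendsto) auto
    also have "?L s (complex_of_real 1) v - complex_of_real 1 * ?L (1 - s) (complex_of_real 1) v = complex_of_real (?h v)"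
      by (simp add: diff_divide_distrib)
    finally show "(\<lambda>N. ?f N v) \<longlonglongrightarrow> complex_of_real (?h v)" .
  qed
  also have "integral {0<..<1} (\<lambda>v. complex_of_real (?h v)) = of_real (pi * cot (pi * s))"
  proof -
    have "(?h has_integral pi * cot (pi * s)) {0<..<1}"
      using integral_eq_cot[OF s] integrable_powr_diff_over[OF s]
      by (metis integrable_integral set_lebesgue_integral_eq_integral(1))
    from has_integral_linear[OF this bounded_linear_of_real[where 'a = complex]] show ?thesis
      unfolding o_def by (rule integral_unique)
  qed
  finally have "(\<lambda>N. Re (integral {0<..<1} (?f N))) \<longlonglongrightarrow> Re (of_real (pi * cot (pi * s)))"
    by (rule tendsto_Re)
  moreover have "Re (mellin_resolvent 0 s (?z N)) = Re (integral {0<..<1} (?f N))" for N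
    unfolding integral_unique[OF f] by (simp add: mellin_resolvent_def)
  ultimately show ?thesis by simp
qed

text \<open>Unless \<open>b = 1\<close> and \<open>k = 0\<close>, both Lerch integrals converge to
  real numbers. In the exceptional case the real part gives the cotangent and the imaginary part is
  merely shown to be bounded. The power \<open>k\<close> of the logarithm corresponds to the index
  \<open>Suc k\<close> of \<open>Theta\<close>.\<close>

lemma mellin_resolvent_limits:
  assumes b: "b \<in> {1, -1}" and s: "0 < s" "s < r"
  shows "(\<lambda>N. Re (mellin_resolvent k (s / r) (unit_seq b N))) \<longlonglongrightarrow> (-1) ^ k * fact k * Theta b (Suc k) s r"
    and "Bseq (\<lambda>N. Im (mellin_resolvent k (s / r) (unit_seq b N)))"
proof -
  define t where "t = s / r"
  have t: "0 < t" "t < 1" using s by (auto simp: t_def)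
  have t': "(r - s) / r = 1 - t" using s by (simp add: t_def field_simps)
  have "(\<lambda>N. Re (mellin_resolvent k t (unit_seq b N))) \<longlonglongrightarrow> (-1) ^ k * fact k * Theta b (Suc k) s r
      \<and> Bseq (\<lambda>N. Im (mellin_resolvent k t (unit_seq b N)))"
  proof (cases "b = 1 \<and> k = 0")
    case True
    then have "b = 1" "k = 0" by auto
    have "\<bar>Im (mellin_resolvent 0 t (unit_seq 1 N))\<bar> \<le> (4 / (t + 1) + 2 * pi) + (4 / (1 - t) + 2 * pi)" for N
    proof -
      \<comment> \<open>Raising \<open>t\<close> to \<open>t + 1\<close> gives both summands the
        factor \<open>z\<close>; the sign changes through conjugation.\<close>
      have "Im (mellin_resolvent 0 t (unit_seq 1 N)) = Im (unit_seq 1 N * lerch_int 0 (t + 1) (unit_seq 1 N))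
          + Im (unit_seq 1 N * lerch_int 0 (1 - t) (unit_seq 1 N))"
        unfolding mellin_resolvent_def using t lerch_int_0_eq[OF norm_unit_seq[of 1 N] unit_seq_neq_1[of 1 N] t(1)]
        by (simp add: algebra_simps)
      then show ?thesis
        using lerch_int_0_bound[of "t + 1" N] lerch_int_0_bound[of "1 - t" N] t by linarith
    qed
    then have "Bseq (\<lambda>N. Im (mellin_resolvent 0 t (unit_seq 1 N)))" by (intro BseqI') auto
    moreover have "Theta b (Suc k) s r = pi * cot (pi * t)"
      using True by (simp add: Theta_def t_def)
    ultimately show ?thesis using Re_mellin_resolvent_tendsto_cot[OF t] \<open>b = 1\<close> \<open>k = 0\<close> by simp
  next
    case False
    let ?l = "(-1) ^ k * complex_of_real (fact k * lerch b (Suc k) t)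
      - cnj (complex_of_real b) * cnj (complex_of_real (fact k * lerch b (Suc k) (1 - t)))"
    have "(\<lambda>N. mellin_resolvent k t (unit_seq b N)) \<longlonglongrightarrow> ?l"
      unfolding mellin_resolvent_def using False t b
      by (intro tendsto_intros tendsto_cnj lerch_int_tendsto unit_seq_tendsto) auto
    also have "?l = complex_of_real ((-1) ^ k * fact k * Theta b (Suc k) s r)"
      using False by (auto simp: Theta_def t_def[symmetric] t' algebra_simps minus_one_mult_self)
    finally have "(\<lambda>N. mellin_resolvent k t (unit_seq b N)) \<longlonglongrightarrow> complex_of_real ((-1) ^ k * fact k * Theta b (Suc k) s r)" .
    from tendsto_Re[OF this] tendsto_Im[OF this] show ?thesis
      by (auto intro!: convergent_imp_Bseq simp: convergent_def)
  qed
  then show "(\<lambda>N. Re (mellin_resolvent k (s / r) (unit_seq b N))) \<longlonglongrightarrow> (-1) ^ k * fact k * Theta b (Suc k) s r"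
    and "Bseq (\<lambda>N. Im (mellin_resolvent k (s / r) (unit_seq b N)))"
    unfolding t_def by auto
qed

text \<open>For \<open>b = 1\<close>, \<open>k = 0\<close> the value is the conjugate of a number
  minus that number, so its real part is 0; correspondingly the factor
  \<open>1 - (-1) ^ 0 = 0\<close> cancels the meaningless \<open>lerch 1 1 1\<close>.\<close>

lemma mellin_resolvent_0_limits:
  assumes b: "b \<in> {1, -1}"
  shows "(\<lambda>N. Re (mellin_resolvent_0 k (unit_seq b N))) \<longlonglongrightarrow> b * (1 - (-1) ^ k) * fact k * lerch b (Suc k) 1"
    and "Bseq (\<lambda>N. Im (mellin_resolvent_0 k (unit_seq b N)))"
proof -
  have "(\<lambda>N. Re (mellin_resolvent_0 k (unit_seq b N))) \<longlonglongrightarrow> b * (1 - (-1) ^ k) * fact k * lerch b (Suc k) 1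
      \<and> Bseq (\<lambda>N. Im (mellin_resolvent_0 k (unit_seq b N)))"
  proof (cases "b = 1 \<and> k = 0")
    case True
    then have "b = 1" "k = 0" by auto
    have "Re (mellin_resolvent_0 0 z) = 0" for z by (simp add: mellin_resolvent_0_def)
    moreover have "\<bar>Im (mellin_resolvent_0 0 (unit_seq 1 N))\<bar> \<le> 2 * (4 / 1 + 2 * pi)" for N
    proof -
      have "Im (mellin_resolvent_0 0 (unit_seq 1 N)) = - 2 * Im (unit_seq 1 N * lerch_int 0 1 (unit_seq 1 N))"
        by (simp add: mellin_resolvent_0_def)
      then have eq: "\<bar>Im (mellin_resolvent_0 0 (unit_seq 1 N))\<bar> = 2 * \<bar>Im (unit_seq 1 N * lerch_int 0 1 (unit_seq 1 N))\<bar>"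
        by (simp only: abs_mult_pos abs_neg_numeral abs_mult[of "- 2"])
      show ?thesis
        unfolding eq by (rule mult_left_mono[OF lerch_int_0_bound[OF zero_less_one]]) simp
    qed
    then have "Bseq (\<lambda>N. Im (mellin_resolvent_0 0 (unit_seq 1 N)))" by (intro BseqI') auto
    ultimately show ?thesis using \<open>b = 1\<close> \<open>k = 0\<close> by simp
  next
    case False
    let ?l = "cnj (complex_of_real b) * cnj (complex_of_real (fact k * lerch b (Suc k) 1))
      - (-1) ^ k * complex_of_real b * complex_of_real (fact k * lerch b (Suc k) 1)"
    have "(\<lambda>N. mellin_resolvent_0 k (unit_seq b N)) \<longlonglongrightarrow> ?l"
      unfolding mellin_resolvent_0_def using False b
      by (intro tendsto_intros tendsto_cnj lerch_int_tendsto unit_seq_tendsto) auto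
    also have "?l = complex_of_real (b * (1 - (-1) ^ k) * fact k * lerch b (Suc k) 1)"
      by (simp add: algebra_simps)
    finally have "(\<lambda>N. mellin_resolvent_0 k (unit_seq b N)) \<longlonglongrightarrow> complex_of_real (b * (1 - (-1) ^ k) * fact k * lerch b (Suc k) 1)" .
    from tendsto_Re[OF this] tendsto_Im[OF this] show ?thesis
      by (auto intro!: convergent_imp_Bseq simp: convergent_def)
  qed
  then show "(\<lambda>N. Re (mellin_resolvent_0 k (unit_seq b N))) \<longlonglongrightarrow> b * (1 - (-1) ^ k) * fact k * lerch b (Suc k) 1"
    and "Bseq (\<lambda>N. Im (mellin_resolvent_0 k (unit_seq b N)))"
    by auto
qed

subsection \<open>The real part of the polylogarithm\<close>

text \<open>For \<open>z\<close> off \<open>[1, \<infinity>)\<close> this is the real part of the polylogarithm, integrated by parts once so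
  that the pole at \<open>1 / z\<close> becomes a logarithmic singularity. Hence it also represents the principal
  value when \<open>z > 1\<close>. The excluded point is where the logarithm cannot be dominated uniformly
  in \<open>arg z\<close>.\<close>

definition re_polylog_kernel :: "nat \<Rightarrow> complex \<Rightarrow> real \<Rightarrow> real" where
  "re_polylog_kernel p z y =
     (if p = 1 then 0 else (- ln y) ^ (p - 2) / fact (p - 2) * (- ln (norm (1 - z * of_real y))) / y)"

definition re_polylog :: "nat \<Rightarrow> complex \<Rightarrow> real" where
  "re_polylog p z = (if p = 1 then - ln (norm (1 - z)) else 0)
     + integral ({0<..<1} - {1 / norm z}) (re_polylog_kernel p z)"

lemma borel_measurable_re_polylog_kernel [measurable]: "re_polylog_kernel p z \<in> borel_measurable borel"
  unfolding re_polylog_kernel_def by measurable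

lemma mult_powr_image_Ioi:
  fixes c r :: real
  assumes "c > 0" "r \<noteq> 0"
  shows "(\<lambda>x::real. c * x powr r) ` {0<..} = {0<..}"
proof (intro equalityI subsetI)
  fix y :: real assume "y \<in> {0<..}"
  then show "y \<in> (\<lambda>x. c * x powr r) ` {0<..}"
    using assms by (intro image_eqI[of _ _ "(y / c) powr (1 / r)"]) (auto simp: powr_powr)
qed (use assms in auto)

lemma mellin_substitution_Ioi:
  fixes F :: "real \<Rightarrow> 'a::{euclidean_space,real_normed_field}"
  assumes "c > 0" "r \<noteq> 0" "(\<lambda>v. F v / of_real v) absolutely_integrable_on {0<..}"
  shows "(\<lambda>x. F (c * x powr r) / of_real x) absolutely_integrable_on {0<..}"
    and "integral {0<..} (\<lambda>x. F (c * x powr r) / of_real x)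
         = integral {0<..} (\<lambda>v. F v / of_real v) / of_real \<bar>r\<bar>"
  using mellin_substitution[of "{0<..}" c r F "integral {0<..} (\<lambda>v. F v / of_real v)",
      unfolded mult_powr_image_Ioi[OF assms(1,2)], THEN iffD2, OF _ _ assms(1,2) conjI[OF assms(3) refl]]
  by simp_all

text \<open>After \<open>(- ln y) ^ m \<le> K * y powr (- c)\<close> and
  \<open>y powr (- c) = x powr c * (x * y) powr (- c)\<close>, the substitution
  \<open>v = x * y\<close> and an extension to the whole half-line leave a constant times
  \<open>x powr c\<close>.\<close>

lemma log_majorant_convolution:
  assumes c: "0 < c" "c < 1"
  obtains C where "C \<ge> 0"
    and "\<And>x. x > 0 \<Longrightarrow> (\<lambda>y. (- ln y) ^ m * log_majorant (x * y) / y) absolutely_integrable_on {0<..<1}"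
    and "\<And>x. x > 0 \<Longrightarrow> integral {0<..<1} (\<lambda>y. (- ln y) ^ m * log_majorant (x * y) / y) \<le> C * x powr c"
proof -
  define K where "K = (real m / c) ^ m"
  have K: "K \<ge> 0" using c by (simp add: K_def)
  let ?F = "\<lambda>v. log_majorant v * v powr (- c)"
  define M where "M = integral {0<..} (\<lambda>v. ?F v / v)"
  have F: "(\<lambda>v. ?F v / of_real v) absolutely_integrable_on {0<..}"
    using log_majorant_integrable[OF c] by simp
  have M: "M \<ge> 0" unfolding M_def using F
    by (intro integral_nonneg) (auto simp: log_majorant_nonneg intro: set_lebesgue_integral_eq_integral)
  have *: "(\<lambda>y. (- ln y) ^ m * log_majorant (x * y) / y) absolutely_integrable_on {0<..<1} \<and>
      integral {0<..<1} (\<lambda>y. (- ln y) ^ m * log_majorant (x * y) / y) \<le> K * M * x powr c" if x: "x > 0" for x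
  proof -
    define G where "G = (\<lambda>y. ?F (x * y powr 1) / y)"
    have G: "G absolutely_integrable_on {0<..}" "integral {0<..} G = M"
      using mellin_substitution_Ioi[OF x, of 1 ?F] F by (simp_all add: G_def M_def)
    have G': "G absolutely_integrable_on {0<..<1}"
      by (rule set_integrable_subset[OF G(1)]) auto
    then have Gi: "(\<lambda>y. K * x powr c * G y) integrable_on {0<..<1}"
      by (intro integrable_on_mult_right) (rule set_lebesgue_integral_eq_integral)
    have G0: "G y \<ge> 0" if "y > 0" for y
      using that x by (auto simp: G_def log_majorant_nonneg)
    have le: "(- ln y) ^ m * log_majorant (x * y) / y \<le> K * x powr c * G y" if y: "y \<in> {0<..<1}" for y
    proof -
      have "(- ln y) ^ m * log_majorant (x * y) / y \<le> K * y powr (- c) * log_majorant (x * y) / y"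
        unfolding K_def using x y c
        by (intro divide_right_mono mult_right_mono power_neg_ln_le log_majorant_nonneg) auto
      also have "y powr (- c) = x powr c * (x * y) powr (- c)"
        using x y by (simp add: powr_mult powr_minus)
      finally show ?thesis using y by (simp add: G_def mult_ac)
    qed
    have ai: "(\<lambda>y. (- ln y) ^ m * log_majorant (x * y) / y) absolutely_integrable_on {0<..<1}"
      using le x by (intro absolutely_integrable_on_bound[OF _ _ Gi])
        (auto simp: abs_mult log_majorant_nonneg power_abs)
    moreover have "integral {0<..<1} (\<lambda>y. (- ln y) ^ m * log_majorant (x * y) / y)
        \<le> integral {0<..<1} (\<lambda>y. K * x powr c * G y)"
      using ai Gi le by (intro integral_le) (auto intro: set_lebesgue_integral_eq_integral)
    moreover have "integral {0<..<1} G \<le> integral {0<..} G"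
      using G G' G0 by (intro integral_subset_le) (auto intro: set_lebesgue_integral_eq_integral)
    then have "K * x powr c * integral {0<..<1} G \<le> K * x powr c * M"
      unfolding G(2) using K by (intro mult_left_mono) auto
    ultimately show ?thesis by (simp add: mult_ac)
  qed
  then show thesis using that[of "K * M"] K M by simp
qed

lemma log_majorant_convolution_integrable:
  assumes "x > 0"
  shows "(\<lambda>y. (- ln y) ^ m * log_majorant (x * y) / y) absolutely_integrable_on {0<..<1}"
  by (rule log_majorant_convolution[of "1/2" m]) (use assms in auto)

lemma abs_re_polylog_kernel_le:
  assumes "norm z = 1" "x > 0" "y \<in> {0<..<1} - {1 / x}"
  shows "norm (re_polylog_kernel p (z * of_real x) y) \<le> (- ln y) ^ (p - 2) * log_majorant (x * y) / y"
proof (cases "p = 1")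
  case True
  with assms show ?thesis
    by (auto simp: re_polylog_kernel_def intro!: divide_nonneg_nonneg mult_nonneg_nonneg log_majorant_nonneg)
next
  case False
  have "x * y \<noteq> 1" using assms by (auto simp: field_simps)
  then have "\<bar>ln (norm (1 - z * of_real (x * y)))\<bar> \<le> log_majorant (x * y)"
    using assms by (intro abs_ln_norm_le_log_majorant) auto
  moreover have "(- ln y) ^ (p - 2) / fact (p - 2) \<le> (- ln y) ^ (p - 2)"
  proof -
    have "(- ln y) ^ (p - 2) * 1 \<le> (- ln y) ^ (p - 2) * fact (p - 2)"
      using assms by (intro mult_left_mono) (auto simp: fact_ge_1)
    then show ?thesis by (simp add: divide_le_eq)
  qed
  ultimately have "(- ln y) ^ (p - 2) / fact (p - 2) * \<bar>ln (norm (1 - z * of_real (x * y)))\<bar>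
      \<le> (- ln y) ^ (p - 2) * log_majorant (x * y)"
    using assms by (intro mult_mono) auto
  then have "(- ln y) ^ (p - 2) / fact (p - 2) * \<bar>ln (norm (1 - z * of_real (x * y)))\<bar> / y
      \<le> (- ln y) ^ (p - 2) * log_majorant (x * y) / y"
    using assms by (intro divide_right_mono) auto
  then show ?thesis using assms False
    by (simp add: re_polylog_kernel_def abs_mult power_abs mult.assoc)
qed

lemma re_polylog_kernel_integrable:
  assumes "norm z = 1" "x > 0"
  shows "re_polylog_kernel p (z * of_real x) absolutely_integrable_on ({0<..<1} - {1 / x})"
proof -
  have C: "(\<lambda>y. (- ln y) ^ (p - 2) * log_majorant (x * y) / y) absolutely_integrable_on {0<..<1}"
    by (rule log_majorant_convolution_integrable) fact
  have "(\<lambda>y. (- ln y) ^ (p - 2) * log_majorant (x * y) / y) absolutely_integrable_on ({0<..<1} - {1 / x})"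
    by (rule set_integrable_subset[OF C]) auto
  then have "(\<lambda>y. (- ln y) ^ (p - 2) * log_majorant (x * y) / y) integrable_on ({0<..<1} - {1 / x})"
    by (rule set_lebesgue_integral_eq_integral)
  then show ?thesis
    by (rule absolutely_integrable_on_bound[rotated 2]) (use abs_re_polylog_kernel_le[OF assms] in auto)
qed

text \<open>Uniform in \<open>z\<close>. For \<open>p = 1\<close> such a bound fails, since the
  boundary term \<open>ln (norm (1 - z))\<close> at \<open>x = 1\<close> is unbounded as
  \<open>z\<close> tends to 1.\<close>

lemma re_polylog_bound:
  assumes "p \<ge> 2" "0 < c" "c < 1"
  obtains C where "C \<ge> 0" "\<And>z x. norm z = 1 \<Longrightarrow> x > 0 \<Longrightarrow> \<bar>re_polylog p (z * of_real x)\<bar> \<le> C * x powr c"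
proof -
  obtain C where C: "C \<ge> 0" 
    "\<And>x. x > 0 \<Longrightarrow> (\<lambda>y. (- ln y) ^ (p - 2) * log_majorant (x * y) / y) absolutely_integrable_on {0<..<1}"
    "\<And>x. x > 0 \<Longrightarrow> integral {0<..<1} (\<lambda>y. (- ln y) ^ (p - 2) * log_majorant (x * y) / y) \<le> C * x powr c"
    using log_majorant_convolution[OF assms(2,3), of "p - 2"] by blast
  have "\<bar>re_polylog p (z * of_real x)\<bar> \<le> C * x powr c" if z: "norm z = 1" and x: "x > 0" for z x
  proof -
    let ?h = "\<lambda>y. (- ln y) ^ (p - 2) * log_majorant (x * y) / y"
    let ?S = "{0<..<1} - {1 / x}"
    have h: "?h absolutely_integrable_on ?S"
      by (rule set_integrable_subset[OF C(2)[OF x]]) auto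
    have "norm (integral ?S (re_polylog_kernel p (z * of_real x))) \<le> integral ?S ?h"
    proof (rule integral_norm_bound_integral)
      show "re_polylog_kernel p (z * of_real x) integrable_on ?S"
        using re_polylog_kernel_integrable[OF z x] by (rule set_lebesgue_integral_eq_integral)
      show "?h integrable_on ?S" using h by (rule set_lebesgue_integral_eq_integral)
    qed (rule abs_re_polylog_kernel_le[OF z x])
    also have "\<dots> \<le> integral {0<..<1} ?h"
      using h C(2)[OF x] x
      by (intro integral_subset_le)
        (auto intro!: set_lebesgue_integral_eq_integral mult_nonneg_nonneg divide_nonneg_nonneg log_majorant_nonneg)
    also have "\<dots> \<le> C * x powr c" by (rule C(3)[OF x])
    finally show ?thesis using assms(1) x z by (simp add: re_polylog_def norm_mult)
  qed
  then show thesis using that C(1) by blast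
qed

text \<open>Dominated convergence with the majorant that is independent of \<open>z\<close>;
  \<open>x \<noteq> 1\<close> keeps the boundary term of \<open>p = 1\<close> off its
  singularity.\<close>

lemma re_polylog_tendsto:
  assumes b: "b \<in> {1, -1}" and x: "x > 0" "x \<noteq> 1"
  shows "(\<lambda>N. re_polylog p (unit_seq b N * of_real x)) \<longlonglongrightarrow> re_polylog p (of_real (b * x))"
proof -
  let ?S = "{0<..<1} - {1 / x}"
  have nz: "1 - complex_of_real b * of_real t \<noteq> 0" if "t > 0" "t \<noteq> 1" for t
    using that b by (auto simp: complex_eq_iff)
  have norm: "norm (unit_seq b N * complex_of_real x) = x" "norm (complex_of_real (b * x)) = x" for N
    using x b norm_unit_seq[OF b, of N] by (auto simp: norm_mult)
  have ln: "(\<lambda>N. ln (norm (1 - unit_seq b N * complex_of_real t))) \<longlonglongrightarrow> ln (norm (1 - complex_of_real (b * t)))"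
    if "t > 0" "t \<noteq> 1" for t
    using nz[OF that] unfolding of_real_mult by (intro tendsto_intros unit_seq_tendsto) auto
  have C: "(\<lambda>y. (- ln y) ^ (p - 2) * log_majorant (x * y) / y) absolutely_integrable_on {0<..<1}"
    by (rule log_majorant_convolution_integrable) fact
  have h: "(\<lambda>y. (- ln y) ^ (p - 2) * log_majorant (x * y) / y) integrable_on ?S"
    using set_integrable_subset[OF C, of ?S] by (auto intro: set_lebesgue_integral_eq_integral)
  have "(\<lambda>N. integral ?S (re_polylog_kernel p (unit_seq b N * of_real x)))
      \<longlonglongrightarrow> integral ?S (re_polylog_kernel p (of_real (b * x)))"
  proof (rule dominated_convergence(2)[OF _ h])
    show "re_polylog_kernel p (unit_seq b N * of_real x) integrable_on ?S" for N
      using re_polylog_kernel_integrable[OF norm_unit_seq[OF b] x(1)]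
      by (rule set_lebesgue_integral_eq_integral)
    show "norm (re_polylog_kernel p (unit_seq b N * complex_of_real x) y)
        \<le> (- ln y) ^ (p - 2) * log_majorant (x * y) / y" if "y \<in> ?S" for y N
      using that by (intro abs_re_polylog_kernel_le norm_unit_seq b x)
    fix y assume y: "y \<in> ?S"
    then have "x * y > 0" "x * y \<noteq> 1" using x by (auto simp: field_simps)
    from ln[OF this] show "(\<lambda>N. re_polylog_kernel p (unit_seq b N * complex_of_real x) y)
        \<longlonglongrightarrow> re_polylog_kernel p (of_real (b * x)) y"
      using y by (cases "p = 1") (auto simp: re_polylog_kernel_def mult.assoc intro!: tendsto_intros)
  qed
  then show ?thesis
    unfolding re_polylog_def norm using ln[OF x]
    by (cases "p = 1") (auto intro!: tendsto_intros)
qed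

text \<open>Computed from the squared norm and not from a branch of the complex logarithm, because
  \<open>1 - z * y\<close> is a negative real beyond the pole in the principal value case.\<close>

lemma has_derivative_ln_norm_one_minus:
  assumes "1 - z * complex_of_real y \<noteq> 0"
  shows "((\<lambda>y. - ln (norm (1 - z * complex_of_real y))) has_real_derivative
           Re (z / (1 - z * complex_of_real y))) (at y)"
proof -
  let ?Q = "\<lambda>y. (1 - Re z * y)\<^sup>2 + (Im z * y)\<^sup>2"
  have Q: "norm (1 - z * complex_of_real y) = sqrt (?Q y)" for y
    by (simp add: cmod_def)
  have "?Q y > 0" using assms unfolding Q[symmetric] 
    by (metis Q real_sqrt_gt_0_iff zero_less_norm_iff)
  then have "((\<lambda>y. - ln (sqrt (?Q y))) has_real_derivative (Re z - (Re z * Re z + Im z * Im z) * y) / ?Q y) (at y)"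
    by (auto intro!: derivative_eq_intros simp: divide_simps) (simp add: power2_eq_square algebra_simps)?
  moreover have "Re (z / (1 - z * complex_of_real y)) = (Re z - (Re z * Re z + Im z * Im z) * y) / ?Q y"
    by (simp add: Re_divide power2_eq_square algebra_simps)
  ultimately show ?thesis unfolding Q by simp
qed

lemma has_derivative_neg_ln_power:
  assumes "y > 0" "p \<ge> 1"
  shows "((\<lambda>y. (- ln y) ^ (p - 1) / fact (p - 1)) has_real_derivative
           (if p = 1 then 0 else - ((- ln y) ^ (p - 2) / fact (p - 2)) / y)) (at y)"
proof (cases "p = 1")
  case False
  define m where "m = p - 2"
  have p: "p - 1 = Suc m" "p - 2 = m" using assms False by (auto simp: m_def)
  have "((\<lambda>v. (- ln v) ^ Suc m) has_real_derivative real (Suc m) * (- ln y) ^ m * (- (1 / y))) (at y)"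
    by (rule DERIV_cong[OF DERIV_power[OF DERIV_minus[OF DERIV_ln_divide[OF assms(1)]]]])
      (simp del: of_nat_Suc)
  from DERIV_cdivide[OF this, of "fact (Suc m)"] show ?thesis
    unfolding p using False by (simp add: divide_simps mult_ac del: of_nat_Suc)
qed simp

text \<open>The product rule for \<open>\<Psi>\<close>, on any interval free of the pole: the whole
  unit interval for an ordinary integral, the two pieces around \<open>1 / z\<close> for a principal
  value.\<close>

lemma polylog_parts:
  fixes z :: complex
  assumes p: "p \<ge> 1" and cd: "0 \<le> c" "c \<le> d" "d \<le> 1"
    and nz: "\<And>y. y \<in> {c..d} \<Longrightarrow> 1 - z * of_real y \<noteq> 0"
  defines "\<Psi> \<equiv> \<lambda>y. (- ln y) ^ (p - 1) / fact (p - 1) * (- ln (norm (1 - z * of_real y)))"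
  shows "((\<lambda>y. (- ln y) ^ (p - 1) / fact (p - 1) * Re (z / (1 - z * of_real y)) - re_polylog_kernel p z y)
           has_integral \<Psi> d - \<Psi> c) {c..d}"
proof (rule fundamental_theorem_of_calculus_interior[OF cd(2)])
  have der: "(\<Psi> has_real_derivative
      (- ln y) ^ (p - 1) / fact (p - 1) * Re (z / (1 - z * of_real y)) - re_polylog_kernel p z y) (at y)"
    if "y > 0" "y \<in> {c..d}" for y
    unfolding \<Psi>_def
    by (rule DERIV_cong[OF DERIV_mult[OF has_derivative_neg_ln_power[OF that(1) p]
            has_derivative_ln_norm_one_minus[OF nz[OF that(2)]]]])
      (simp add: re_polylog_kernel_def)
  show "(\<Psi> has_vector_derivative
      (- ln y) ^ (p - 1) / fact (p - 1) * Re (z / (1 - z * of_real y)) - re_polylog_kernel p z y) (at y)"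
    if "y \<in> {c<..<d}" for y
    using der[of y] that cd by (auto simp: has_real_derivative_iff_has_vector_derivative)
  \<comment> \<open>\<open>ln (norm (1 - z * y))\<close> is \<open>O(y)\<close> at 0, which beats
    the powers of \<open>ln y\<close>; and \<open>\<Psi> 0 = 0\<close> since
    \<open>ln 1 = 0\<close>.\<close>
  have at0: "(\<Psi> \<longlongrightarrow> 0) (at_right 0)"
  proof -
    let ?L = "\<lambda>y. - ln (norm (1 - z * complex_of_real y))"
    have "(?L has_real_derivative Re (z / (1 - z * of_real 0))) (at 0)"
      by (rule has_derivative_ln_norm_one_minus) simp
    then have "((\<lambda>y. ?L y / y) \<longlongrightarrow> Re z) (at 0)"
      by (simp add: has_field_derivative_iff)
    then have "((\<lambda>y. ?L y / y) \<longlongrightarrow> Re z) (at_right 0)"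
      by (rule filterlim_mono) (auto simp: at_le)
    moreover have "((\<lambda>y. y powr 1 * (- ln y) ^ (p - 1) / fact (p - 1)) \<longlongrightarrow> 0 / fact (p - 1)) (at_right (0::real))"
      by (intro tendsto_divide tendsto_powr_times_power_ln) auto
    ultimately have "((\<lambda>y. y powr 1 * (- ln y) ^ (p - 1) / fact (p - 1) * (?L y / y)) \<longlongrightarrow> 0 / fact (p - 1) * Re z) (at_right 0)"
      by (intro tendsto_mult)
    moreover have "\<forall>\<^sub>F y in at_right 0. y powr 1 * (- ln y) ^ (p - 1) / fact (p - 1) * (?L y / y) = \<Psi> y"
      by (auto simp: eventually_at_right_field \<Psi>_def intro!: exI[of _ 1])
    ultimately show ?thesis using Lim_transform_eventually by fastforce
  qed
  show "continuous_on {c..d} \<Psi>"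
    unfolding continuous_on_eq_continuous_within
  proof
    fix y assume y: "y \<in> {c..d}"
    show "continuous (at y within {c..d}) \<Psi>"
    proof (cases "y = 0")
      case True
      then have "c = 0" using y cd by auto
      show ?thesis
      proof (cases "d = 0")
        case True
        with \<open>c = 0\<close> \<open>y = 0\<close> show ?thesis
          using continuous_on_sing[of 0 \<Psi>] by (simp add: continuous_on_eq_continuous_within)
      next
        case False
        then have "d > 0" using cd by auto
        with at0 \<open>c = 0\<close> \<open>y = 0\<close> show ?thesis
          by (simp add: continuous_within at_within_Icc_at_right \<Psi>_def)
      qed
    next
      case False
      with y cd der[of y] show ?thesis
        by (auto intro: continuous_at_imp_continuous_at_within DERIV_isCont)
    qed
  qed
qed

lemma re_polylog_kernel_has_integral:
  assumes "norm z = 1" "x > 0"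
  shows "(re_polylog_kernel p (z * of_real x) has_integral
           integral ({0<..<1} - {1 / x}) (re_polylog_kernel p (z * of_real x))) {0..1}"
proof -
  have "(re_polylog_kernel p (z * of_real x) has_integral
           integral ({0<..<1} - {1 / x}) (re_polylog_kernel p (z * of_real x))) ({0<..<1} - {1 / x})"
    using re_polylog_kernel_integrable[OF assms] by (auto intro: set_lebesgue_integral_eq_integral)
  then show ?thesis
    by (rule iffD1[OF has_integral_spike_set_eq, rotated 2]) (rule negligible_subset[of "{0, 1, 1 / x}"], auto)+
qed

lemma has_integral_re_polylog:
  assumes p: "p \<ge> 1" and z: "norm z = 1" and x: "x > 0"
    and nz: "\<And>y. y \<in> {0..1} \<Longrightarrow> 1 - z * of_real x * of_real y \<noteq> 0"
  shows "((\<lambda>y. (- ln y) ^ (p - 1) / fact (p - 1) * Re (z * of_real x / (1 - z * of_real x * of_real y)))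
           has_integral re_polylog p (z * of_real x)) {0<..<1}"
proof -
  let ?w = "z * complex_of_real x"
  have "norm ?w = x" using z x by (simp add: norm_mult)
  \<comment> \<open>At the endpoint 1 the factor \<open>(- ln 1) ^ (p - 1)\<close> vanishes unless
    \<open>p = 1\<close>; this is the boundary term in \<open>re_polylog\<close>.\<close>
  then have val: "(- ln 1) ^ (p - 1) / fact (p - 1) * (- ln (norm (1 - ?w * of_real 1)))
      - (- ln 0) ^ (p - 1) / fact (p - 1) * (- ln (norm (1 - ?w * of_real 0)))
      + integral ({0<..<1} - {1 / x}) (re_polylog_kernel p ?w) = re_polylog p ?w"
    using p by (cases "p = 1") (auto simp: re_polylog_def power_0_left)
  from has_integral_add[OF polylog_parts[OF p _ _ _ nz] re_polylog_kernel_has_integral[OF z x, of p]]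
  have "((\<lambda>y. (- ln y) ^ (p - 1) / fact (p - 1) * Re (?w / (1 - ?w * of_real y)))
      has_integral re_polylog p ?w) {0..1}"
    unfolding val by simp
  then show ?thesis by (simp only: has_integral_Icc_iff_Ioo)
qed

text \<open>The symmetric cut makes \<open>\<bar>1 - x * y\<bar>\<close> equal to
  \<open>x * \<epsilon>\<close> at both inner endpoints. Their boundary terms combine into a
  difference of values of \<open>u\<close>, of order \<open>\<epsilon>\<close>, times
  \<open>ln (x * \<epsilon>)\<close>, which tends to 0.\<close>

lemma pv_integral_re_polylog:
  assumes p: "p \<ge> 1" and x: "x > 1"
  shows "((\<lambda>\<epsilon>. integral {0..1 / x - \<epsilon>} (\<lambda>y. (- ln y) ^ (p - 1) / fact (p - 1) * (x / (1 - x * y)))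
         + integral {1 / x + \<epsilon>..1} (\<lambda>y. (- ln y) ^ (p - 1) / fact (p - 1) * (x / (1 - x * y))))
       \<longlongrightarrow> re_polylog p (of_real x)) (at_right 0)"
proof -
  define c where "c = 1 / x"
  have c: "0 < c" "c < 1" using x by (auto simp: c_def)
  define h where "h = (\<lambda>y. (- ln y) ^ (p - 1) / fact (p - 1) * (x / (1 - x * y)))"
  define u where "u = (\<lambda>y::real. (- ln y) ^ (p - 1) / fact (p - 1))"
  define K where "K = re_polylog_kernel p (of_real x)"
  define I where "I = integral ({0<..<1} - {1 / x}) K"
  have K: "(K has_integral I) {0..1}"
    using re_polylog_kernel_has_integral[of 1 x p] x by (simp add: K_def I_def)
  then have Ki: "K integrable_on {0..1}" by (auto simp: integrable_on_def)
  have norm: "norm (1 - complex_of_real x * complex_of_real y) = \<bar>1 - x * y\<bar>" for y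
    by (metis norm_of_real of_real_1 of_real_diff of_real_mult)
  have Re: "Re (complex_of_real x / (1 - complex_of_real x * complex_of_real y)) = x / (1 - x * y)" for y
    by (metis Re_complex_of_real of_real_1 of_real_diff of_real_divide of_real_mult)
  have nz: "1 - complex_of_real x * complex_of_real y \<noteq> 0" if "y \<noteq> c" for y
  proof -
    have "1 - x * y \<noteq> 0" using that x by (auto simp: c_def field_simps)
    then show ?thesis using norm[of y] by auto
  qed
  have parts: "integral {s..t} h = u t * (- ln \<bar>1 - x * t\<bar>) - u s * (- ln \<bar>1 - x * s\<bar>) + integral {s..t} K"
    if st: "0 \<le> s" "s \<le> t" "t \<le> 1" "c \<notin> {s..t}" for s t
  proof -
    have nz': "1 - complex_of_real x * complex_of_real y \<noteq> 0" if "y \<in> {s..t}" for y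
      using nz[of y] st(4) that by metis
    have "((\<lambda>y. h y - K y) has_integral u t * (- ln \<bar>1 - x * t\<bar>) - u s * (- ln \<bar>1 - x * s\<bar>)) {s..t}"
      using polylog_parts[OF p st(1-3) nz'] unfolding norm Re h_def K_def u_def .
    moreover have "(K has_integral integral {s..t} K) {s..t}"
      using integrable_on_subinterval[OF Ki, of s t] st by (auto intro: integrable_integral)
    ultimately have "((\<lambda>y. (h y - K y) + K y) has_integral
        u t * (- ln \<bar>1 - x * t\<bar>) - u s * (- ln \<bar>1 - x * s\<bar>) + integral {s..t} K) {s..t}"
      by (rule has_integral_add)
    then show ?thesis by (simp add: integral_unique)
  qed
  have u1: "u 1 * (- ln \<bar>1 - x * 1\<bar>) = (if p = 1 then - ln (norm (1 - complex_of_real x)) else 0)"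
    using p norm[of 1] by (auto simp: u_def power_0_left)
  have ev: "\<forall>\<^sub>F \<epsilon> in at_right 0. integral {0..c - \<epsilon>} h + integral {c + \<epsilon>..1} h
      = u 1 * (- ln \<bar>1 - x * 1\<bar>) + (u (c - \<epsilon>) - u (c + \<epsilon>)) / \<epsilon> * (\<epsilon> * (- ln (x * \<epsilon>)))
        + (integral {0..c - \<epsilon>} K + integral {c + \<epsilon>..1} K)"
    unfolding eventually_at_right_field
  proof (intro exI[of _ "min c (1 - c)"] conjI allI impI)
    fix \<epsilon> :: real assume e: "0 < \<epsilon>" "\<epsilon> < min c (1 - c)"
    have "1 - x * (c - \<epsilon>) = x * \<epsilon>" "1 - x * (c + \<epsilon>) = - (x * \<epsilon>)"
      using x by (simp_all add: c_def field_simps)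
    then have "\<bar>1 - x * (c - \<epsilon>)\<bar> = x * \<epsilon>" "\<bar>1 - x * (c + \<epsilon>)\<bar> = x * \<epsilon>"
      using e x by auto
    moreover have "(u (c - \<epsilon>) - u (c + \<epsilon>)) / \<epsilon> * (\<epsilon> * (- ln (x * \<epsilon>))) = (u (c - \<epsilon>) - u (c + \<epsilon>)) * (- ln (x * \<epsilon>))"
      using e by simp
    ultimately show "integral {0..c - \<epsilon>} h + integral {c + \<epsilon>..1} h
      = u 1 * (- ln \<bar>1 - x * 1\<bar>) + (u (c - \<epsilon>) - u (c + \<epsilon>)) / \<epsilon> * (\<epsilon> * (- ln (x * \<epsilon>)))
        + (integral {0..c - \<epsilon>} K + integral {c + \<epsilon>..1} K)"
      using e c parts[of 0 "c - \<epsilon>"] parts[of "c + \<epsilon>" 1] by (simp add: left_diff_distrib)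
  qed (use c in auto)
  obtain D where D: "(u has_real_derivative D) (at c)"
    using has_derivative_neg_ln_power[OF c(1) p] unfolding u_def by blast
  have lim_u: "((\<lambda>\<epsilon>. (u (c - \<epsilon>) - u (c + \<epsilon>)) / \<epsilon>) \<longlongrightarrow> - D - D) (at_right 0)"
  proof -
    have 1: "((\<lambda>h. (u (c + h) - u c) / h) \<longlongrightarrow> D) (at 0)" using D by (simp add: DERIV_def)
    have "((\<lambda>h. (u (c + h) - u c) / h) \<longlongrightarrow> D) (at_right 0)"
      by (rule filterlim_mono[OF 1]) (auto simp: at_le)
    moreover have "filterlim uminus (at 0) (at_right (0::real))"
      by (auto simp: filterlim_at eventually_at_filter intro!: tendsto_eq_intros)
    from filterlim_compose[OF 1 this]
    have "((\<lambda>h. (u (c - h) - u c) / - h) \<longlongrightarrow> D) (at_right 0)" by simp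
    ultimately have "((\<lambda>h. - ((u (c - h) - u c) / - h) - (u (c + h) - u c) / h) \<longlongrightarrow> - D - D) (at_right 0)"
      by (intro tendsto_intros)
    then show ?thesis by (simp add: diff_divide_distrib)
  qed
  have lim_ln: "((\<lambda>\<epsilon>. \<epsilon> * (- ln (x * \<epsilon>))) \<longlongrightarrow> 0) (at_right 0)"
    using x by real_asymp
  have lim_K: "((\<lambda>\<epsilon>. integral {0..c - \<epsilon>} K + integral {c + \<epsilon>..1} K) \<longlongrightarrow> I) (at_right 0)"
  proof -
    have cont: "isCont (\<lambda>t. integral {0..t} K) c" "isCont (\<lambda>t. integral {t..1} K) c"
      by (rule continuous_on_interior[OF indefinite_integral_continuous_1[OF Ki]]
          continuous_on_interior[OF indefinite_integral_continuous_1'[OF Ki]], use c in simp)+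
    have lim: "((\<lambda>\<epsilon>. c - \<epsilon>) \<longlongrightarrow> c) (at_right 0)" "((\<lambda>\<epsilon>. c + \<epsilon>) \<longlongrightarrow> c) (at_right 0)"
      by (auto intro!: tendsto_eq_intros)
    from tendsto_add[OF isCont_tendsto_compose[OF cont(1) lim(1)] isCont_tendsto_compose[OF cont(2) lim(2)]]
    have "((\<lambda>\<epsilon>. integral {0..c - \<epsilon>} K + integral {c + \<epsilon>..1} K) \<longlongrightarrow> integral {0..c} K + integral {c..1} K) (at_right 0)" .
    also have "integral {0..c} K + integral {c..1} K = integral {0..1} K"
      using c Ki by (intro Henstock_Kurzweil_Integration.integral_combine) auto
    also have "\<dots> = I" using K by (rule integral_unique)
    finally show ?thesis .
  qed
  have "((\<lambda>\<epsilon>. u 1 * (- ln \<bar>1 - x * 1\<bar>) + (u (c - \<epsilon>) - u (c + \<epsilon>)) / \<epsilon> * (\<epsilon> * (- ln (x * \<epsilon>)))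
        + (integral {0..c - \<epsilon>} K + integral {c + \<epsilon>..1} K))
      \<longlongrightarrow> u 1 * (- ln \<bar>1 - x * 1\<bar>) + (- D - D) * 0 + I) (at_right 0)"
    by (intro tendsto_add tendsto_mult[OF lim_u lim_ln] tendsto_const lim_K)
  then have "((\<lambda>\<epsilon>. integral {0..c - \<epsilon>} h + integral {c + \<epsilon>..1} h)
      \<longlongrightarrow> u 1 * (- ln \<bar>1 - x * 1\<bar>) + (- D - D) * 0 + I) (at_right 0)"
    using tendsto_cong[OF ev] by simp
  moreover have "u 1 * (- ln \<bar>1 - x * 1\<bar>) + (- D - D) * 0 + I = re_polylog p (of_real x)"
    unfolding u1 using x by (simp add: re_polylog_def I_def K_def)
  ultimately show ?thesis unfolding c_def h_def by simp
qed

text \<open>Below 1 this is the ordinary integral, above 1 the principal value; the sign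
  \<open>(-1) ^ (p - 1)\<close> of \<open>polylog\<close> turns \<open>ln y\<close> into
  \<open>- ln y\<close>.\<close>

lemma polylog_eq_re_polylog:
  assumes p: "p \<ge> 1" and b: "b \<in> {1, -1}" and x: "x > 0" "x \<noteq> 1"
  shows "polylog p (b * x) = re_polylog p (of_real (b * x))"
proof -
  define t where "t = b * x"
  define f where "f = (\<lambda>y. t * ln y ^ (p - 1) / (1 - t * y))"
  define h where "h = (\<lambda>y. (- ln y) ^ (p - 1) / fact (p - 1) * (t / (1 - t * y)))"
  have fh: "f = (\<lambda>y. ((-1) ^ (p - 1) * fact (p - 1)) * h y)"
    unfolding f_def h_def by (rule ext) (simp add: power_minus[of "ln _"] flip: power_add)
  have cancel: "(-1) ^ (p - 1) / fact (p - 1) * ((-1) ^ (p - 1) * fact (p - 1)) = (1::real)"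
    by (simp flip: power_add)
  show ?thesis
  proof (cases "t \<le> 1")
    case True
    have nz: "1 - t * y > 0" if "y \<in> {0..1}" for y
    proof (cases "b = 1")
      case True
      with \<open>t \<le> 1\<close> x have "x < 1" by (auto simp: t_def)
      then have "x * y < 1" using that x by (metis atLeastAtMost_iff mult_left_le order_le_less_trans less_imp_le)
      then show ?thesis using True by (simp add: t_def)
    next
      case False
      then have "b = -1" using b by auto
      moreover have "x * y \<ge> 0" using that x by simp
      ultimately show ?thesis by (simp add: t_def)
    qed
    have Re: "Re (complex_of_real t / (1 - complex_of_real t * complex_of_real y)) = t / (1 - t * y)" for y
      by (metis Re_complex_of_real of_real_1 of_real_diff of_real_divide of_real_mult)
    have "1 - complex_of_real b * of_real x * of_real y \<noteq> 0" if "y \<in> {0..1}" for y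
    proof -
      have "complex_of_real (1 - t * y) \<noteq> 0" using nz[OF that] unfolding of_real_eq_0_iff by simp
      then show ?thesis by (simp add: t_def)
    qed
    moreover have "norm (complex_of_real b) = 1" using b by auto
    ultimately have "((\<lambda>y. (- ln y) ^ (p - 1) / fact (p - 1) *
          Re (of_real b * of_real x / (1 - of_real b * of_real x * complex_of_real y)))
        has_integral re_polylog p (of_real b * of_real x)) {0<..<1}"
      by (intro has_integral_re_polylog p x(1))
    then have "(h has_integral re_polylog p (of_real t)) {0<..<1}"
      unfolding h_def Re[symmetric] by (simp add: t_def)
    then have "integral {0..1} h = re_polylog p (of_real t)"
      by (intro integral_unique) (simp only: has_integral_Icc_iff_Ioo)
    then have "integral {0..1} f = ((-1) ^ (p - 1) * fact (p - 1)) * re_polylog p (of_real t)"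
      unfolding fh by simp
    moreover have "polylog p t = (-1) ^ (p - 1) / fact (p - 1) * integral {0..1} f"
      using True by (simp add: polylog_def f_def)
    ultimately have "polylog p t = (-1) ^ (p - 1) / fact (p - 1) * ((-1) ^ (p - 1) * fact (p - 1)) * re_polylog p (of_real t)"
      by (simp only: mult.assoc)
    then show ?thesis unfolding cancel t_def by simp
  next
    case False
    have "((\<lambda>\<epsilon>. ((-1) ^ (p - 1) * fact (p - 1)) * (integral {0..1 / t - \<epsilon>} h + integral {1 / t + \<epsilon>..1} h))
       \<longlongrightarrow> ((-1) ^ (p - 1) * fact (p - 1)) * re_polylog p (of_real t)) (at_right 0)"
      unfolding h_def using False by (intro tendsto_mult tendsto_const pv_integral_re_polylog p) auto
    then have "((\<lambda>\<epsilon>. integral {0..1 / t - \<epsilon>} f + integral {1 / t + \<epsilon>..1} f)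
       \<longlongrightarrow> ((-1) ^ (p - 1) * fact (p - 1)) * re_polylog p (of_real t)) (at_right 0)"
      unfolding fh integral_mult_right by (simp only: distrib_left)
    then have "pv_integral 0 (1 / t) 1 f = ((-1) ^ (p - 1) * fact (p - 1)) * re_polylog p (of_real t)"
      unfolding pv_integral_def by (intro tendsto_Lim) auto
    moreover have "polylog p t = (-1) ^ (p - 1) / fact (p - 1) * pv_integral 0 (1 / t) 1 f"
      using False by (simp add: polylog_def f_def)
    ultimately have "polylog p t = (-1) ^ (p - 1) / fact (p - 1) * ((-1) ^ (p - 1) * fact (p - 1)) * re_polylog p (of_real t)"
      by (simp only: mult.assoc)
    then show ?thesis unfolding cancel t_def by simp
  qed
qed

text \<open>For \<open>p \<ge> 2\<close> the power bound on \<open>re_polylog\<close> suffices. For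
  \<open>p = 1\<close> the singularity at \<open>x = 1\<close> stays in the majorant, whose
  integrability follows from \<open>log_majorant_integrable\<close> by
  \<open>v = x ^ n\<close>.\<close>

lemma re_polylog_dominated:
  assumes a: "a \<in> {1, -1}" "a = 1 \<Longrightarrow> q \<noteq> 1" and "p \<ge> 1" "q \<ge> 1" "n \<ge> 1"
  obtains D where "D integrable_on {0<..}"
    and "\<And>z x. norm z = 1 \<Longrightarrow> x > 0 \<Longrightarrow> x \<noteq> 1 \<Longrightarrow>
           \<bar>log_kernel q a x * re_polylog p (z * of_real (x ^ n))\<bar> \<le> D x"
proof -
  obtain C where C: "C \<ge> 0" "\<And>x. x > 0 \<Longrightarrow> \<bar>log_kernel q a x\<bar> \<le> C * x powr (- 3 / 2)"
    "(\<lambda>x. log_kernel q a x * x powr (1/2)) absolutely_integrable_on {0<..}"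
    using log_kernel_bound[OF a(1) assms(4) a(2)] by blast
  \<comment> \<open>Chosen so that \<open>(x ^ n) powr c = x powr (1/2)\<close>, the weight in
    \<open>log_kernel_bound\<close>.\<close>
  define c where "c = 1 / (2 * real n)"
  have c: "0 < c" "c < 1" "real n * c = 1 / 2" using assms by (auto simp: c_def)
  show thesis
  proof (cases "p = 1")
    case True
    define D where "D = (\<lambda>x. C * (log_majorant (x ^ n) * x powr (- (1/2)) / x))"
    let ?F = "\<lambda>v. log_majorant v * v powr (- c)"
    have "(\<lambda>x. ?F (1 * x powr real n) / x) absolutely_integrable_on {0<..}"
      using mellin_substitution_Ioi(1)[of 1 "real n" ?F] log_majorant_integrable[OF c(1,2)] assms by simp
    then have F: "(\<lambda>x. ?F (1 * x powr real n) / x) integrable_on {0<..}"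
      by (rule set_lebesgue_integral_eq_integral)
    have eq: "?F (1 * x powr real n) / x = log_majorant (x ^ n) * x powr (- (1/2)) / x" if "x \<in> {0<..}" for x
    proof -
      have "real n * (- c) = - (1/2)" using c(3) by simp
      then have "(x powr real n) powr (- c) = x powr (- (1/2))" by (simp only: powr_powr)
      then show ?thesis using that by (simp add: powr_realpow)
    qed
    have "(\<lambda>x. log_majorant (x ^ n) * x powr (- (1/2)) / x) integrable_on {0<..}"
      by (rule integrable_eq[OF F eq])
    then have "D integrable_on {0<..}" unfolding D_def by (rule integrable_on_mult_right)
    moreover have "\<bar>log_kernel q a x * re_polylog p (z * of_real (x ^ n))\<bar> \<le> D x"
      if z: "norm z = 1" and x: "x > 0" "x \<noteq> 1" for z x
    proof -
      have "x ^ n \<noteq> 1" using power_eq_iff_eq_base[of n x 1] x assms(5) by simp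
      moreover have "re_polylog_kernel 1 w = (\<lambda>_. 0)" for w
        by (simp add: fun_eq_iff re_polylog_kernel_def)
      then have "re_polylog p w = - ln (norm (1 - w))" for w
        by (simp add: re_polylog_def True)
      ultimately have "\<bar>re_polylog p (z * of_real (x ^ n))\<bar> \<le> log_majorant (x ^ n)"
        using abs_ln_norm_le_log_majorant[OF z, of "x ^ n"] x by simp
      then have "\<bar>log_kernel q a x * re_polylog p (z * of_real (x ^ n))\<bar> \<le> C * x powr (- 3 / 2) * log_majorant (x ^ n)"
        unfolding abs_mult using x C by (intro mult_mono) auto
      also have "x powr (- 3 / 2) = x powr (- (1/2)) / x"
        using x powr_diff[of x "-(1/2)" 1] by simp
      finally show ?thesis by (simp add: D_def mult_ac)
    qed
    ultimately show thesis using that by blast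
  next
    case False
    then obtain B where B: "B \<ge> 0" "\<And>z x. norm z = 1 \<Longrightarrow> x > 0 \<Longrightarrow> \<bar>re_polylog p (z * of_real x)\<bar> \<le> B * x powr c"
      using re_polylog_bound[of p c] c assms by (metis One_nat_def Suc_1 Suc_leI le_neq_implies_less)
    define D where "D = (\<lambda>x. B * \<bar>log_kernel q a x * x powr (1/2)\<bar>)"
    have "D integrable_on {0<..}"
      using C(3) unfolding D_def absolutely_integrable_on_def by (intro integrable_on_mult_right) simp
    moreover have "\<bar>log_kernel q a x * re_polylog p (z * of_real (x ^ n))\<bar> \<le> D x"
      if z: "norm z = 1" and x: "x > 0" "x \<noteq> 1" for z x
    proof -
      have "(x ^ n) powr c = x powr (real n * c)" using x by (simp add: powr_powr flip: powr_realpow)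
      then have "(x ^ n) powr c = x powr (1/2)" unfolding c(3) .
      then have "\<bar>re_polylog p (z * of_real (x ^ n))\<bar> \<le> B * x powr (1/2)"
        using B(2)[OF z, of "x ^ n"] x by simp
      then have "\<bar>log_kernel q a x\<bar> * \<bar>re_polylog p (z * of_real (x ^ n))\<bar> \<le> \<bar>log_kernel q a x\<bar> * (B * x powr (1/2))"
        by (intro mult_left_mono) auto
      then show ?thesis by (simp add: D_def abs_mult mult_ac)
    qed
    ultimately show thesis using that by blast
  qed
qed

subsection \<open>The formula off the real axis\<close>

text \<open>For \<open>t > 1\<close>, \<open>1 - z * t = - z * t * (1 - cnj z / t)\<close> reduces
  to the first case. The growth in \<open>t\<close> serves Fubini at infinity; the constant
  degenerates as \<open>z\<close> tends to 1, so the integrals are exchanged at fixed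
  \<open>z\<close>.\<close>

lemma norm_one_minus_ge_linear:
  assumes "norm z = 1" "t \<ge> 0"
  shows "norm (1 - z * complex_of_real t) \<ge> norm (1 - z) / 4 * (1 + t)"
proof (cases "t \<le> 1")
  case True
  have "norm (1 - z) / 4 * (1 + t) \<le> norm (1 - z) / 4 * 2"
    using True by (intro mult_left_mono) auto
  with norm_one_minus_ge(1)[OF assms True] show ?thesis by linarith
next
  case False
  have zc: "z * cnj z = 1" using assms(1) by (simp add: complex_norm_square[symmetric])
  have "1 - z * complex_of_real t = - (z * of_real t) * (1 - cnj z * complex_of_real (1 / t))"
    using False zc by (simp add: field_simps)
  then have "norm (1 - z * complex_of_real t) = t * norm (1 - cnj z * complex_of_real (1 / t))"
    using assms by (simp only: norm_mult norm_minus_cancel norm_of_real)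
  moreover have "norm (1 - cnj z * complex_of_real (1 / t)) \<ge> norm (1 - cnj z) / 2"
    using False assms by (intro norm_one_minus_ge(1)) auto
  moreover have "norm (1 - cnj z) = norm (1 - z)"
    by (metis complex_cnj_diff complex_cnj_one complex_mod_cnj)
  ultimately have "norm (1 - z * complex_of_real t) \<ge> t * (norm (1 - z) / 2)"
    using False by simp
  moreover have "norm (1 - z) / 4 * (1 + t) \<le> norm (1 - z) / 4 * (2 * t)"
    using False by (intro mult_left_mono) auto
  moreover have "norm (1 - z) / 4 * (2 * t) = t * (norm (1 - z) / 2)" by simp
  ultimately show ?thesis by linarith
qed

lemma one_minus_mult_of_real_nonzero:
  assumes "norm z = 1" "z \<noteq> 1" "t \<ge> 0"
  shows "1 - z * complex_of_real t \<noteq> 0"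
proof -
  have "norm (1 - z) / 4 * (1 + t) > 0" using assms by (intro mult_pos_pos) auto
  with norm_one_minus_ge_linear[OF assms(1,3)] show ?thesis by auto
qed

text \<open>Interpolates between the bounds 1 and \<open>1 / t\<close>. A power of
  \<open>t = x ^ n * y\<close> splits into a factor in \<open>x\<close> and a factor in
  \<open>y\<close>, as a product majorant requires.\<close>

lemma inverse_one_plus_le_powr:
  assumes "t > 0" "0 < c" "c < (1::real)"
  shows "1 / (1 + t) \<le> t powr (c - 1)"
proof -
  have "t powr (1 - c) \<le> 1 + t"
  proof (cases "t \<le> 1")
    case True
    then have "t powr (1 - c) \<le> 1" using assms powr_mono2[of "1 - c" t 1] by simp
    then show ?thesis using assms by linarith
  next
    case False
    then have "t powr (1 - c) \<le> t powr 1" using assms by (intro powr_mono) auto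
    then show ?thesis using False by simp
  qed
  then have "t powr (c - 1) * t powr (1 - c) \<le> t powr (c - 1) * (1 + t)"
    by (intro mult_left_mono) auto
  then show ?thesis using assms by (simp add: divide_le_eq flip: powr_add)
qed

text \<open>Fubini for the complex integrand; \<open>re_polylog\<close> enters as the real part of
  the inner integral over \<open>y\<close>, so the real part can be moved outside both
  integrals.\<close>

lemma log_kernel_re_polylog_integral:
  fixes a :: real
  assumes a: "a \<in> {1, -1}" "a = 1 \<Longrightarrow> q \<noteq> 1" and p: "p \<ge> 1" and q: "q \<ge> 1" and n: "n \<ge> 1"
    and z: "norm z = 1" "z \<noteq> 1"
  defines "J \<equiv> \<lambda>y. integral {0<..} (\<lambda>x. complex_of_real (log_kernel q a x) * (z * of_real (x ^ n) / (1 - z * of_real (x ^ n * y))))"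
  shows "(\<lambda>x. log_kernel q a x * re_polylog p (z * of_real (x ^ n))) integrable_on {0<..}"
    and "integral {0<..} (\<lambda>x. log_kernel q a x * re_polylog p (z * of_real (x ^ n)))
       = Re (integral {0<..<1} (\<lambda>y. complex_of_real ((- ln y) ^ (p - 1) / fact (p - 1)) * J y))"
proof -
  let ?g = "log_kernel q a"
  let ?u = "\<lambda>y::real. (- ln y) ^ (p - 1) / fact (p - 1)"
  obtain C where C: "(\<lambda>x. ?g x * x powr (1/2)) absolutely_integrable_on {0<..}"
    using log_kernel_bound[OF a(1) q a(2)] by blast
  define c where "c = 1 / (2 * real n)"
  have c: "0 < c" "c < 1" "real n * c = 1 / 2" using n by (auto simp: c_def)
  define f where "f = (\<lambda>x y. complex_of_real (?g x) * (complex_of_real (?u y) * (z * of_real (x ^ n) / (1 - z * of_real (x ^ n * y)))))"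
  define h1 where "h1 = (\<lambda>x. \<bar>?g x\<bar> * x powr (1/2))"
  define h2 where "h2 = (\<lambda>y. 4 / norm (1 - z) / fact (p - 1) * ((- ln y) ^ (p - 1) * y powr (c - 1)))"
  have [measurable]: "case_prod f \<in> borel_measurable (borel \<Otimes>\<^sub>M borel)"
    unfolding f_def by measurable
  have [measurable]: "h1 \<in> borel_measurable borel" "h2 \<in> borel_measurable borel"
    unfolding h1_def h2_def by measurable
  have h1: "h1 absolutely_integrable_on {0<..}"
  proof -
    have "(\<lambda>x. norm (?g x * x powr (1/2))) absolutely_integrable_on {0<..}"
      using C by (rule set_integrable_norm)
    then show ?thesis by (simp add: h1_def abs_mult)
  qed
  have h2: "h2 absolutely_integrable_on {0<..<1}"
    unfolding h2_def using integrable_neg_ln_powr[OF c(1), of "p - 1"]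
    by (intro set_integrable_mult_right) auto
  have bound: "norm (f x y) \<le> h1 x * h2 y" if x: "x \<in> {0<..}" and y: "y \<in> {0<..<1}" for x y
  proof -
    let ?t = "x ^ n * y"
    have t: "?t > 0" using x y by simp
    have pos: "norm (1 - z) / 4 * (1 + ?t) > 0" using z t by (intro mult_pos_pos) auto
    have "norm (f x y) = \<bar>?g x\<bar> * (?u y * (x ^ n / norm (1 - z * of_real ?t)))"
      using x y z unfolding f_def norm_mult norm_divide norm_of_real by (simp add: abs_mult power_abs)
    also have "\<dots> \<le> \<bar>?g x\<bar> * (?u y * (x ^ n / (norm (1 - z) / 4 * (1 + ?t))))"
    proof (intro mult_left_mono divide_left_mono)
      show le: "norm (1 - z) / 4 * (1 + ?t) \<le> norm (1 - z * of_real ?t)"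
        using t by (intro norm_one_minus_ge_linear z) auto
      show "0 < norm (1 - z * of_real ?t) * (norm (1 - z) / 4 * (1 + ?t))"
        by (rule mult_pos_pos[OF less_le_trans[OF pos le] pos])
    qed (use x y in auto)
    also have "\<dots> = \<bar>?g x\<bar> * (?u y * (x ^ n * (4 / norm (1 - z) * (1 / (1 + ?t)))))"
      by simp
    also have "\<dots> \<le> \<bar>?g x\<bar> * (?u y * (x ^ n * (4 / norm (1 - z) * ?t powr (c - 1))))"
      using x y t c by (intro mult_left_mono inverse_one_plus_le_powr) auto
    also have "?t powr (c - 1) = (x ^ n) powr (c - 1) * y powr (c - 1)"
      using x y by (simp add: powr_mult)
    also have "\<bar>?g x\<bar> * (?u y * (x ^ n * (4 / norm (1 - z) * ((x ^ n) powr (c - 1) * y powr (c - 1)))))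
      = \<bar>?g x\<bar> * (x ^ n * (x ^ n) powr (c - 1)) * h2 y"
      by (simp add: h2_def mult_ac)
    also have "x ^ n * (x ^ n) powr (c - 1) = x powr (1/2)"
    proof -
      have "x ^ n * (x ^ n) powr (c - 1) = (x ^ n) powr c"
        using x by (simp add: powr_diff)
      also have "\<dots> = x powr (real n * c)" using x by (simp add: powr_powr flip: powr_realpow)
      finally show ?thesis unfolding c(3) .
    qed
    finally show ?thesis by (simp add: h1_def)
  qed
  note fub = fubini_product_bound[of f h1 h2 "{0<..}" "{0<..<1}", OF _ _ _ _ _ h1 h2 bound]
  have F1: "(\<lambda>x. integral {0<..<1} (f x)) absolutely_integrable_on {0<..}"
    by (rule fub(1)) auto
  have F2: "integral {0<..} (\<lambda>x. integral {0<..<1} (f x)) = integral {0<..<1} (\<lambda>y. integral {0<..} (\<lambda>x. f x y))"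
    by (rule fub(3)) auto
  have inner: "Re (integral {0<..<1} (f x)) = ?g x * re_polylog p (z * of_real (x ^ n))" if x: "x \<in> {0<..}" for x
  proof -
    let ?w = "z * complex_of_real (x ^ n)"
    have nz: "1 - ?w * of_real y \<noteq> 0" if "y \<in> {0..1}" for y
      using one_minus_mult_of_real_nonzero[OF z, of "x ^ n * y"] that x by (simp add: mult.assoc)
    have R: "((\<lambda>y. ?u y * Re (?w / (1 - ?w * of_real y))) has_integral re_polylog p ?w) {0<..<1}"
      using x by (intro has_integral_re_polylog p z(1) nz) auto
    have "f x absolutely_integrable_on {0<..<1}"
    proof (rule absolutely_integrable_on_bound)
      show "f x \<in> borel_measurable borel" by measurable
      show "(\<lambda>y. h1 x * h2 y) integrable_on {0<..<1}"
        using h2 by (intro integrable_on_mult_right) (rule set_lebesgue_integral_eq_integral)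
    qed (use bound[OF x] in auto)
    then have "(f x has_integral integral {0<..<1} (f x)) {0<..<1}"
      by (intro integrable_integral) (rule set_lebesgue_integral_eq_integral)
    from has_integral_Re[OF this]
    have fi: "((\<lambda>y. Re (f x y)) has_integral Re (integral {0<..<1} (f x))) {0<..<1}" .
    have Re_mult: "Re (complex_of_real r * v) = r * Re v" for r v by simp
    have "Re (f x y) = ?g x * (?u y * Re (?w / (1 - ?w * of_real y)))" for y
      by (simp only: f_def Re_mult of_real_mult mult.assoc)
    with fi have "((\<lambda>y. ?g x * (?u y * Re (?w / (1 - ?w * of_real y)))) has_integral Re (integral {0<..<1} (f x))) {0<..<1}"
      by simp
    from has_integral_unique[OF this has_integral_mult_right[OF R, of "?g x"]] show ?thesis .
  qed
  have G: "((\<lambda>x. Re (integral {0<..<1} (f x))) has_integral Re (integral {0<..} (\<lambda>x. integral {0<..<1} (f x)))) {0<..}"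
    using F1 by (intro has_integral_Re integrable_integral) (rule set_lebesgue_integral_eq_integral)
  have G': "((\<lambda>x. ?g x * re_polylog p (z * of_real (x ^ n))) has_integral
      Re (integral {0<..} (\<lambda>x. integral {0<..<1} (f x)))) {0<..}"
    by (rule has_integral_eq[OF inner G])
  then show "(\<lambda>x. ?g x * re_polylog p (z * of_real (x ^ n))) integrable_on {0<..}"
    by (auto simp: integrable_on_def)
  have "integral {0<..} (\<lambda>x. f x y) = complex_of_real (?u y) * J y" for y
    unfolding J_def f_def by (simp add: mult.left_commute flip: integral_mult_right)
  with integral_unique[OF G'] F2
  show "integral {0<..} (\<lambda>x. ?g x * re_polylog p (z * of_real (x ^ n)))
       = Re (integral {0<..<1} (\<lambda>y. complex_of_real (?u y) * J y))" by simp
qed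

text \<open>The indicator removes the divergence at 0 and later cancels against the one behind
  \<open>mellin_resolvent_0\<close>. The parts below and above 1 give the same Lerch value with
  signs \<open>(-1) ^ (q - 1)\<close> and -1, hence the factor \<open>1 + (-1) ^ q\<close>.\<close>

lemma log_kernel_regularized_integral:
  fixes a :: real
  assumes a: "a \<in> {1, -1}" "a = 1 \<Longrightarrow> q \<noteq> 1" and q: "q \<ge> 1"
  defines "T \<equiv> \<lambda>x. ln x ^ (q - 1) * (1 / (1 - a * x) - (if x < 1 then 1 else 0)) / x"
  shows "(T has_integral - (a * (1 + (-1) ^ q) * fact (q - 1) * lerch a q 1)) {0<..}"
proof -
  obtain m where m: "q = Suc m" using q by (cases q) auto
  define F where "F = (\<lambda>x. ln x ^ m * (1 / (1 - a * x) - (if x < 1 then 1 else 0)))"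
  let ?L = "\<lambda>v. (- ln v) ^ m * v powr (1 - 1) / (1 - a * v)"
  have am: "a = 1 \<Longrightarrow> m \<noteq> 0" using a m by auto
  have nz: "1 - a * v > 0" if "v \<in> {0<..<1}" for v using that a by auto
  have Li: "?L absolutely_integrable_on {0<..<1}"
  proof (rule nonnegative_absolutely_integrable_1)
    show "?L integrable_on {0<..<1}"
      using integral_eq_lerch[OF a(1), of 1 m] am by (auto simp: integrable_on_def)
    show "0 \<le> ?L v" if "v \<in> {0<..<1}" for v
      using that nz[OF that] by (intro divide_nonneg_pos mult_nonneg_nonneg zero_le_power) auto
  qed
  have LI: "integral {0<..<1} ?L = fact m * lerch a q 1"
    unfolding m using integral_eq_lerch[OF a(1), of 1 m] am by (intro integral_unique) auto
  have ln: "ln v ^ m = (-1) ^ m * (- ln v) ^ m" for v :: real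
    by (simp flip: power_mult_distrib)
  have 1: "F v / of_real v = (a * (-1) ^ m) * ?L v" if v: "v \<in> {0<..<1}" for v
  proof -
    have "1 / (1 - a * v) - (if v < 1 then 1 else 0) = a * v / (1 - a * v)"
      using nz[OF v] v by (simp add: field_simps)
    then show ?thesis unfolding F_def using v by (simp add: ln[of v])
  qed
  have 2: "F (1 / v) / of_real v = - a * ?L v" if v: "v \<in> {0<..<1}" for v
  proof -
    have "1 / (1 - a * (1 / v)) = - a * v / (1 - a * v)"
      using nz[OF v] v a by (auto simp: field_simps)
    then have "F (1 / v) = (- ln v) ^ m * (- a * v / (1 - a * v))"
      using v by (simp add: F_def ln_div)
    then show ?thesis using v by simp
  qed
  have i1: "(\<lambda>v. (a * (-1) ^ m) * ?L v) absolutely_integrable_on {0<..<1}"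
    using Li by (intro set_integrable_mult_right) auto
  have i2: "(\<lambda>v. - a * ?L v) absolutely_integrable_on {0<..<1}"
    using Li by (intro set_integrable_mult_right) auto
  have I: "(\<lambda>v. F v / of_real v) absolutely_integrable_on {0<..<1}"
      "(\<lambda>v. F (1 / v) / of_real v) absolutely_integrable_on {0<..<1}"
    by (rule iffD2[OF set_integrable_cong[OF refl refl 1] i1], assumption)
      (rule iffD2[OF set_integrable_cong[OF refl refl 2] i2], assumption)
  have "(\<lambda>v. F v / of_real v) integrable_on {0<..}"
    using integral_Ioi_by_inversion(1)[OF I] by (rule set_lebesgue_integral_eq_integral)
  moreover have "integral {0<..} (\<lambda>v. F v / of_real v)
      = integral {0<..<1} (\<lambda>v. F v / of_real v) + integral {0<..<1} (\<lambda>v. F (1 / v) / of_real v)"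
    by (rule integral_Ioi_by_inversion(2)[OF I])
  moreover have "integral {0<..<1} (\<lambda>v. F v / of_real v) = (a * (-1) ^ m) * (fact m * lerch a q 1)"
    unfolding LI[symmetric] integral_mult_right[symmetric] by (intro integral_cong 1)
  moreover have "integral {0<..<1} (\<lambda>v. F (1 / v) / of_real v) = - a * (fact m * lerch a q 1)"
    unfolding LI[symmetric] integral_mult_right[symmetric] by (intro integral_cong 2)
  ultimately have "((\<lambda>v. F v / of_real v) has_integral
      (a * (-1) ^ m) * (fact m * lerch a q 1) + - a * (fact m * lerch a q 1)) {0<..}"
    by (simp add: has_integral_iff)
  also have "(\<lambda>v. F v / of_real v) = T"
    by (simp add: T_def F_def m)
  also have "(a * (-1) ^ m) * (fact m * lerch a q 1) + - a * (fact m * lerch a q 1)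
      = - (a * (1 + (-1) ^ q) * fact (q - 1) * lerch a q 1)"
    by (simp add: m algebra_simps)
  finally show ?thesis .
qed

text \<open>Measures the mismatch between the indicators of \<open>v < y\<close> and
  \<open>v < 1\<close> in \<open>integral_scaled_resolvent_0\<close>; it ends up as the summand
  \<open>j = 0\<close> of the theorem.\<close>

lemma has_integral_power_ln_diff:
  fixes y :: real
  assumes y: "0 < y" "y < 1"
  shows "((\<lambda>v. if v \<in> {y..<1} then (ln v - ln y) ^ m / v else 0) has_integral (- ln y) ^ Suc m / real (Suc m)) {0<..}"
proof -
  have "((\<lambda>v. (ln v - ln y) ^ m / v) has_integral
      (ln 1 - ln y) ^ Suc m / real (Suc m) - (ln y - ln y) ^ Suc m / real (Suc m)) {y..1}"
  proof (rule fundamental_theorem_of_calculus)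
    fix x assume x: "x \<in> {y..1}"
    then have "x > 0" using y by auto
    have "((\<lambda>v. ln v - ln y) has_real_derivative 1 / x) (at x)"
      using \<open>x > 0\<close> by (auto intro!: derivative_eq_intros)
    from DERIV_cdivide[OF DERIV_power[OF this, of "Suc m"], of "real (Suc m)"]
    have "((\<lambda>v. (ln v - ln y) ^ Suc m / real (Suc m)) has_real_derivative (ln x - ln y) ^ m / x) (at x)"
      by (rule DERIV_cong) (simp del: of_nat_Suc)
    then show "((\<lambda>v. (ln v - ln y) ^ Suc m / real (Suc m)) has_vector_derivative (ln x - ln y) ^ m / x) (at x within {y..1})"
      by (simp add: has_real_derivative_iff_has_vector_derivative has_vector_derivative_at_within)
  qed (use y in auto)
  then have *: "((\<lambda>v. (ln v - ln y) ^ m / v) has_integral (- ln y) ^ Suc m / real (Suc m)) {y..1}"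
    by simp
  have **: "((\<lambda>v. (ln v - ln y) ^ m / v) has_integral (- ln y) ^ Suc m / real (Suc m)) {y..<1}"
    by (rule iffD1[OF has_integral_spike_set_eq *]) (rule negligible_subset[of "{1}"], auto)+
  have "{y..<1} \<subseteq> {0<..}" using y by auto
  then show ?thesis by (rule iffD2[OF has_integral_restrict **])
qed

lemma power_ln_diff_expand:
  fixes v y :: real
  shows "(ln v - ln y) ^ m = (\<Sum>k\<le>m. real (m choose k) * (- ln y) ^ (m - k) * ln v ^ k)"
  using binomial_ring[of "ln v" "- ln y" m] by (simp add: mult_ac)

text \<open>Under \<open>v = y * x ^ n\<close>, \<open>ln x\<close> becomes
  \<open>(ln v - ln y) / n\<close>, expanded by the binomial theorem, and \<open>x < 1\<close>
  becomes \<open>v < y\<close>. The \<open>m\<close> logarithms and \<open>dx / x\<close> each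
  contribute \<open>1 / n\<close>, hence the exponent \<open>Suc m\<close>.\<close>

lemma integral_scaled_resolvent_0:
  assumes z: "norm z = 1" "z \<noteq> 1" and y: "0 < y" "y < 1" and n: "n \<ge> 1"
  shows "((\<lambda>x. complex_of_real (ln x ^ m) * ((if x < 1 then 1 else 0) - 1 / (1 - z * of_real (y * x ^ n))) / of_real x)
    has_integral ((\<Sum>k\<le>m. of_real (real (m choose k) * (- ln y) ^ (m - k)) * mellin_resolvent_0 k z)
       - of_real ((- ln y) ^ Suc m / real (Suc m))) / of_nat n ^ Suc m) {0<..}"
proof -
  define w where "w = (\<lambda>k v. complex_of_real (ln v ^ k) * ((if v < 1 then 1 else 0) - 1 / (1 - z * complex_of_real v)) / of_real v)"
  define r where "r = (\<lambda>v. if v \<in> {y..<1} then (ln v - ln y) ^ m / v else 0)"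
  define co where "co = (\<lambda>k. complex_of_real (real (m choose k) * (- ln y) ^ (m - k)))"
  define K where "K = complex_of_real (1 / real n ^ m)"
  define F where "F = (\<lambda>v. complex_of_real (((ln v - ln y) / real n) ^ m)
      * ((if v < y then 1 else 0) - 1 / (1 - z * complex_of_real v)))"
  define G where "G = (\<lambda>v. K * ((\<Sum>k\<le>m. co k * w k v) - complex_of_real (r v)))"
  define I where "I = K * ((\<Sum>k\<le>m. co k * mellin_resolvent_0 k z) - complex_of_real ((- ln y) ^ Suc m / real (Suc m)))"
  have w: "w k absolutely_integrable_on {0<..}" "integral {0<..} (w k) = mellin_resolvent_0 k z" for k
    unfolding w_def using integral_mellin_resolvent_0[OF z, of k] by auto
  then have w': "(w k has_integral mellin_resolvent_0 k z) {0<..}" for k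
    by (metis integrable_integral set_lebesgue_integral_eq_integral(1))
  have r: "(r has_integral (- ln y) ^ Suc m / real (Suc m)) {0<..}"
    unfolding r_def by (rule has_integral_power_ln_diff[OF y])
  have r0: "r v \<ge> 0" for v using y by (auto simp: r_def)
  have "r absolutely_integrable_on {0<..}"
    using r r0 by (intro nonnegative_absolutely_integrable_1) (auto simp: integrable_on_def)
  from absolutely_integrable_linear[OF this bounded_linear_of_real[where 'a = complex]]
  have ra: "(\<lambda>v. complex_of_real (r v)) absolutely_integrable_on {0<..}" by (simp add: o_def)
  have G: "G absolutely_integrable_on {0<..}"
    unfolding G_def
    by (rule set_integrable_mult_right, rule set_integral_diff(1)[OF _ ra],
        rule absolutely_integrable_sum, simp, rule set_integrable_mult_right, rule w(1))
  have GI: "(G has_integral I) {0<..}"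
    unfolding G_def I_def using has_integral_linear[OF r bounded_linear_of_real[where 'a = complex]]
    by (intro has_integral_mult_right has_integral_diff has_integral_sum w') (simp_all add: o_def)
  have FG: "F v / of_real v = G v" if v: "v \<in> {0<..}" for v
  proof -
    let ?d = "1 / (1 - z * complex_of_real v)"
    have sum: "(\<Sum>k\<le>m. co k * w k v)
        = complex_of_real ((ln v - ln y) ^ m) * ((if v < 1 then 1 else 0) - ?d) / of_real v"
      unfolding power_ln_diff_expand of_real_sum sum_distrib_right sum_divide_distrib co_def w_def
      by (intro sum.cong refl) simp
    have r_eq: "complex_of_real (r v)
        = complex_of_real ((ln v - ln y) ^ m) * (if v \<in> {y..<1} then 1 else 0) / of_real v"
      by (simp add: r_def)
    have "complex_of_real (((ln v - ln y) / real n) ^ m) = K * complex_of_real ((ln v - ln y) ^ m)"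
      by (simp add: K_def power_divide)
    then have "F v / of_real v = K * (complex_of_real ((ln v - ln y) ^ m) * ((if v < y then 1 else 0) - ?d) / of_real v)"
      by (simp add: F_def)
    also have "(if v < y then 1 else 0) - ?d = ((if v < 1 then 1 else 0) - ?d) - (if v \<in> {y..<1} then 1 else 0)"
      using y by auto
    finally show ?thesis unfolding G_def sum r_eq by (simp only: right_diff_distrib diff_divide_distrib)
  qed
  have F: "(\<lambda>v. F v / of_real v) absolutely_integrable_on {0<..}"
    by (rule iffD2[OF set_integrable_cong[OF refl refl FG] G])
  have FI: "integral {0<..} (\<lambda>v. F v / of_real v) = I"
    using integral_unique[OF has_integral_eq[OF FG[symmetric] GI]] .
  have nz: "real n \<noteq> 0" using n by simp
  note sub = mellin_substitution_Ioi[OF y(1) nz F]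
  have eq: "F (y * x powr real n) / of_real x
      = complex_of_real (ln x ^ m) * ((if x < 1 then 1 else 0) - 1 / (1 - z * of_real (y * x ^ n))) / of_real x"
    if x: "x \<in> {0<..}" for x
  proof -
    have "x powr real n = x ^ n" using x by (simp add: powr_realpow)
    moreover have "(ln (y * x ^ n) - ln y) / real n = ln x"
      using x y n by (simp add: ln_mult ln_realpow)
    moreover have "y * x ^ n < y \<longleftrightarrow> x < 1"
      using x y n power_less_one_iff[of x n] by (simp add: mult_less_cancel_left2)
    ultimately show ?thesis by (simp only: F_def)
  qed
  have "((\<lambda>x. F (y * x powr real n) / of_real x) has_integral I / of_nat n) {0<..}"
    using sub unfolding FI by (simp add: has_integral_iff set_lebesgue_integral_eq_integral(1))
  from has_integral_eq[OF eq this] show ?thesis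
    by (simp add: I_def K_def co_def mult_ac)
qed

text \<open>The same substitution, where \<open>x ^ j\<close> becomes
  \<open>(v / y) powr (j / n)\<close>. No regularization is called for: \<open>1 \<le> j\<close>
  gives convergence at 0, and \<open>j < n\<close> at infinity.\<close>

lemma integral_scaled_resolvent:
  assumes z: "norm z = 1" "z \<noteq> 1" and y: "0 < y" "y < 1" and j: "1 \<le> j" "j < n"
  shows "((\<lambda>x. complex_of_real (ln x ^ m * x ^ j) / (1 - z * of_real (y * x ^ n)) / of_real x)
    has_integral (of_real (y powr (- (real j / real n)))
       * (\<Sum>k\<le>m. of_real (real (m choose k) * (- ln y) ^ (m - k)) * mellin_resolvent k (real j / real n) z)) / of_nat n ^ Suc m) {0<..}"
proof -
  define s where "s = real j / real n"
  have s: "0 < s" "s < 1" using j by (auto simp: s_def)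
  define w where "w = (\<lambda>k v. complex_of_real (ln v ^ k * v powr s) / (1 - z * complex_of_real v) / of_real v)"
  define co where "co = (\<lambda>k. complex_of_real (real (m choose k) * (- ln y) ^ (m - k)))"
  define K where "K = complex_of_real (y powr (- s) / real n ^ m)"
  define F where "F = (\<lambda>v. complex_of_real (((ln v - ln y) / real n) ^ m * (v powr s * y powr (- s)))
      / (1 - z * complex_of_real v))"
  define G where "G = (\<lambda>v. K * (\<Sum>k\<le>m. co k * w k v))"
  define I where "I = K * (\<Sum>k\<le>m. co k * mellin_resolvent k s z)"
  have w: "w k absolutely_integrable_on {0<..}" "integral {0<..} (w k) = mellin_resolvent k s z" for k
    unfolding w_def using integral_mellin_resolvent[OF z s, of k] by auto
  then have w': "(w k has_integral mellin_resolvent k s z) {0<..}" for k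
    by (metis integrable_integral set_lebesgue_integral_eq_integral(1))
  have G: "G absolutely_integrable_on {0<..}"
    unfolding G_def
    by (rule set_integrable_mult_right, rule absolutely_integrable_sum, simp, rule set_integrable_mult_right, rule w(1))
  have GI: "(G has_integral I) {0<..}"
    unfolding G_def I_def by (intro has_integral_mult_right has_integral_sum w') simp_all
  have FG: "F v / of_real v = G v" if v: "v \<in> {0<..}" for v
  proof -
    have sum: "(\<Sum>k\<le>m. co k * w k v)
        = complex_of_real ((ln v - ln y) ^ m) * of_real (v powr s) / (1 - z * complex_of_real v) / of_real v"
      unfolding power_ln_diff_expand of_real_sum sum_distrib_right sum_divide_distrib co_def w_def
      by (intro sum.cong refl) simp
    show ?thesis unfolding G_def sum F_def K_def by (simp add: power_divide mult_ac)
  qed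
  have F: "(\<lambda>v. F v / of_real v) absolutely_integrable_on {0<..}"
    by (rule iffD2[OF set_integrable_cong[OF refl refl FG] G])
  have FI: "integral {0<..} (\<lambda>v. F v / of_real v) = I"
    using integral_unique[OF has_integral_eq[OF FG[symmetric] GI]] .
  have nz: "real n \<noteq> 0" using j by simp
  note sub = mellin_substitution_Ioi[OF y(1) nz F]
  have eq: "F (y * x powr real n) / of_real x
      = complex_of_real (ln x ^ m * x ^ j) / (1 - z * of_real (y * x ^ n)) / of_real x"
    if x: "x \<in> {0<..}" for x
  proof -
    have "(y * x powr real n) powr s * y powr (- s) = (x powr real n) powr s * (y powr s * y powr (- s))"
      using x y by (simp add: powr_mult)
    also have "y powr s * y powr (- s) = 1" using y by (simp flip: powr_add)
    also have "(x powr real n) powr s = x powr real j" using j by (simp add: powr_powr s_def)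
    finally have "(y * x powr real n) powr s * y powr (- s) = x ^ j"
      using x by (simp add: powr_realpow)
    moreover have "x powr real n = x ^ n" using x by (simp add: powr_realpow)
    moreover have "(ln (y * x ^ n) - ln y) / real n = ln x"
      using x y j by (simp add: ln_mult ln_realpow)
    ultimately show ?thesis by (simp only: F_def)
  qed
  have "((\<lambda>x. F (y * x powr real n) / of_real x) has_integral I / of_nat n) {0<..}"
    using sub unfolding FI by (simp add: has_integral_iff set_lebesgue_integral_eq_integral(1))
  from has_integral_eq[OF eq this] show ?thesis
    by (simp add: I_def K_def co_def s_def mult_ac)
qed

text \<open>Partial fractions in \<open>x ^ n\<close>: the geometric sum \<open>\<Sum>j<n. a ^ j * x ^ j\<close> turns \<open>1 - a x\<close> into
  \<open>1 - a ^ n x ^ n\<close>. The term \<open>j = 0\<close> alone diverges at \<open>0\<close>, so it is regularized by \<open>1 [x < 1]\<close>.\<close>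

lemma log_kernel_stieltjes_integral:
  fixes a :: real and z :: complex
  assumes a: "a \<in> {1, -1}" "a = 1 \<Longrightarrow> m \<noteq> 0" and n: "n \<ge> 1"
    and z: "norm z = 1" "z \<noteq> 1" and y: "0 < y" "y < 1"
  defines "\<zeta> \<equiv> of_real (a ^ n) * z"
  shows "integral {0<..} (\<lambda>x. complex_of_real (log_kernel (Suc m) a x) * (z * of_real (x ^ n) / (1 - z * of_real (x ^ n * y))))
    = \<zeta> / (1 - \<zeta> * of_real y) *
       (of_real (- (a * (1 + (-1) ^ Suc m) * fact m * lerch a (Suc m) 1))
        + ((\<Sum>k\<le>m. of_real (real (m choose k) * (- ln y) ^ (m - k)) * mellin_resolvent_0 k z)
             - of_real ((- ln y) ^ Suc m / real (Suc m))) / of_nat n ^ Suc m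
        - (\<Sum>j = 1..<n. of_real (a ^ j) * ((of_real (y powr (- (real j / real n)))
            * (\<Sum>k\<le>m. of_real (real (m choose k) * (- ln y) ^ (m - k)) * mellin_resolvent k (real j / real n) z)) / of_nat n ^ Suc m)))"
    (is "_ = ?k * (?A + ?B - (\<Sum>j = 1..<n. ?C j))")
proof (rule integral_unique)
  define \<alpha> where "\<alpha> = a ^ n"
  have al: "\<alpha> * \<alpha> = 1"
  proof -
    have "\<alpha> * \<alpha> = (a * a) ^ n" by (simp add: \<alpha>_def power_mult_distrib)
    also have "a * a = 1" using a by auto
    finally show ?thesis by simp
  qed
  have norm\<zeta>: "norm \<zeta> = 1" using z a by (auto simp: \<zeta>_def norm_mult norm_power)
  have kd: "1 - \<zeta> * complex_of_real y \<noteq> 0"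
    using norm_one_minus_ge(2)[OF norm\<zeta>, of y] y by auto
  let ?T1 = "\<lambda>x. complex_of_real (ln x ^ m * (1 / (1 - a * x) - (if x < 1 then 1 else 0)) / x)"
  let ?T2 = "\<lambda>x. complex_of_real (ln x ^ m) * ((if x < 1 then 1 else 0) - 1 / (1 - z * of_real (y * x ^ n))) / of_real x"
  let ?T3 = "\<lambda>j x. complex_of_real (ln x ^ m * x ^ j) / (1 - z * of_real (y * x ^ n)) / of_real x"
  have T1: "(?T1 has_integral ?A) {0<..}"
    using has_integral_linear[OF log_kernel_regularized_integral[of a "Suc m"] bounded_linear_of_real[where 'a = complex]] a
    by (simp add: o_def)
  have T: "((\<lambda>x. ?k * (?T1 x + ?T2 x - (\<Sum>j = 1..<n. of_real (a ^ j) * ?T3 j x)))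
      has_integral ?k * (?A + ?B - (\<Sum>j = 1..<n. ?C j))) {0<..}"
    by (intro has_integral_mult_right has_integral_diff has_integral_add has_integral_sum T1
        integral_scaled_resolvent_0[OF z y n] integral_scaled_resolvent[OF z y]) auto
  show "((\<lambda>x. complex_of_real (log_kernel (Suc m) a x) * (z * of_real (x ^ n) / (1 - z * of_real (x ^ n * y))))
      has_integral ?k * (?A + ?B - (\<Sum>j = 1..<n. ?C j))) {0<..}"
  \<comment> \<open>For \<open>a = 1\<close> the denominator \<open>1 - a * x\<close> vanishes at 1,
    so the identity of the integrands is checked away from that point.\<close>
  proof (rule has_integral_spike[OF _ _ T])
    show "negligible {1::real}" by simp
    fix x :: real assume x: "x \<in> {0<..} - {1}"
    let ?L = "complex_of_real (ln x ^ m) / of_real x"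
    let ?u = "1 / (1 - complex_of_real (a * x))"
    let ?v = "1 / (1 - z * complex_of_real (y * x ^ n))"
    let ?X = "complex_of_real (x ^ n)"
    have ax: "1 - a * x \<noteq> 0" using x a by auto
    then have ax': "1 - complex_of_real (a * x) \<noteq> 0"
      by (metis of_real_1 of_real_diff of_real_eq_0_iff)
    have vx: "1 - z * complex_of_real (y * x ^ n) \<noteq> 0"
      using one_minus_mult_of_real_nonzero[OF z, of "y * x ^ n"] x y by simp
    have T1x: "?T1 x = ?L * (?u - (if x < 1 then 1 else 0))" by simp
    have T2x: "?T2 x = ?L * ((if x < 1 then 1 else 0) - ?v)" by simp
    have T3x: "?T3 j x = ?L * (of_real (x ^ j) * ?v)" for j by simp
    have geo: "1 + (\<Sum>j = 1..<n. complex_of_real (a ^ j) * of_real (x ^ j)) = (1 - of_real \<alpha> * ?X) * ?u"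
    proof -
      have "(\<Sum>j<n. (a * x) ^ j) = (1 - (a * x) ^ n) / (1 - a * x)"
        using ax by (simp add: sum_gp_strict)
      moreover have "{..<n} = insert 0 {1..<n}" using n by auto
      ultimately have "1 + (\<Sum>j = 1..<n. (a * x) ^ j) = (1 - (a * x) ^ n) / (1 - a * x)"
        by simp
      then have "complex_of_real (1 + (\<Sum>j = 1..<n. (a * x) ^ j)) = complex_of_real ((1 - (a * x) ^ n) / (1 - a * x))"
        by (simp only:)
      then show ?thesis by (simp add: \<alpha>_def power_mult_distrib)
    qed
    have "?k * (?T1 x + ?T2 x - (\<Sum>j = 1..<n. of_real (a ^ j) * ?T3 j x))
        = ?k * (?L * (?u - (1 + (\<Sum>j = 1..<n. complex_of_real (a ^ j) * of_real (x ^ j))) * ?v))"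
    proof -
      have "L * (u - c) + L * (c - v) - (\<Sum>j = 1..<n. b j * (L * (d j * v))) = L * (u - (1 + (\<Sum>j = 1..<n. b j * d j)) * v)"
        for L u c v :: complex and b d :: "nat \<Rightarrow> complex"
      proof -
        have "(\<Sum>j = 1..<n. b j * (L * (d j * v))) = L * v * (\<Sum>j = 1..<n. b j * d j)"
          by (simp add: sum_distrib_left mult_ac)
        then show ?thesis by (simp add: algebra_simps)
      qed
      then show ?thesis unfolding T1x T2x T3x by (rule arg_cong)
    qed
    also have "\<dots> = ?L * ?u * (?k * (1 - (1 - of_real \<alpha> * ?X) * ?v))"
    proof -
      have "k * (L * (u - c * u * v)) = L * u * (k * (1 - c * v))" for k L u c v :: complex
        by (simp add: algebra_simps)
      then show ?thesis unfolding geo .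
    qed
    \<comment> \<open>The bracket equals \<open>(\<alpha> - z * y) * X * v\<close>. By
      \<open>\<alpha> * \<alpha> = 1\<close>,
      \<open>\<zeta> * (\<alpha> - z * y) = z * (1 - \<zeta> * y)\<close>, so the denominator of the
      prefactor cancels.\<close>
    also have "?k * (1 - (1 - of_real \<alpha> * ?X) * ?v) = z * ?X * ?v"
    proof -
      have 1: "1 - (1 - of_real \<alpha> * ?X) * ?v = (of_real \<alpha> - z * of_real y) * ?X * ?v"
        using vx by (simp add: field_simps)
      have "\<zeta> * (of_real \<alpha> - z * of_real y) = of_real (\<alpha> * \<alpha>) * z - \<zeta> * z * of_real y"
        by (simp add: \<zeta>_def \<alpha>_def algebra_simps)
      also have "\<dots> = z * (1 - \<zeta> * of_real y)" unfolding al by (simp add: algebra_simps)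
      finally have 2: "?k * (of_real \<alpha> - z * of_real y) = z" using kd by simp
      have "?k * ((of_real \<alpha> - z * of_real y) * ?X * ?v) = (?k * (of_real \<alpha> - z * of_real y)) * ?X * ?v"
        by (simp only: mult.assoc)
      then show ?thesis unfolding 1 2 .
    qed
    also have "?L * ?u * (z * ?X * ?v)
        = complex_of_real (log_kernel (Suc m) a x) * (z * of_real (x ^ n) / (1 - z * of_real (x ^ n * y)))"
      by (simp add: log_kernel_def mult_ac)
    finally show "complex_of_real (log_kernel (Suc m) a x) * (z * of_real (x ^ n) / (1 - z * of_real (x ^ n * y)))
        = ?k * (?T1 x + ?T2 x - (\<Sum>j = 1..<n. of_real (a ^ j) * ?T3 j x))" by simp
  qed
qed

text \<open>The result of integrating \<open>log_kernel_stieltjes_integral\<close> against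
  \<open>(- ln y) ^ (p - 1) / fact (p - 1)\<close>: the powers of \<open>- ln y\<close> and of
  \<open>y\<close> merely shift the parameters of \<open>lerch_int\<close>. Each product pairs a
  Mellin transform at \<open>z\<close> with \<open>\<zeta> * lerch_int\<close>, the form in which
  \<open>tendsto_Re_mult\<close> applies.\<close>

definition approx_value :: "real \<Rightarrow> nat \<Rightarrow> nat \<Rightarrow> nat \<Rightarrow> complex \<Rightarrow> complex \<Rightarrow> complex" where
  "approx_value a n p m z \<zeta> = of_real (1 / fact (p - 1)) *
     (of_real (- (a * (1 + (-1) ^ Suc m) * fact m * lerch a (Suc m) 1)) * (\<zeta> * lerch_int (p - 1) 1 \<zeta>)
      + of_real (1 / real n ^ Suc m) *
          ((\<Sum>k\<le>m. of_real (real (m choose k)) * (mellin_resolvent_0 k z * (\<zeta> * lerch_int (p - 1 + (m - k)) 1 \<zeta>)))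
           - of_real (1 / real (Suc m)) * (\<zeta> * lerch_int (p - 1 + Suc m) 1 \<zeta>))
      - (\<Sum>j = 1..<n. of_real (a ^ j / real n ^ Suc m) *
          (\<Sum>k\<le>m. of_real (real (m choose k)) *
             (mellin_resolvent k (real j / real n) z * (\<zeta> * lerch_int (p - 1 + (m - k)) (1 - real j / real n) \<zeta>)))))"

lemma log_kernel_re_polylog_value:
  fixes a :: real and z :: complex
  assumes a: "a \<in> {1, -1}" "a = 1 \<Longrightarrow> m \<noteq> 0" and p: "p \<ge> 1" and n: "n \<ge> 1"
    and z: "norm z = 1" "z \<noteq> 1" and \<zeta>: "\<zeta> = of_real (a ^ n) * z" "\<zeta> \<noteq> 1"
  shows "((\<lambda>x. log_kernel (Suc m) a x * re_polylog p (z * of_real (x ^ n))) has_integral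
           Re (approx_value a n p m z \<zeta>)) {0<..}"
proof -
  have norm\<zeta>: "norm \<zeta> = 1" using z a by (auto simp: \<zeta>(1) norm_mult norm_power)
  define B where "B = (\<lambda>r t y. complex_of_real ((- ln y) ^ r * y powr (t - 1)) / (1 - \<zeta> * complex_of_real y))"
  have B: "(B r t has_integral lerch_int r t \<zeta>) {0<..<1}" if "t > 0" for r t
    unfolding B_def lerch_int_def
    using lerch_int_integrable[OF norm\<zeta> \<zeta>(2) that, of r]
    by (intro integrable_integral) (rule set_lebesgue_integral_eq_integral)
  define J where "J = (\<lambda>y. integral {0<..} (\<lambda>x. complex_of_real (log_kernel (Suc m) a x) *
      (z * of_real (x ^ n) / (1 - z * of_real (x ^ n * y)))))"
  define A where "A = - (a * (1 + (-1) ^ Suc m) * fact m * lerch a (Suc m) 1)"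
  define G where "G = (\<lambda>y. of_real (1 / fact (p - 1)) *
     (of_real A * (\<zeta> * B (p - 1) 1 y)
      + of_real (1 / real n ^ Suc m) *
          ((\<Sum>k\<le>m. of_real (real (m choose k)) * (mellin_resolvent_0 k z * (\<zeta> * B (p - 1 + (m - k)) 1 y)))
           - of_real (1 / real (Suc m)) * (\<zeta> * B (p - 1 + Suc m) 1 y))
      - (\<Sum>j = 1..<n. of_real (a ^ j / real n ^ Suc m) *
          (\<Sum>k\<le>m. of_real (real (m choose k)) *
             (mellin_resolvent k (real j / real n) z * (\<zeta> * B (p - 1 + (m - k)) (1 - real j / real n) y))))))"
  have G: "(G has_integral approx_value a n p m z \<zeta>) {0<..<1}"
    unfolding G_def approx_value_def A_def
    by (intro has_integral_mult_right has_integral_diff has_integral_add has_integral_sum B) auto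
  have GJ: "G y = complex_of_real ((- ln y) ^ (p - 1) / fact (p - 1)) * J y" if y: "y \<in> {0<..<1}" for y
  proof -
    \<comment> \<open>All of \<open>G y\<close> shares the factor \<open>\<zeta> * P\<close>; what
      remains are powers of \<open>- ln y\<close> and of \<open>y\<close>.\<close>
    define P where "P = complex_of_real ((- ln y) ^ (p - 1)) / (1 - \<zeta> * complex_of_real y)"
    have B1: "B (p - 1 + i) 1 y = P * of_real ((- ln y) ^ i)" for i
      using y by (simp add: B_def P_def power_add)
    have B0: "B (p - 1) 1 y = P" using B1[of 0] by simp
    have Bs: "B (p - 1 + i) (1 - s) y = P * of_real ((- ln y) ^ i) * of_real (y powr (- s))" for i s
      by (simp add: B_def P_def power_add)
    have s1: "(\<Sum>k\<le>m. of_real (real (m choose k)) * (mellin_resolvent_0 k z * (\<zeta> * (P * of_real ((- ln y) ^ (m - k))))))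
        = \<zeta> * P * (\<Sum>k\<le>m. of_real (real (m choose k) * (- ln y) ^ (m - k)) * mellin_resolvent_0 k z)"
      by (simp add: sum_distrib_left mult_ac)
    have s2: "(\<Sum>k\<le>m. of_real (real (m choose k)) * (mellin_resolvent k s z * (\<zeta> * (P * of_real ((- ln y) ^ (m - k)) * of_real (y powr (- s))))))
        = \<zeta> * P * (of_real (y powr (- s)) * (\<Sum>k\<le>m. of_real (real (m choose k) * (- ln y) ^ (m - k)) * mellin_resolvent k s z))" for s
      by (simp add: sum_distrib_left mult_ac)
    have s3: "(\<Sum>j = 1..<n. of_real (a ^ j / real n ^ Suc m) * (\<zeta> * P * Q j))
        = \<zeta> * P * (\<Sum>j = 1..<n. of_real (a ^ j) * (Q j / of_nat n ^ Suc m))" for Q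
      by (simp add: sum_distrib_left divide_inverse mult_ac)
    have J: "J y = \<zeta> / (1 - \<zeta> * of_real y) *
       (of_real A
        + ((\<Sum>k\<le>m. of_real (real (m choose k) * (- ln y) ^ (m - k)) * mellin_resolvent_0 k z)
             - of_real ((- ln y) ^ Suc m / real (Suc m))) / of_nat n ^ Suc m
        - (\<Sum>j = 1..<n. of_real (a ^ j) * ((of_real (y powr (- (real j / real n)))
            * (\<Sum>k\<le>m. of_real (real (m choose k) * (- ln y) ^ (m - k)) * mellin_resolvent k (real j / real n) z)) / of_nat n ^ Suc m)))"
      unfolding J_def A_def \<zeta>(1) using y by (intro log_kernel_stieltjes_integral a n z) auto
    have alg: "of_real (1 / f) * (A' * (\<zeta> * P) + of_real (1 / N) * (\<zeta> * P * S - of_real (1 / M) * (\<zeta> * (P * of_real l))) - \<zeta> * P * T)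
        = of_real (1 / f) * (\<zeta> * P) * (A' + (S - of_real (l / M)) / of_real N - T)" for f N M l :: real and A' S T :: complex
      by (simp add: algebra_simps diff_divide_distrib add_divide_distrib)
    have "G y = of_real (1 / fact (p - 1)) * (\<zeta> * P) * (of_real A
        + ((\<Sum>k\<le>m. of_real (real (m choose k) * (- ln y) ^ (m - k)) * mellin_resolvent_0 k z)
             - of_real ((- ln y) ^ Suc m / real (Suc m))) / of_real (real n ^ Suc m)
        - (\<Sum>j = 1..<n. of_real (a ^ j) * ((of_real (y powr (- (real j / real n)))
            * (\<Sum>k\<le>m. of_real (real (m choose k) * (- ln y) ^ (m - k)) * mellin_resolvent k (real j / real n) z)) / of_nat n ^ Suc m)))"
      unfolding G_def B1 B0 Bs s1 s2 s3 by (rule alg)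
    then show ?thesis unfolding J P_def by simp
  qed
  have "(integral {0<..<1} (\<lambda>y. complex_of_real ((- ln y) ^ (p - 1) / fact (p - 1)) * J y)) = approx_value a n p m z \<zeta>"
    by (rule integral_unique[OF has_integral_eq[OF GJ G]])
  moreover have a': "a = 1 \<Longrightarrow> Suc m \<noteq> 1" "Suc m \<ge> 1" using a(2) by auto
  ultimately show ?thesis
    using log_kernel_re_polylog_integral[OF a(1) a'(1) p a'(2) n z] unfolding J_def
    by (simp add: has_integral_iff)
qed

subsection \<open>Passage to the limit\<close>

text \<open>\<open>Re (Y X) = Re Y * Re X - Im Y * Im X\<close>, where the last product is a bounded
  sequence times a null sequence.\<close>

lemma tendsto_Re_mult:
  assumes X: "X \<longlonglongrightarrow> complex_of_real f" and Y: "(\<lambda>N. Re (Y N)) \<longlonglongrightarrow> y" "Bseq (\<lambda>N. Im (Y N))"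
  shows "(\<lambda>N. Re (Y N * X N)) \<longlonglongrightarrow> y * f"
proof -
  obtain K where K: "\<And>N. norm (Im (Y N)) \<le> K" using Y(2) unfolding Bseq_def by blast
  have X': "(\<lambda>N. Re (X N)) \<longlonglongrightarrow> f" "(\<lambda>N. Im (X N)) \<longlonglongrightarrow> 0"
    using tendsto_Re[OF X] tendsto_Im[OF X] by simp_all
  have "(\<lambda>N. Im (Y N) * Im (X N)) \<longlonglongrightarrow> 0"
  proof (rule Lim_null_comparison)
    show "\<forall>\<^sub>F N in sequentially. norm (Im (Y N) * Im (X N)) \<le> K * \<bar>Im (X N)\<bar>"
      using K by (intro always_eventually allI) (simp add: abs_mult mult_right_mono)
    show "(\<lambda>N. K * \<bar>Im (X N)\<bar>) \<longlonglongrightarrow> 0"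
      using X'(2) by (intro tendsto_mult_right_zero tendsto_rabs_zero)
  qed
  from tendsto_diff[OF tendsto_mult[OF Y(1) X'(1)] this] show ?thesis by simp
qed

text \<open>Origin of the binomial coefficients of the theorem: \<open>m choose k\<close> comes from
  expanding \<open>(ln v - ln y) ^ m\<close>, the factorials above from the two Lerch integrals, and
  \<open>fact r\<close> from the normalization of the polylogarithm.\<close>

lemma choose_fact_quotient:
  assumes "k \<le> m"
  shows "real (m choose k) * fact k * fact (r + (m - k)) / fact r = fact m * real ((r + (m - k)) choose r)"
proof -
  have "real (m choose k) = fact m / (fact k * fact (m - k))"
    using assms by (rule binomial_fact)
  moreover have "real ((r + (m - k)) choose r) = fact (r + (m - k)) / (fact r * fact (r + (m - k) - r))"
    by (rule binomial_fact) simp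
  ultimately show ?thesis by simp
qed

text \<open>Even \<open>k\<close> drop out, and \<open>k = 2 * j - 1\<close> makes the Lerch order
  \<open>Suc k\<close> equal to \<open>2 * j\<close>.\<close>

lemma sum_odd_reindex:
  fixes g :: "nat \<Rightarrow> real"
  shows "(\<Sum>k\<le>m. (1 - (-1) ^ k) * g k) = 2 * (\<Sum>j = 1..Suc m div 2. g (2 * j - 1))"
proof -
  have "(\<Sum>k\<le>m. (1 - (-1) ^ k) * g k) = (\<Sum>k\<in>{k. k \<le> m \<and> odd k}. 2 * g k)"
    by (rule sum.mono_neutral_cong_right) auto
  also have "\<dots> = (\<Sum>j = 1..Suc m div 2. 2 * g (2 * j - 1))"
    by (rule sum.reindex_bij_witness[of _ "\<lambda>j. 2 * j - 1" "\<lambda>k. (k + 1) div 2"]) (auto elim!: oddE)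
  finally show ?thesis by (simp add: sum_distrib_left)
qed

text \<open>The limit of the real part of \<open>approx_value\<close>, indexed as it arises;
  \<open>limit_value_eq\<close> brings it to the form of the theorem.\<close>

definition limit_value :: "real \<Rightarrow> real \<Rightarrow> nat \<Rightarrow> nat \<Rightarrow> nat \<Rightarrow> real" where
  "limit_value a b n p m = (let c = a ^ n * b; \<phi> = \<lambda>r t. c * (fact r * lerch c (Suc r) t) in
     1 / fact (p - 1) *
     (- (a * (1 + (-1) ^ Suc m) * fact m * lerch a (Suc m) 1) * \<phi> (p - 1) 1
      + 1 / real n ^ Suc m *
          ((\<Sum>k\<le>m. real (m choose k) * (b * (1 - (-1) ^ k) * fact k * lerch b (Suc k) 1 * \<phi> (p - 1 + (m - k)) 1))
           - 1 / real (Suc m) * \<phi> (p - 1 + Suc m) 1)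
      - (\<Sum>j = 1..<n. a ^ j / real n ^ Suc m *
          (\<Sum>k\<le>m. real (m choose k) *
             ((-1) ^ k * fact k * Theta b (Suc k) (real j) (real n) * \<phi> (p - 1 + (m - k)) (1 - real j / real n))))))"

lemma approx_value_tendsto:
  assumes a: "a \<in> {1, -1}" and b: "b \<in> {1, -1}" and p: "p \<ge> 1" "a ^ n * b = 1 \<Longrightarrow> p \<noteq> 1"
  shows "(\<lambda>N. Re (approx_value a n p m (unit_seq b N) (unit_seq (a ^ n * b) N))) \<longlonglongrightarrow> limit_value a b n p m"
proof -
  define c where "c = a ^ n * b"
  have c: "c \<in> {1, -1}"
  proof -
    have "a ^ n \<in> {1, -1}" using a by (cases "even n") auto
    then show ?thesis using b by (auto simp: c_def)
  qed
  define F where "F = (\<lambda>r t N. unit_seq c N * lerch_int r t (unit_seq c N))"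
  define \<phi> where "\<phi> = (\<lambda>r t. c * (fact r * lerch c (Suc r) t))"
  \<comment> \<open>If \<open>c = 1\<close>, then \<open>p \<ge> 2\<close>, so the power of the
    logarithm is positive and the divergent case does not occur.\<close>
  have F: "F (p - 1 + i) t \<longlonglongrightarrow> of_real (\<phi> (p - 1 + i) t)" if "t > 0" for i t
    unfolding F_def \<phi>_def of_real_mult[of c]
    using p that by (intro tendsto_mult unit_seq_tendsto lerch_int_tendsto c) (auto simp: c_def)
  have F0: "F (p - 1) 1 \<longlonglongrightarrow> of_real (\<phi> (p - 1) 1)" using F[of 1 0] by simp
  have ReF: "(\<lambda>N. Re (F (p - 1) 1 N)) \<longlonglongrightarrow> \<phi> (p - 1) 1"
      "(\<lambda>N. Re (F (p - 1 + Suc m) 1 N)) \<longlonglongrightarrow> \<phi> (p - 1 + Suc m) 1"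
    using tendsto_Re[OF F0] tendsto_Re[OF F[of 1 "Suc m"]] by simp_all
  have W: "(\<lambda>N. Re (mellin_resolvent_0 k (unit_seq b N) * F (p - 1 + i) 1 N))
      \<longlonglongrightarrow> b * (1 - (-1) ^ k) * fact k * lerch b (Suc k) 1 * \<phi> (p - 1 + i) 1" for k i
    by (intro tendsto_Re_mult F mellin_resolvent_0_limits b) simp
  have V: "(\<lambda>N. Re (mellin_resolvent k (real j / real n) (unit_seq b N) * F (p - 1 + i) (1 - real j / real n) N))
      \<longlonglongrightarrow> (-1) ^ k * fact k * Theta b (Suc k) (real j) (real n) * \<phi> (p - 1 + i) (1 - real j / real n)"
    if "j \<in> {1..<n}" for k i j
    using that by (intro tendsto_Re_mult F mellin_resolvent_limits b) auto
  have Re_mult: "Re (complex_of_real r * w) = r * Re w" for r w by simp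
  have eq: "Re (approx_value a n p m (unit_seq b N) (unit_seq c N)) =
     1 / fact (p - 1) *
     (- (a * (1 + (-1) ^ Suc m) * fact m * lerch a (Suc m) 1) * Re (F (p - 1) 1 N)
      + 1 / real n ^ Suc m *
          ((\<Sum>k\<le>m. real (m choose k) * Re (mellin_resolvent_0 k (unit_seq b N) * F (p - 1 + (m - k)) 1 N))
           - 1 / real (Suc m) * Re (F (p - 1 + Suc m) 1 N))
      - (\<Sum>j = 1..<n. a ^ j / real n ^ Suc m *
          (\<Sum>k\<le>m. real (m choose k) *
             Re (mellin_resolvent k (real j / real n) (unit_seq b N) * F (p - 1 + (m - k)) (1 - real j / real n) N))))" for N
    unfolding approx_value_def F_def
    by (simp only: Re_mult Re_sum plus_complex.sel minus_complex.sel)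
  have lim: "limit_value a b n p m =
     1 / fact (p - 1) *
     (- (a * (1 + (-1) ^ Suc m) * fact m * lerch a (Suc m) 1) * \<phi> (p - 1) 1
      + 1 / real n ^ Suc m *
          ((\<Sum>k\<le>m. real (m choose k) * (b * (1 - (-1) ^ k) * fact k * lerch b (Suc k) 1 * \<phi> (p - 1 + (m - k)) 1))
           - 1 / real (Suc m) * \<phi> (p - 1 + Suc m) 1)
      - (\<Sum>j = 1..<n. a ^ j / real n ^ Suc m *
          (\<Sum>k\<le>m. real (m choose k) *
             ((-1) ^ k * fact k * Theta b (Suc k) (real j) (real n) * \<phi> (p - 1 + (m - k)) (1 - real j / real n)))))"
    by (simp only: limit_value_def Let_def c_def \<phi>_def)
  show ?thesis
    unfolding c_def[symmetric] eq lim
    by (intro tendsto_mult tendsto_diff tendsto_add tendsto_const tendsto_sum ReF W V)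
qed

lemma limit_value_eq:
  fixes a b :: real
  assumes a: "a \<in> {1, -1}" and b: "b \<in> {1, -1}" and p: "p \<ge> 1" and n: "n \<ge> 1" and q: "q = Suc m"
  shows "limit_value a b n p m =
      - (a ^ (n - 1) * b * (1 + (-1) ^ q) * fact (q - 1)
          * lerch (a ^ n * b) p 1 * lerch a q 1)
      + 2 * a ^ n / real n ^ q * fact (q - 1) *
          (\<Sum>j = 0..q div 2. real ((p + q - 2 * j - 1) choose (p - 1))
             * lerch b (2 * j) 1 * lerch (a ^ n * b) (p + q - 2 * j) 1)
      + a ^ (n - 1) * b / real n ^ q * fact (q - 1) *
          (\<Sum>j = 2..n. \<Sum>k = 1..q. real ((p + q - k - 1) choose (p - 1))
             * a ^ j * (-1) ^ k * Theta b k (real j - 1) (real n)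
             * lerch (a ^ n * b) (p + q - k) ((real n - real j + 1) / real n))"
proof -
  define c where "c = a ^ n * b"
  define r where "r = p - 1"
  have pr: "p = Suc r" using p by (simp add: r_def)
  have aa: "a * a = 1" "b * b = 1" using a b by auto
  have an: "a ^ n = a * a ^ (n - 1)" using n by (cases n) auto
  have an': "a * a ^ n = a ^ (n - 1)" unfolding an using aa by (simp flip: mult.assoc)
  define \<phi> where "\<phi> = (\<lambda>i t. c * (fact i * lerch c (Suc i) t))"
  define g where "g = (\<lambda>k. real ((r + (m - k)) choose r) * lerch b (Suc k) 1 * lerch c (Suc (r + (m - k))) 1)"
  define M where "M = 1 / real n ^ Suc m"
  have ch: "real (m choose k) * fact k * fact (r + (m - k)) / fact r = fact m * real ((r + (m - k)) choose r)"
    if "k \<le> m" for k by (rule choose_fact_quotient[OF that])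
  have t1: "1 / fact r * (- (a * (1 + (-1) ^ Suc m) * fact m * lerch a (Suc m) 1) * \<phi> r 1)
      = - (a ^ (n - 1) * b * (1 + (-1) ^ q) * fact (q - 1) * lerch c p 1 * lerch a q 1)"
  proof -
    have "1 / fact r * (- (a * (1 + (-1) ^ Suc m) * fact m * lerch a (Suc m) 1) * \<phi> r 1)
      = - ((a * a ^ n) * b * (1 + (-1) ^ q) * fact (q - 1) * lerch c p 1 * lerch a q 1)"
      by (simp add: \<phi>_def c_def q pr)
    then show ?thesis unfolding an' .
  qed
  have t2: "1 / fact r * (\<Sum>k\<le>m. real (m choose k) * (b * (1 - (-1) ^ k) * fact k * lerch b (Suc k) 1 * \<phi> (r + (m - k)) 1))
      = 2 * a ^ n * fact (q - 1) * (\<Sum>j = 1..q div 2. g (2 * j - 1))"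
  proof -
    have "1 / fact r * (\<Sum>k\<le>m. real (m choose k) * (b * (1 - (-1) ^ k) * fact k * lerch b (Suc k) 1 * \<phi> (r + (m - k)) 1))
        = (\<Sum>k\<le>m. a ^ n * fact m * ((1 - (-1) ^ k) * g k))"
      unfolding sum_distrib_left
    proof (intro sum.cong refl)
      fix k assume "k \<in> {..m}"
      then have k: "k \<le> m" by simp
      have "1 / fact r * (real (m choose k) * (b * (1 - (-1) ^ k) * fact k * lerch b (Suc k) 1 * \<phi> (r + (m - k)) 1))
        = (b * b) * a ^ n * (real (m choose k) * fact k * fact (r + (m - k)) / fact r)
           * ((1 - (-1) ^ k) * (lerch b (Suc k) 1 * lerch c (Suc (r + (m - k))) 1))"
        by (simp add: \<phi>_def c_def mult_ac)
      also have "\<dots> = a ^ n * fact m * ((1 - (-1) ^ k) * g k)"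
        unfolding ch[OF k] aa g_def by (simp add: mult_ac)
      finally show "1 / fact r * (real (m choose k) * (b * (1 - (-1) ^ k) * fact k * lerch b (Suc k) 1 * \<phi> (r + (m - k)) 1))
        = a ^ n * fact m * ((1 - (-1) ^ k) * g k)" .
    qed
    also have "\<dots> = a ^ n * fact m * (2 * (\<Sum>j = 1..q div 2. g (2 * j - 1)))"
      unfolding q sum_odd_reindex[symmetric] by (simp add: sum_distrib_left)
    finally show ?thesis by (simp add: q)
  qed
  \<comment> \<open>The leftover power of \<open>ln y\<close> becomes the summand
    \<open>j = 0\<close>: the values -1/2 for \<open>b = 1\<close> and 1/2 for \<open>b = -1\<close>
    satisfy \<open>2 * lerch b 0 1 = - b\<close> in both cases.\<close>
  have t2': "1 / fact r * (1 / real (Suc m) * \<phi> (r + Suc m) 1)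
      = - (2 * a ^ n * fact (q - 1) * (real ((p + q - 2 * 0 - 1) choose (p - 1)) * lerch b (2 * 0) 1 * lerch c (p + q - 2 * 0) 1))"
  proof -
    have "real ((r + Suc m) choose r) = fact (r + Suc m) / (fact r * fact (r + Suc m - r))"
      by (rule binomial_fact) simp
    then have "fact m * real ((r + Suc m) choose r) = fact (r + Suc m) / (fact r * real (Suc m))"
      by (simp del: of_nat_Suc)
    moreover have "2 * lerch b 0 1 = - b" using b by (auto simp: lerch_def)
    moreover have "1 / fact r * (1 / real (Suc m) * \<phi> (r + Suc m) 1)
      = a ^ n * b * (fact (r + Suc m) / (fact r * real (Suc m))) * lerch c (Suc (r + Suc m)) 1"
      by (simp add: \<phi>_def c_def del: of_nat_Suc fact_Suc)
    ultimately have "1 / fact r * (1 / real (Suc m) * \<phi> (r + Suc m) 1)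
      = a ^ n * (- (2 * lerch b 0 1)) * (fact m * real ((r + Suc m) choose r)) * lerch c (Suc (r + Suc m)) 1"
      by simp
    then show ?thesis by (simp add: pr q)
  qed
  have sum0: "(\<Sum>j = 0..q div 2. real ((p + q - 2 * j - 1) choose (p - 1)) * lerch b (2 * j) 1 * lerch c (p + q - 2 * j) 1)
      = real ((p + q - 2 * 0 - 1) choose (p - 1)) * lerch b (2 * 0) 1 * lerch c (p + q - 2 * 0) 1
        + (\<Sum>j = 1..q div 2. g (2 * j - 1))"
  proof -
    have "real ((p + q - 2 * j - 1) choose (p - 1)) * lerch b (2 * j) 1 * lerch c (p + q - 2 * j) 1 = g (2 * j - 1)"
      if "j \<in> {1..q div 2}" for j
    proof -
      have j: "1 \<le> j" "2 * j \<le> Suc m" using that by (auto simp: q)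
      then have "p + q - 2 * j - 1 = r + (m - (2 * j - 1))" "2 * j = Suc (2 * j - 1)"
          "p + q - 2 * j = Suc (r + (m - (2 * j - 1)))"
        by (auto simp: pr q)
      then show ?thesis by (simp add: g_def r_def)
    qed
    then show ?thesis by (simp add: sum.atLeast_Suc_atMost)
  qed
  \<comment> \<open>Shifting \<open>j\<close> and \<open>k\<close> by one puts the factor
    \<open>- a\<close> into the summands; as \<open>a * a = 1\<close>, the prefactor
    \<open>a ^ n\<close> becomes \<open>- a ^ (n - 1)\<close>.\<close>
  have t3: "1 / fact r * (\<Sum>j = 1..<n. a ^ j / real n ^ Suc m *
          (\<Sum>k\<le>m. real (m choose k) *
             ((-1) ^ k * fact k * Theta b (Suc k) (real j) (real n) * \<phi> (r + (m - k)) (1 - real j / real n))))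
     = - (a ^ (n - 1) * b / real n ^ q * fact (q - 1) *
          (\<Sum>j = 2..n. \<Sum>k = 1..q. real ((p + q - k - 1) choose (p - 1))
             * a ^ j * (-1) ^ k * Theta b k (real j - 1) (real n)
             * lerch c (p + q - k) ((real n - real j + 1) / real n)))"
  proof -
    define h where "h = (\<lambda>j k. real ((r + (m - k)) choose r) * a ^ Suc j * (-1) ^ Suc k * Theta b (Suc k) (real j) (real n)
             * lerch c (Suc (r + (m - k))) (1 - real j / real n))"
    have "(\<Sum>j = 2..n. \<Sum>k = 1..q. real ((p + q - k - 1) choose (p - 1))
             * a ^ j * (-1) ^ k * Theta b k (real j - 1) (real n)
             * lerch c (p + q - k) ((real n - real j + 1) / real n)) = (\<Sum>j = 1..<n. \<Sum>k\<le>m. h j k)"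
    proof (rule sum.reindex_bij_witness[of _ Suc "\<lambda>j. j - 1"])
      fix j assume j: "j \<in> {2..n}"
      then have j': "Suc (j - 1) = j" "real (j - 1) = real j - 1" "1 - (real j - 1) / real n = (real n - real j + 1) / real n"
        using n by (auto simp: of_nat_diff field_simps)
      show "(\<Sum>k\<le>m. h (j - 1) k) = (\<Sum>k = 1..q. real ((p + q - k - 1) choose (p - 1))
             * a ^ j * (-1) ^ k * Theta b k (real j - 1) (real n)
             * lerch c (p + q - k) ((real n - real j + 1) / real n))"
        unfolding h_def j'
      proof (rule sum.reindex_bij_witness[of _ "\<lambda>k. k - 1" Suc])
        fix k assume k: "k \<in> {..m}"
        then have "p + q - Suc k - 1 = r + (m - k)" "p + q - Suc k = Suc (r + (m - k))"
          by (auto simp: pr q)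
        then show "real ((p + q - Suc k - 1) choose (p - 1))
             * a ^ j * (-1) ^ Suc k * Theta b (Suc k) (real j - 1) (real n)
             * lerch c (p + q - Suc k) ((real n - real j + 1) / real n)
          = real ((r + (m - k)) choose r) * a ^ j * (-1) ^ Suc k * Theta b (Suc k) (real j - 1) (real n)
             * lerch c (Suc (r + (m - k))) ((real n - real j + 1) / real n)"
          by (simp add: r_def)
      qed (auto simp: q)
    qed (use n in auto)
    then have rhs: "- (a ^ (n - 1) * b / real n ^ q * fact (q - 1) *
          (\<Sum>j = 2..n. \<Sum>k = 1..q. real ((p + q - k - 1) choose (p - 1))
             * a ^ j * (-1) ^ k * Theta b k (real j - 1) (real n)
             * lerch c (p + q - k) ((real n - real j + 1) / real n)))
        = (\<Sum>j = 1..<n. \<Sum>k\<le>m. - (a ^ (n - 1) * b / real n ^ q * fact (q - 1)) * h j k)"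
      by (simp add: sum_distrib_left sum_negf)
    have eq: "1 / fact r * (a ^ j / real n ^ Suc m * (real (m choose k) *
             ((-1) ^ k * fact k * Theta b (Suc k) (real j) (real n) * \<phi> (r + (m - k)) (1 - real j / real n))))
        = - (a ^ (n - 1) * b / real n ^ q * fact (q - 1)) * h j k" if "k \<le> m" for j k
    proof -
      have "1 / fact r * (a ^ j / real n ^ Suc m * (real (m choose k) *
             ((-1) ^ k * fact k * Theta b (Suc k) (real j) (real n) * \<phi> (r + (m - k)) (1 - real j / real n))))
        = (real (m choose k) * fact k * fact (r + (m - k)) / fact r) * (a ^ n * b / real n ^ q) * (a ^ j * (-1) ^ k *
             Theta b (Suc k) (real j) (real n) * lerch c (Suc (r + (m - k))) (1 - real j / real n))"
        by (simp add: \<phi>_def c_def q mult_ac)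
      also have "\<dots> = - (a ^ (n - 1) * b / real n ^ q * fact (q - 1)) * h j k"
        unfolding ch[OF that] h_def an by (simp add: q mult_ac)
      finally show ?thesis .
    qed
    show ?thesis
      unfolding rhs unfolding sum_distrib_left by (intro sum.cong refl eq) auto
  qed
  have "limit_value a b n p m = 1 / fact r * (- (a * (1 + (-1) ^ Suc m) * fact m * lerch a (Suc m) 1) * \<phi> r 1)
     + M * (1 / fact r * (\<Sum>k\<le>m. real (m choose k) * (b * (1 - (-1) ^ k) * fact k * lerch b (Suc k) 1 * \<phi> (r + (m - k)) 1))
        - 1 / fact r * (1 / real (Suc m) * \<phi> (r + Suc m) 1))
     - 1 / fact r * (\<Sum>j = 1..<n. a ^ j / real n ^ Suc m *
          (\<Sum>k\<le>m. real (m choose k) *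
             ((-1) ^ k * fact k * Theta b (Suc k) (real j) (real n) * \<phi> (r + (m - k)) (1 - real j / real n))))"
    unfolding limit_value_def Let_def r_def[symmetric] c_def[symmetric] \<phi>_def M_def
    by (simp only: right_diff_distrib distrib_left mult.left_commute[of "1 / fact r"])
  also have "\<dots> = - (a ^ (n - 1) * b * (1 + (-1) ^ q) * fact (q - 1) * lerch c p 1 * lerch a q 1)
      + 2 * a ^ n / real n ^ q * fact (q - 1) *
          (\<Sum>j = 0..q div 2. real ((p + q - 2 * j - 1) choose (p - 1)) * lerch b (2 * j) 1 * lerch c (p + q - 2 * j) 1)
      + a ^ (n - 1) * b / real n ^ q * fact (q - 1) *
          (\<Sum>j = 2..n. \<Sum>k = 1..q. real ((p + q - k - 1) choose (p - 1))
             * a ^ j * (-1) ^ k * Theta b k (real j - 1) (real n)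
             * lerch c (p + q - k) ((real n - real j + 1) / real n))"
  proof -
    have alg: "X + M * (2 * u * f * S - - (2 * u * f * E)) - - Z = X + 2 * u / D * f * (E + S) + Z"
      if "M = 1 / D" for X u f S E Z D :: real
      using that by (simp add: algebra_simps add_divide_distrib)
    show ?thesis unfolding t1 t2 t2' t3 sum0
      by (rule alg) (simp add: M_def q)
  qed
  finally show ?thesis unfolding c_def .
qed

theorem theorem1:
  fixes p q n :: nat and a b :: real
  assumes "p \<ge> 1" and "q \<ge> 1" and "n \<ge> 1"
    and "a \<in> {1, -1}" and "b \<in> {1, -1}"
    and "a ^ n * b = 1 \<Longrightarrow> p \<noteq> 1"
    and "a = 1 \<Longrightarrow> q \<noteq> 1"
  shows "((\<lambda>x. ln x ^ (q - 1) * polylog p (b * x ^ n) / (x * (1 - a * x))) has_integral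
     (- (a ^ (n - 1) * b * (1 + (-1) ^ q) * fact (q - 1)
          * lerch (a ^ n * b) p 1 * lerch a q 1)
      + 2 * a ^ n / real n ^ q * fact (q - 1) *
          (\<Sum>j = 0..q div 2. real ((p + q - 2 * j - 1) choose (p - 1))
             * lerch b (2 * j) 1 * lerch (a ^ n * b) (p + q - 2 * j) 1)
      + a ^ (n - 1) * b / real n ^ q * fact (q - 1) *
          (\<Sum>j = 2..n. \<Sum>k = 1..q. real ((p + q - k - 1) choose (p - 1))
             * a ^ j * (-1) ^ k * Theta b k (real j - 1) (real n)
             * lerch (a ^ n * b) (p + q - k) ((real n - real j + 1) / real n))))
     {0<..}"
proof -
  define q' where "q' = q - 1"
  have q': "q = Suc q'" using assms(2) by (simp add: q'_def)
  have a: "a \<in> {1, -1}" and b: "b \<in> {1, -1}" and aq: "a = 1 \<Longrightarrow> q' \<noteq> 0"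
    using assms q' by auto
  have c: "a ^ n * b \<in> {1, -1}"
    using a b by (cases "even n") auto
  have z: "norm (unit_seq b N) = 1" "unit_seq b N \<noteq> 1" for N
    using norm_unit_seq[OF b] unit_seq_neq_1[OF b] by auto
  \<comment> \<open>At \<open>x = 1\<close> also \<open>x ^ n = 1\<close>, where neither the uniform
    bound nor the pointwise limit has been established.\<close>
  let ?S = "{0<..} - {1::real}"
  let ?f = "\<lambda>N x. log_kernel q a x * re_polylog p (unit_seq b N * of_real (x ^ n))"
  let ?y = "\<lambda>N. Re (approx_value a n p q' (unit_seq b N) (unit_seq (a ^ n * b) N))"
  obtain D where D: "D integrable_on {0<..}"
    "\<And>z x. norm z = 1 \<Longrightarrow> x > 0 \<Longrightarrow> x \<noteq> 1 \<Longrightarrow> \<bar>log_kernel q a x * re_polylog p (z * of_real (x ^ n))\<bar> \<le> D x"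
    using re_polylog_dominated[OF a assms(7,1,2,3)] by blast
  have 1: "D integrable_on ?S"
    by (rule integrable_spike_set[OF D(1)]) (rule negligible_subset[of "{1}"], auto)+
  have 2: "(?f N has_integral ?y N) ?S" for N
  proof -
    have eq: "unit_seq (a ^ n * b) N = of_real (a ^ n) * unit_seq b N" by simp
    have "(?f N has_integral ?y N) {0<..}"
      unfolding q' by (rule log_kernel_re_polylog_value[OF a aq assms(1,3) z eq unit_seq_neq_1[OF c]])
    then show ?thesis
      by (rule iffD1[OF has_integral_spike_set_eq, rotated 2]) (rule negligible_subset[of "{1}"], auto)+
  qed
  have 3: "?y \<longlonglongrightarrow> limit_value a b n p q'"
    by (rule approx_value_tendsto[OF a b assms(1,6)])
  have 4: "(\<lambda>N. ?f N x) \<longlonglongrightarrow> log_kernel q a x * polylog p (b * x ^ n)" if x: "x \<in> ?S" for x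
  proof -
    have xn: "x ^ n > 0" "x ^ n \<noteq> 1"
      using x power_eq_iff_eq_base[of n x 1] assms(3) by auto
    show ?thesis
      unfolding polylog_eq_re_polylog[OF assms(1) b xn]
      by (intro tendsto_mult tendsto_const re_polylog_tendsto b xn)
  qed
  have 5: "norm (?f N x) \<le> D x" if "x \<in> ?S" for N x
    unfolding real_norm_def by (rule D(2)[OF z(1)]) (use that in auto)
  \<comment> \<open>Dominated convergence also yields integrability of the limit: the integral over
    \<open>x\<close> exists in the ordinary sense, and principal values occur only inside
    \<open>polylog\<close>.\<close>
  have "((\<lambda>x. log_kernel q a x * polylog p (b * x ^ n)) has_integral limit_value a b n p q') ?S"
    by (rule has_integral_dominated_convergence[OF 2 1 ballI[OF 5] ballI[OF 4] 3])
  then have "((\<lambda>x. log_kernel q a x * polylog p (b * x ^ n)) has_integral limit_value a b n p q') {0<..}"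
    by (rule iffD1[OF has_integral_spike_set_eq, rotated 2]) (rule negligible_subset[of "{1}"], auto)+
  then show ?thesis
    unfolding limit_value_eq[OF a b assms(1,3) q', symmetric] by (simp add: log_kernel_def)
qed

end
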